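(* Let $T=(t_{ij})$ be an $m\times n$ matrix of $0$'s and $1$'s, with $2\leq m\leq n$, and let $K$ be the corresponding Bedford–McMullen carpet, the attractor of the IFS $$\left\{\tau_{ij}(x,y)=\left(\frac{x}{n}+\frac{i}{n},\frac{y}{m}+\frac{j}{m}\right):t_{ij}=1\right\}.$$ Let $p_{ij}>0$ (for $t_{ij}=1$) be the weights of this IFS, with $\sum_{t_{ij}=1}p_{ij}=1$. Let $\mu$ be the invariant measure of this weighted IFS, with Rokhlin disintegrations $\mu=\rho_x(dy)\,\mu_1(dx)=\rho^y(dx)\,\mu_2(dy)$. Let $$\gamma_1=\max_i\Big\{\sum_{j:\,t_{ij}=1}p_{ij}\Big\},\qquad \gamma_2=\max_j\Big\{\sum_{i:\,t_{ij}=1}p_{ij}\Big\}$$ be the maximal total weight in any single column or row, respectively. Let $r_j$ denote the number of $1$'s in the $j$th row of $T$, and define $$\xi_1=\left(\sum_{j=0}^{m-1}r_j^{\frac{\ln m}{\ln n}}\right)^{\frac{\ln n}{\ln m}},\qquad \xi_2=\sum_{j=0}^{m-1}r_j^{\frac{\ln m}{\ln n}}.$$ Then: (1) If $\gamma_1<\frac{n}{\xi_1}$, then $\mu_1$-almost every slice measure $\rho_x$ is singular, and every $f\in L^2(\mu)$ can be written as $$f(x,y)=\sum_{k=0}^{\infty}\sum_{l=0}^{\infty}d_{kl}e^{2\pi i(ky+lx)}\quad\text{or}\quad f(x,y)=\sum_{k=0}^{\infty}\sum_{l=-\infty}^{\infty}d_{kl}e^{2\pi i(ky+lx)}$$ according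 to whether $\mu_1$ is singular or Lebesgue measure. (2) If $\gamma_2<\frac{m}{\xi_2}$, then $\mu_2$-almost every slice measure $\rho^y$ is singular, and every $f\in L^2(\mu)$ can be written as $$f(x,y)=\sum_{k=0}^{\infty}\sum_{l=0}^{\infty}d_{kl}e^{2\pi i(kx+ly)}\quad\text{or}\quad f(x,y)=\sum_{k=0}^{\infty}\sum_{l=-\infty}^{\infty}d_{kl}e^{2\pi i(kx+ly)}$$ according to whether $\mu_2$ is singular or Lebesgue measure. In all cases $d_{kl}\in\mathbb{C}$ depend on $f$ and the series converges conditionally in the norm of $L^2(\mu)$.
   Context: Indexing of $T$: rows are indexed by $0\le j\le m-1$ from bottom to top, columns by $0\le i\le n-1$ from left to right, and $t_{ij}$ is the entry in column $i$ and row $j$. The attractor $K$ is the unique nonempty compact set with $K=\bigcup_{t_{ij}=1}\tau_{ij}(K)$, and the invariant measure $\mu$ is the unique Borel probability measure on $\mathbb{R}^2$, supported on $K\subseteq[0,1]^2$, with $\int f\,d\mu=\sum_{t_{ij}=1}p_{ij}\int f\circ\tau_{ij}\,d\mu$ for every continuous $f$. "Singular" means singular with respect to Lebesgue measure. The marginals are $\mu_1=\mu\circ\pi_x^{-1}$, $\mu_2=\mu\circ\pi_y^{-1}$, with $\pi_x(x,y)=x$, $\pi_y(x,y)=y$. Rokhlin disintegrations: there are families of Borel probability measures $\{\rho_x\}$, $\{\rho^y\}$ on $[0,1]$ (slice measures), unique up to $\mu_1$-null, respectively $\mu_2$-null, sets, with $\int f\,d\mu=\int\int f(x,y)\,\rho_x(dy)\,\mu_1(dx)=\int\int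 f(x,y)\,\rho^y(dx)\,\mu_2(dy)$ for all $f\in L^1(\mu)$. In the definition of $\xi_1,\xi_2$, $0^{\ln m/\ln n}=0$. Conditional convergence in norm: the double sum is an iterated sum (for each $k$ the inner sum over $l$ converges in $L^2(\mu)$, and then the outer sum over $k$ converges in $L^2(\mu)$); unconditional convergence is not claimed. *)

theory Defs
  imports "HOL-Probability.Probability"
begin

text \<open>
  A 0-1 matrix with m rows and n columns is a function t of two natural numbers, of which only the
  arguments i < n, j < m matter. The FIRST index is the column (left to right), the second one the
  row (bottom to top).
\<close>

definition ones :: "nat \<Rightarrow> nat \<Rightarrow> (nat \<Rightarrow> nat \<Rightarrow> nat) \<Rightarrow> (nat \<times> nat) set" where
  "ones m n t = {(i, j). i < n \<and> j < m \<and> t i j = 1}"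

definition tau :: "nat \<Rightarrow> nat \<Rightarrow> nat \<Rightarrow> nat \<Rightarrow> real \<times> real \<Rightarrow> real \<times> real" where
  "tau m n i j = (\<lambda>(x, y). (x / real n + real i / real n, y / real m + real j / real m))"

definition is_attractor :: "nat \<Rightarrow> nat \<Rightarrow> (nat \<Rightarrow> nat \<Rightarrow> nat) \<Rightarrow> (real \<times> real) set \<Rightarrow> bool" where
  "is_attractor m n t K \<longleftrightarrow>
     compact K \<and> K \<noteq> {} \<and> K = (\<Union>(i, j)\<in>ones m n t. tau m n i j ` K)"

definition is_invariant_measure ::
  "nat \<Rightarrow> nat \<Rightarrow> (nat \<Rightarrow> nat \<Rightarrow> nat) \<Rightarrow> (nat \<Rightarrow> nat \<Rightarrow> real) \<Rightarrow> (real \<times> real) set \<Rightarrow>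
     (real \<times> real) measure \<Rightarrow> bool" where
  "is_invariant_measure m n t p K \<mu> \<longleftrightarrow>
     prob_space \<mu> \<and> sets \<mu> = sets borel \<and> emeasure \<mu> (- K) = 0 \<and>
     (\<forall>f :: real \<times> real \<Rightarrow> complex. continuous_on UNIV f \<longrightarrow>
        (\<integral>z. f z \<partial>\<mu>) = (\<Sum>(i, j)\<in>ones m n t. of_real (p i j) * (\<integral>z. f (tau m n i j z) \<partial>\<mu>)))"

abbreviation x_marginal :: "(real \<times> real) measure \<Rightarrow> real measure" where
  "x_marginal \<mu> \<equiv> distr \<mu> borel fst"

abbreviation y_marginal :: "(real \<times> real) measure \<Rightarrow> real measure" where
  "y_marginal \<mu> \<equiv> distr \<mu> borel snd"

definition lebesgue_singular :: "real measure \<Rightarrow> bool" where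
  "lebesgue_singular \<nu> \<longleftrightarrow>
     (\<exists>A\<in>sets borel. emeasure lborel A = 0 \<and> emeasure \<nu> (- A) = 0)"

abbreviation lebesgue_unit :: "real measure" where
  "lebesgue_unit \<equiv> uniform_measure lborel {0..1}"

text \<open>
  Rokhlin disintegration of \<mu> over its marginal \<nu>. The first argument puts the base coordinate s
  and the slice coordinate u into place: it is \<lambda>s u. (s, u) for vertical slices over the x-axis and
  \<lambda>s u. (u, s) for horizontal slices over the y-axis. The inner integrability is only required
  almost everywhere; measurability of the kernel is the case of f an indicator function.
\<close>

definition is_disintegration ::
  "(real \<Rightarrow> real \<Rightarrow> real \<times> real) \<Rightarrow> (real \<times> real) measure \<Rightarrow> real measure \<Rightarrow>
     (real \<Rightarrow> real measure) \<Rightarrow> bool" where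
  "is_disintegration c \<mu> \<nu> \<rho> \<longleftrightarrow>
     (\<forall>s. prob_space (\<rho> s) \<and> sets (\<rho> s) = sets borel \<and> emeasure (\<rho> s) {0..1} = 1) \<and>
     (\<forall>f :: real \<times> real \<Rightarrow> complex. integrable \<mu> f \<longrightarrow>
        (AE s in \<nu>. integrable (\<rho> s) (\<lambda>u. f (c s u))) \<and>
        integrable \<nu> (\<lambda>s. \<integral>u. f (c s u) \<partial>\<rho> s) \<and>
        (\<integral>z. f z \<partial>\<mu>) = (\<integral>s. (\<integral>u. f (c s u) \<partial>\<rho> s) \<partial>\<nu>))"

definition max_column_weight ::
  "nat \<Rightarrow> nat \<Rightarrow> (nat \<Rightarrow> nat \<Rightarrow> nat) \<Rightarrow> (nat \<Rightarrow> nat \<Rightarrow> real) \<Rightarrow> real" where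
  "max_column_weight m n t p = (MAX i\<in>{..<n}. \<Sum>j | j < m \<and> t i j = 1. p i j)"

definition max_row_weight ::
  "nat \<Rightarrow> nat \<Rightarrow> (nat \<Rightarrow> nat \<Rightarrow> nat) \<Rightarrow> (nat \<Rightarrow> nat \<Rightarrow> real) \<Rightarrow> real" where
  "max_row_weight m n t p = (MAX j\<in>{..<m}. \<Sum>i | i < n \<and> t i j = 1. p i j)"

definition row_count :: "nat \<Rightarrow> (nat \<Rightarrow> nat \<Rightarrow> nat) \<Rightarrow> nat \<Rightarrow> nat" where
  "row_count n t j = card {i. i < n \<and> t i j = 1}"

text \<open>Empty rows contribute nothing below, since 0 powr a = 0.\<close>

definition xi2 :: "nat \<Rightarrow> nat \<Rightarrow> (nat \<Rightarrow> nat \<Rightarrow> nat) \<Rightarrow> real" where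
  "xi2 m n t = (\<Sum>j<m. real (row_count n t j) powr (ln (real m) / ln (real n)))"

definition xi1 :: "nat \<Rightarrow> nat \<Rightarrow> (nat \<Rightarrow> nat \<Rightarrow> nat) \<Rightarrow> real" where
  "xi1 m n t = (\<Sum>j<m. real (row_count n t j) powr (ln (real m) / ln (real n)))
                  powr (ln (real n) / ln (real m))"

definition L2 :: "'a measure \<Rightarrow> ('a \<Rightarrow> complex) set" where
  "L2 M = {f \<in> borel_measurable M. integrable M (\<lambda>z. (cmod (f z))\<^sup>2)}"

text \<open>
  Norm convergence is stated with the nonnegative integral, as the Bochner integral of a
  non-integrable function is 0 by convention.
\<close>

definition L2_tendsto ::
  "'a measure \<Rightarrow> ('i \<Rightarrow> 'a \<Rightarrow> complex) \<Rightarrow> ('a \<Rightarrow> complex) \<Rightarrow> 'i filter \<Rightarrow> bool" where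
  "L2_tendsto M S g F \<longleftrightarrow>
     ((\<lambda>i. \<integral>\<^sup>+ z. ennreal ((cmod (S i z - g z))\<^sup>2) \<partial>M) \<longlongrightarrow> 0) F"

definition L2_sums :: "'a measure \<Rightarrow> (nat \<Rightarrow> 'a \<Rightarrow> complex) \<Rightarrow> ('a \<Rightarrow> complex) \<Rightarrow> bool" where
  "L2_sums M u g \<longleftrightarrow> g \<in> L2 M \<and> L2_tendsto M (\<lambda>N z. \<Sum>l<N. u l z) g sequentially"

text \<open>In a two-sided series the two ends of the summation range go to infinity independently.\<close>

definition L2_sums_bilateral ::
  "'a measure \<Rightarrow> (int \<Rightarrow> 'a \<Rightarrow> complex) \<Rightarrow> ('a \<Rightarrow> complex) \<Rightarrow> bool" where
  "L2_sums_bilateral M u g \<longleftrightarrow> g \<in> L2 M \<and>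
     L2_tendsto M (\<lambda>(A, B) z. \<Sum>l\<in>{- int A..int B}. u l z) g (sequentially \<times>\<^sub>F sequentially)"

definition L2_iterated_sums ::
  "'a measure \<Rightarrow> (nat \<Rightarrow> nat \<Rightarrow> 'a \<Rightarrow> complex) \<Rightarrow> ('a \<Rightarrow> complex) \<Rightarrow> bool" where
  "L2_iterated_sums M u f \<longleftrightarrow> (\<exists>g. (\<forall>k. L2_sums M (u k) (g k)) \<and> L2_sums M g f)"

definition L2_iterated_sums_bilateral ::
  "'a measure \<Rightarrow> (nat \<Rightarrow> int \<Rightarrow> 'a \<Rightarrow> complex) \<Rightarrow> ('a \<Rightarrow> complex) \<Rightarrow> bool" where
  "L2_iterated_sums_bilateral M u f \<longleftrightarrow>
     (\<exists>g. (\<forall>k. L2_sums_bilateral M (u k) (g k)) \<and> L2_sums M g f)"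

definition expi :: "real \<Rightarrow> complex" where
  "expi s = exp (2 * of_real pi * \<i> * of_real s)"

end

theory Submission
  imports Defs
begin

text \<open>
  Singularity of the slices. Let \<nu> be a marginal of \<mu>; it is self-similar. The expected Lebesgue length
  I of the slices of K with respect to \<nu> satisfies I \<le> \<theta> I, where \<theta> is the mean proportion of occupied
  cells in a column of the pattern drawn according to \<nu>. Hence I = 0 unless every nonempty column is
  full. In that exceptional case the bound on the maximal column weight reads \<gamma> < 1 / r with r the number
  of nonempty columns, which is absurd as the r column weights add up to 1. So no dimension theory is
  needed.

  Fourier series. For a singular probability measure on the circle the Kaczmarz algorithm (Kwapien and
  Mycielski) expands every L2 function in the nonnegative exponentials. The set of all f for which it
  converges is closed, contains 1, and contains f iff it contains the product of f with e(-x), provided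
  that it contains e(-x) itself; so only this one function matters. Its Kaczmarz coefficients are the
  Taylor coefficients of an analytic function b with 1 - |b|^2 \<le> min 1 (4 P), P the Poisson integral of
  the measure. As P tends to 0 in Lebesgue measure at the boundary, these coefficients have square
  sum 1, which is the claim. In the plane, the algorithm is run in every slice simultaneously, and its
  coefficients, functions on the base, are expanded once more: by the Kaczmarz algorithm if the marginal
  is singular, and in its ordinary Fourier series if it is Lebesgue measure.
\<close>

section \<open>Square integrable functions and trigonometric polynomials\<close>

text \<open>The double series is iterated because the fibre is expanded first: the Kaczmarz
  coefficients of the slices are functions on the base, and each of them is expanded by itself.
  Their measurability is an issue, since about the family \<rho> only the disintegration formula is
  known; it is settled by gluing the residuals of all slices into one function on the plane.

  Exponentials live on the circle, where 0 and 1 are one point, but the measures live on [0,1].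
  Hence the recurring alternative that all the mass lies in [0,1) or all of it at 1. It holds
  because self-similarity permits an atom at an endpoint only when the map fixing that endpoint
  carries the whole weight. The same fact disposes of the common boundaries of neighbouring columns,
  which could otherwise spoil I \<le> \<theta> I.

  That the marginal is either singular or Lebesgue measure has to be proved as well: uniform column
  weights force the distribution function of Lebesgue measure, and for all other weights the
  measures of the N-adic cells drift apart from their lengths.\<close>

definition wave :: "int \<Rightarrow> real \<Rightarrow> complex" where
  "wave k x = expi (of_int k * x)"

lemma expi_eq_cis: "expi s = cis (2 * pi * s)"
  by (simp add: expi_def cis_conv_exp mult_ac)

lemma wave_0 [simp]: "wave 0 x = 1"
  by (simp add: wave_def expi_eq_cis)

lemma wave_0_eq: "wave 0 = (\<lambda>x. 1)"
  by (simp add: fun_eq_iff)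

lemma wave_add: "wave (j + k) x = wave j x * wave k x"
  by (simp add: wave_def expi_eq_cis cis_mult algebra_simps)

lemma wave_diff: "wave (j - k) x = wave j x * wave (- k) x"
  using wave_add[of j "- k"] by simp

lemma cnj_wave: "cnj (wave k x) = wave (- k) x"
  by (simp add: wave_def expi_eq_cis cis_cnj)

lemma norm_wave [simp]: "cmod (wave k x) = 1"
  by (simp add: wave_def expi_eq_cis)

lemma wave_mult_minus [simp]: "wave k x * wave (- k) x = 1" "wave (- k) x * wave k x = 1"
  using wave_add[of k "- k" x] by (simp_all add: mult.commute)

lemma wave_of_nat: "wave (int k) x = wave 1 x ^ k"
proof -
  have "wave (int k) x = cis (real k * (2 * pi * x))"
    by (simp add: wave_def expi_eq_cis algebra_simps)
  also have "\<dots> = wave 1 x ^ k"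
    by (simp add: wave_def expi_eq_cis Complex.DeMoivre)
  finally show ?thesis .
qed

lemma continuous_wave [continuous_intros]:
  "continuous_on A g \<Longrightarrow> continuous_on A (\<lambda>x. wave k (g x))"
  unfolding wave_def expi_def by (intro continuous_intros)

lemma wave_measurable [measurable]: "wave k \<in> borel_measurable borel"
  by (intro borel_measurable_continuous_onI continuous_intros)

lemma wave_1_inj:
  assumes "0 \<le> x" "x < 1" "0 \<le> y" "y < 1" "wave 1 x = wave 1 y"
  shows "x = y"
proof -
  have "exp (2 * of_real pi * \<i> * of_real x) = exp (2 * of_real pi * \<i> * of_real y)"
    using assms(5) by (simp add: wave_def expi_def)
  then obtain j :: int where
    "2 * of_real pi * \<i> * of_real x = 2 * of_real pi * \<i> * of_real y + (of_int (2 * j) * pi) * \<i>"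
    by (auto simp: exp_eq)
  then have "Im (2 * of_real pi * \<i> * of_real x)
      = Im (2 * of_real pi * \<i> * of_real y + (of_int (2 * j) * pi) * \<i>)"
    by simp
  then have "2 * pi * x = 2 * pi * (y + of_int j)" by (simp add: algebra_simps)
  then have "x = y + of_int j" by simp
  then have "\<bar>of_int j\<bar> < (1::real)" using assms by linarith
  then have "j = 0" by linarith
  then show ?thesis using \<open>x = y + of_int j\<close> by simp
qed

section \<open>The space L2 and its squared norm\<close>

text \<open>A Bochner integral, hence 0 when the square is not integrable; this is why membership in
  \<open>L2\<close> is carried along.\<close>

definition energy :: "'a measure \<Rightarrow> ('a \<Rightarrow> complex) \<Rightarrow> real" where
  "energy M f = (\<integral>z. (cmod (f z))\<^sup>2 \<partial>M)"

lemma energy_nonneg [simp]: "0 \<le> energy M f"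
  by (simp add: energy_def)

lemma cmod_add_squared_le: "(cmod (a + b))\<^sup>2 \<le> 2 * (cmod a)\<^sup>2 + 2 * (cmod b)\<^sup>2"
proof -
  have "(cmod (a + b))\<^sup>2 \<le> (cmod a + cmod b)\<^sup>2"
    by (intro power_mono norm_triangle_ineq) auto
  also have "\<dots> \<le> 2 * (cmod a)\<^sup>2 + 2 * (cmod b)\<^sup>2"
    using sum_squares_bound[of "cmod a" "cmod b"] by (simp add: power2_sum)
  finally show ?thesis .
qed

lemma L2_measurable [measurable_dest]: "f \<in> L2 M \<Longrightarrow> f \<in> borel_measurable M"
  by (simp add: L2_def)

lemma L2_integrable_squared: "f \<in> L2 M \<Longrightarrow> integrable M (\<lambda>z. (cmod (f z))\<^sup>2)"
  by (simp add: L2_def)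

lemma L2_dominated:
  assumes "g \<in> L2 M" "f \<in> borel_measurable M" "\<And>z. z \<in> space M \<Longrightarrow> cmod (f z) \<le> C * cmod (g z)"
  shows "f \<in> L2 M"
proof -
  note [measurable] = assms(2)
  have "integrable M (\<lambda>z. (cmod (f z))\<^sup>2)"
  proof (rule Bochner_Integration.integrable_bound)
    show "integrable M (\<lambda>z. C\<^sup>2 * (cmod (g z))\<^sup>2)"
      using L2_integrable_squared[OF assms(1)] by simp
    show "AE z in M. norm ((cmod (f z))\<^sup>2) \<le> norm (C\<^sup>2 * (cmod (g z))\<^sup>2)"
    proof (rule AE_I2)
      fix z assume "z \<in> space M"
      then have "(cmod (f z))\<^sup>2 \<le> (C * cmod (g z))\<^sup>2" by (intro power_mono assms) auto
      then show "norm ((cmod (f z))\<^sup>2) \<le> norm (C\<^sup>2 * (cmod (g z))\<^sup>2)"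
        by (simp add: power_mult_distrib)
    qed
  qed simp
  then show ?thesis using assms(2) by (simp add: L2_def)
qed

lemma L2_zero [simp]: "(\<lambda>z. 0) \<in> L2 M"
  by (simp add: L2_def)

lemma L2_add:
  assumes "f \<in> L2 M" "g \<in> L2 M"
  shows "(\<lambda>z. f z + g z) \<in> L2 M"
proof -
  note [measurable] = assms
  have "integrable M (\<lambda>z. (cmod (f z + g z))\<^sup>2)"
  proof (rule Bochner_Integration.integrable_bound)
    show "integrable M (\<lambda>z. 2 * (cmod (f z))\<^sup>2 + 2 * (cmod (g z))\<^sup>2)"
      by (intro Bochner_Integration.integrable_add integrable_mult_right L2_integrable_squared assms)
  qed (use cmod_add_squared_le in \<open>auto simp: abs_of_nonneg\<close>)
  then show ?thesis by (simp add: L2_def)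
qed

lemma L2_cmult: "f \<in> L2 M \<Longrightarrow> (\<lambda>z. c * f z) \<in> L2 M"
  by (rule L2_dominated[where C = "cmod c" and g = f]) (auto simp: norm_mult)

lemma L2_minus: "f \<in> L2 M \<Longrightarrow> (\<lambda>z. - f z) \<in> L2 M"
  using L2_cmult[of f M "-1"] by simp

lemma L2_diff: "f \<in> L2 M \<Longrightarrow> g \<in> L2 M \<Longrightarrow> (\<lambda>z. f z - g z) \<in> L2 M"
  using L2_add[of f M "\<lambda>z. - g z"] L2_minus[of g M] by simp

lemma cnj_measurable [measurable]: "cnj \<in> borel_measurable borel"
  by (intro borel_measurable_continuous_onI continuous_intros)

lemma L2_cnj: "f \<in> L2 M \<Longrightarrow> (\<lambda>z. cnj (f z)) \<in> L2 M"
  by (rule L2_dominated[where C = 1 and g = f]) (auto intro: measurable_compose[OF _ cnj_measurable])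

lemma L2_sum: "(\<And>i. i \<in> I \<Longrightarrow> f i \<in> L2 M) \<Longrightarrow> (\<lambda>z. \<Sum>i\<in>I. f i z) \<in> L2 M"
  by (induction I rule: infinite_finite_induct) (auto intro: L2_add)

lemma L2_mult_unimodular:
  assumes "f \<in> L2 M" "u \<in> borel_measurable M" "\<And>z. cmod (u z) = 1"
  shows "(\<lambda>z. f z * u z) \<in> L2 M"
  by (rule L2_dominated[where C = 1 and g = f]) (use assms in \<open>auto simp: norm_mult\<close>)

lemma L2_integrable_mult:
  assumes "f \<in> L2 M" "g \<in> L2 M"
  shows "integrable M (\<lambda>z. f z * g z)"
proof (rule Bochner_Integration.integrable_bound)
  note [measurable] = assms
  show "integrable M (\<lambda>z. (cmod (f z))\<^sup>2 + (cmod (g z))\<^sup>2)"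
    by (intro Bochner_Integration.integrable_add L2_integrable_squared assms)
  show "(\<lambda>z. f z * g z) \<in> borel_measurable M" by simp
  have "cmod (f z * g z) \<le> (cmod (f z))\<^sup>2 + (cmod (g z))\<^sup>2" for z
  proof -
    have "0 \<le> cmod (f z) * cmod (g z)" by simp
    then show ?thesis
      using sum_squares_bound[of "cmod (f z)" "cmod (g z)"] unfolding norm_mult by linarith
  qed
  then show "AE z in M. norm (f z * g z) \<le> norm ((cmod (f z))\<^sup>2 + (cmod (g z))\<^sup>2)"
    by (simp add: abs_of_nonneg)
qed

lemma (in finite_measure) L2_bounded:
  assumes "f \<in> borel_measurable M" "\<And>z. cmod (f z) \<le> B"
  shows "f \<in> L2 M"
  by (rule L2_dominated[where C = B and g = "\<lambda>z. 1"]) (use assms in \<open>auto simp: L2_def\<close>)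

lemma (in finite_measure) L2_integrable: "f \<in> L2 M \<Longrightarrow> integrable M f"
  using L2_integrable_mult[OF _ L2_bounded[of "\<lambda>z. 1" 1], of f] by simp

text \<open>A substitute for the triangle inequality that stays with squared norms. The factor 2
  does no harm where only convergence to 0 is at stake; it is the origin of the bounds \<epsilon> /
  4 in later approximation arguments.\<close>

lemma energy_add_le:
  assumes "f \<in> L2 M" "g \<in> L2 M"
  shows "energy M (\<lambda>z. f z + g z) \<le> 2 * energy M f + 2 * energy M g"
proof -
  have "energy M (\<lambda>z. f z + g z) \<le> (\<integral>z. 2 * (cmod (f z))\<^sup>2 + 2 * (cmod (g z))\<^sup>2 \<partial>M)"
    unfolding energy_def
    by (intro integral_mono cmod_add_squared_le L2_integrable_squared L2_add assms
        Bochner_Integration.integrable_add integrable_mult_right)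
  also have "\<dots> = 2 * energy M f + 2 * energy M g"
    using assms by (simp add: energy_def L2_integrable_squared)
  finally show ?thesis .
qed

lemma energy_cmult: "energy M (\<lambda>z. c * f z) = (cmod c)\<^sup>2 * energy M f"
  by (simp add: energy_def norm_mult power_mult_distrib)

lemma nn_integral_energy:
  "f \<in> L2 M \<Longrightarrow> (\<integral>\<^sup>+ z. ennreal ((cmod (f z))\<^sup>2) \<partial>M) = ennreal (energy M f)"
  unfolding energy_def by (rule nn_integral_eq_integral) (auto dest: L2_integrable_squared)

section \<open>Trigonometric polynomials\<close>

text \<open>Frequencies of both signs occur, so this is an algebra containing \<open>wave 1\<close>
  and its conjugate. The inductive form turns the closure properties into short inductions;
  \<open>trig_representation\<close> recovers the finite sum.\<close>

inductive_set trig :: "(real \<Rightarrow> complex) set" where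
  trig_zero: "(\<lambda>x. 0) \<in> trig"
| trig_add_wave: "f \<in> trig \<Longrightarrow> (\<lambda>x. f x + c * wave k x) \<in> trig"

lemma trig_add: "g \<in> trig \<Longrightarrow> f \<in> trig \<Longrightarrow> (\<lambda>x. f x + g x) \<in> trig"
  by (induction rule: trig.induct)
     (auto simp: add.assoc[symmetric] intro: trig_add_wave)

lemma trig_wave: "(\<lambda>x. c * wave k x) \<in> trig"
  using trig_add_wave[OF trig_zero, of c k] by simp

lemma trig_const: "(\<lambda>x. c) \<in> trig"
  using trig_wave[of c 0] by simp

lemma trig_mult_wave: "f \<in> trig \<Longrightarrow> (\<lambda>x. f x * (c * wave k x)) \<in> trig"
proof (induction rule: trig.induct)
  case (trig_add_wave f d j)
  have "(\<lambda>x. f x * (c * wave k x) + (d * c) * wave (j + k) x) \<in> trig"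
    by (intro trig.trig_add_wave trig_add_wave.IH)
  then show ?case by (simp add: wave_add algebra_simps)
qed (use trig_zero in simp)

lemma trig_mult: "g \<in> trig \<Longrightarrow> f \<in> trig \<Longrightarrow> (\<lambda>x. f x * g x) \<in> trig"
proof (induction rule: trig.induct)
  case (trig_add_wave g d j)
  have "(\<lambda>x. f x * g x + f x * (d * wave j x)) \<in> trig"
    using trig_add_wave by (intro trig_add trig_mult_wave)
  then show ?case by (simp add: algebra_simps)
qed (use trig_zero in simp)

lemma trig_measurable [measurable]: "f \<in> trig \<Longrightarrow> f \<in> borel_measurable borel"
  by (induction rule: trig.induct) auto

lemma trig_bounded: "f \<in> trig \<Longrightarrow> \<exists>B. \<forall>x. cmod (f x) \<le> B"
proof (induction rule: trig.induct)
  case (trig_add_wave f c k)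
  then obtain B where "\<forall>x. cmod (f x) \<le> B" by blast
  then have "cmod (f x + c * wave k x) \<le> B + cmod c" for x
    using norm_triangle_ineq[of "f x" "c * wave k x"] by (simp add: norm_mult) (smt (verit))
  then show ?case by blast
qed auto

lemma trig_representation:
  "f \<in> trig \<Longrightarrow> \<exists>N c. f = (\<lambda>x. \<Sum>k\<in>{- int N..int N}. c k * wave k x)"
proof (induction rule: trig.induct)
  case trig_zero
  then show ?case by (intro exI[of _ 0] exI[of _ "\<lambda>_. 0"]) auto
next
  case (trig_add_wave f d j)
  then obtain N c where f: "f = (\<lambda>x. \<Sum>k\<in>{- int N..int N}. c k * wave k x)" by blast
  define N' where "N' = max N (nat \<bar>j\<bar>)"
  define c' where "c' k = (if k \<in> {- int N..int N} then c k else 0) + (if k = j then d else 0)" for k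
  have sub: "{- int N..int N} \<subseteq> {- int N'..int N'}" "j \<in> {- int N'..int N'}"
    by (auto simp: N'_def)
  have "(\<Sum>k\<in>{- int N'..int N'}. c' k * wave k x) = f x + d * wave j x" for x
  proof -
    have "(\<Sum>k\<in>{- int N'..int N'}. c' k * wave k x)
        = (\<Sum>k\<in>{- int N'..int N'}. if k \<in> {- int N..int N} then c k * wave k x else 0)
          + (\<Sum>k\<in>{- int N'..int N'}. if k = j then d * wave k x else 0)"
      unfolding sum.distrib[symmetric] by (intro sum.cong) (auto simp: c'_def algebra_simps)
    also have "\<dots> = f x + d * wave j x"
      unfolding f using sub by (subst sum.inter_restrict[symmetric]) (auto simp: Int_absorb1 sum.delta)
    finally show ?thesis .
  qed
  then show ?case by (intro exI[of _ N'] exI[of _ c']) auto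
qed

text \<open>A real-linear form on the complex plane is a combination of z and its conjugate, which
  on the unit circle are the frequencies 1 and -1. Sums and products stay in the algebra
  \<open>trig\<close>.\<close>

lemma real_polynomial_wave_trig:
  fixes g :: "complex \<Rightarrow> real"
  assumes "real_polynomial_function g"
  shows "(\<lambda>x. complex_of_real (g (wave 1 x))) \<in> trig"
  using assms
proof (induction rule: real_polynomial_function.induct)
  case (linear h)
  interpret bounded_linear h by fact
  have "complex_of_real (h (wave 1 x)) =
      (h 1 + h \<i> / \<i>) / 2 * wave 1 x + (h 1 - h \<i> / \<i>) / 2 * wave (- 1) x" for x
  proof -
    have "wave 1 x = Re (wave 1 x) *\<^sub>R 1 + Im (wave 1 x) *\<^sub>R \<i>"
      by (simp add: complex_eq_iff)
    then have "h (wave 1 x) = Re (wave 1 x) * h 1 + Im (wave 1 x) * h \<i>"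
      by (metis add scale scaleR_conv_of_real real_scaleR_def)
    moreover have "wave (- 1) x = cnj (wave 1 x)" by (simp add: cnj_wave)
    ultimately show ?thesis by (simp add: complex_eq_iff field_simps)
  qed
  then show ?case
    using trig_add[OF trig_wave trig_wave] by presburger
next
  case (add f g)
  then show ?case by (simp add: trig_add)
next
  case (mult f g)
  then show ?case by (simp add: trig_mult)
qed (rule trig_const)

section \<open>Density of trigonometric polynomials in L2 of a measure on the circle\<close>

text \<open>\<open>wave 1\<close> is injective on [0,1) but does not separate 0 from 1, so density
  would fail for a measure charging both endpoints. The second alternative, a point mass at 1, is
  kept because a carpet may lie in its last column or row.\<close>

locale circle_measure = prob_space M for M :: "real measure" +
  assumes sets_M [measurable_cong, simp]: "sets M = sets borel"
    and mass: "emeasure M {0..<1} = 1 \<or> emeasure M {1} = 1"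
begin

lemma space_M [simp]: "space M = UNIV"
  using sets_eq_imp_space_eq[OF sets_M] by simp

lemma prob_UNIV [simp]: "prob UNIV = 1"
  using prob_space by simp

lemma trig_L2: "f \<in> trig \<Longrightarrow> f \<in> L2 M"
  using trig_bounded[of f] trig_measurable[of f] L2_bounded[of f] measurable_cong_sets[OF sets_M refl]
  by blast

lemma wave_L2: "wave k \<in> L2 M"
  using trig_L2[OF trig_wave[of 1 k]] by simp

definition approximable :: "(real \<Rightarrow> complex) \<Rightarrow> bool" where
  "approximable f \<longleftrightarrow> f \<in> L2 M \<and> (\<forall>\<epsilon>>0. \<exists>q\<in>trig. energy M (\<lambda>x. f x - q x) < \<epsilon>)"

lemma approximable_limit:
  assumes "f \<in> L2 M" "\<And>\<epsilon>. \<epsilon> > 0 \<Longrightarrow> \<exists>g. approximable g \<and> energy M (\<lambda>x. f x - g x) < \<epsilon>"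
  shows "approximable f"
  unfolding approximable_def
proof (intro conjI allI impI assms(1))
  fix \<epsilon> :: real assume "\<epsilon> > 0"
  then obtain g where g: "approximable g" "energy M (\<lambda>x. f x - g x) < \<epsilon> / 4"
    using assms(2)[of "\<epsilon> / 4"] by auto
  then obtain q where q: "q \<in> trig" "energy M (\<lambda>x. g x - q x) < \<epsilon> / 4"
    using \<open>\<epsilon> > 0\<close> unfolding approximable_def by (meson divide_pos_pos zero_less_numeral)
  have "g \<in> L2 M" "q \<in> L2 M" using g q trig_L2 by (auto simp: approximable_def)
  then have "energy M (\<lambda>x. (f x - g x) + (g x - q x)) \<le>
      2 * energy M (\<lambda>x. f x - g x) + 2 * energy M (\<lambda>x. g x - q x)"
    by (intro energy_add_le L2_diff assms)
  then have "energy M (\<lambda>x. f x - q x) < \<epsilon>" using g q by simp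
  then show "\<exists>q\<in>trig. energy M (\<lambda>x. f x - q x) < \<epsilon>" using q by blast
qed

lemma approximable_trig: "q \<in> trig \<Longrightarrow> approximable q"
  unfolding approximable_def using trig_L2 by (auto simp: energy_def intro!: bexI[of _ q])

lemma approximable_add:
  assumes "approximable f" "approximable g"
  shows "approximable (\<lambda>x. f x + g x)"
  unfolding approximable_def
proof (intro conjI allI impI)
  show "(\<lambda>x. f x + g x) \<in> L2 M" using assms by (auto simp: approximable_def L2_add)
  fix \<epsilon> :: real assume "\<epsilon> > 0"
  then have "\<epsilon> / 4 > 0" by simp
  then obtain p q where pq: "p \<in> trig" "energy M (\<lambda>x. f x - p x) < \<epsilon> / 4"
      "q \<in> trig" "energy M (\<lambda>x. g x - q x) < \<epsilon> / 4"
    using assms unfolding approximable_def by meson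
  have "energy M (\<lambda>x. (f x - p x) + (g x - q x)) \<le>
      2 * energy M (\<lambda>x. f x - p x) + 2 * energy M (\<lambda>x. g x - q x)"
    using assms pq trig_L2 by (intro energy_add_le L2_diff) (auto simp: approximable_def)
  then have "energy M (\<lambda>x. f x + g x - (p x + q x)) < \<epsilon>" using pq by (simp add: algebra_simps)
  then show "\<exists>q\<in>trig. energy M (\<lambda>x. f x + g x - q x) < \<epsilon>"
    by (rule bexI[OF _ trig_add[OF pq(3) pq(1)]])
qed

lemma approximable_cmult:
  assumes "approximable f"
  shows "approximable (\<lambda>x. c * f x)"
  unfolding approximable_def
proof (intro conjI allI impI)
  show "(\<lambda>x. c * f x) \<in> L2 M" using assms by (auto simp: approximable_def L2_cmult)
  fix \<epsilon> :: real assume "\<epsilon> > 0"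
  \<comment> \<open>The added 1 keeps the divisor positive for c = 0.\<close>
  define d where "d = (cmod c)\<^sup>2 + 1"
  have "d > 0" by (simp add: d_def add_nonneg_pos)
  then have "\<epsilon> / d > 0" using \<open>\<epsilon> > 0\<close> by simp
  then obtain q where q: "q \<in> trig" "energy M (\<lambda>x. f x - q x) < \<epsilon> / d"
    using assms unfolding approximable_def by meson
  have "energy M (\<lambda>x. c * f x - q x * c) = (cmod c)\<^sup>2 * energy M (\<lambda>x. f x - q x)"
    by (simp add: energy_cmult[symmetric] algebra_simps)
  also have "\<dots> \<le> d * energy M (\<lambda>x. f x - q x)"
    by (intro mult_right_mono) (auto simp: d_def)
  also have "\<dots> < \<epsilon>" using q(2) \<open>d > 0\<close> by (simp add: field_simps)
  finally show "\<exists>q\<in>trig. energy M (\<lambda>x. c * f x - q x) < \<epsilon>"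
    by (rule bexI[OF _ trig_mult[OF trig_const[of c] q(1)]])
qed

lemma approximable_sum:
  "(\<And>i. i \<in> I \<Longrightarrow> approximable (f i)) \<Longrightarrow> approximable (\<lambda>x. \<Sum>i\<in>I. f i x)"
  by (induction I rule: infinite_finite_induct)
     (auto intro: approximable_add approximable_trig trig_zero)

lemma approximable_AE_cong:
  assumes "approximable f" "g \<in> borel_measurable M" "AE x in M. f x = g x"
  shows "approximable g"
proof -
  note [measurable] = assms(2)
  have [measurable]: "f \<in> borel_measurable M" using assms(1) by (simp add: approximable_def L2_def)
  have "integrable M (\<lambda>x. (cmod (f x))\<^sup>2) \<longleftrightarrow> integrable M (\<lambda>x. (cmod (g x))\<^sup>2)"
    by (rule integrable_cong_AE) (use assms(3) in auto)
  then have g: "g \<in> L2 M" using assms(1) by (simp add: approximable_def L2_def)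
  have 0: "energy M (\<lambda>x. g x - f x) = 0"
    unfolding energy_def by (rule integral_eq_zero_AE) (use assms(3) in auto)
  show ?thesis by (rule approximable_limit[OF g]) (use 0 assms(1) in auto)
qed

text \<open>Dominated convergence: the limit inherits the bound by h, so |f - g i| \<le> 2 |h|
  almost everywhere, and the squares have the majorant 4 |h|^2.\<close>

lemma approximable_limit_seq:
  assumes g: "\<And>i. approximable (g i)" and f: "f \<in> borel_measurable M"
    and lim: "AE x in M. (\<lambda>i. g i x) \<longlonglongrightarrow> f x"
    and h: "h \<in> L2 M" "\<And>i x. cmod (g i x) \<le> cmod (h x)"
  shows "approximable f"
proof -
  note [measurable] = f h(1)
  have [measurable]: "g i \<in> borel_measurable M" for i
    using g by (simp add: approximable_def L2_def)
  have le: "AE x in M. cmod (f x) \<le> cmod (h x)"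
    using lim by eventually_elim (auto intro: LIMSEQ_le_const2 tendsto_norm h(2))
  have fL2: "f \<in> L2 M"
    unfolding L2_def
  proof (intro CollectI conjI f)
    show "integrable M (\<lambda>x. (cmod (f x))\<^sup>2)"
      by (rule Bochner_Integration.integrable_bound[OF L2_integrable_squared[OF h(1)]])
         (use le in \<open>auto intro!: power_mono\<close>)
  qed
  have "(\<lambda>i. energy M (\<lambda>x. f x - g i x)) \<longlonglongrightarrow> (\<integral>x. (0::real) \<partial>M)"
    unfolding energy_def
  proof (rule integral_dominated_convergence)
    show "integrable M (\<lambda>x. 4 * (cmod (h x))\<^sup>2)" using h(1) by (simp add: L2_integrable_squared)
    show "AE x in M. (\<lambda>i. (cmod (f x - g i x))\<^sup>2) \<longlonglongrightarrow> 0"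
      using lim
    proof eventually_elim
      case (elim x)
      have "(\<lambda>i. (cmod (f x - g i x))\<^sup>2) \<longlonglongrightarrow> (cmod (f x - f x))\<^sup>2"
        by (intro tendsto_intros elim)
      then show ?case by simp
    qed
    show "AE x in M. norm ((cmod (f x - g i x))\<^sup>2) \<le> 4 * (cmod (h x))\<^sup>2" for i
      using le
    proof eventually_elim
      case (elim x)
      have "cmod (f x - g i x) \<le> 2 * cmod (h x)"
        using norm_triangle_ineq4[of "f x" "g i x"] elim h(2)[of i x] by linarith
      then have "(cmod (f x - g i x))\<^sup>2 \<le> (2 * cmod (h x))\<^sup>2" by (intro power_mono) auto
      then show ?case by (simp add: power_mult_distrib)
    qed
  qed auto
  then have lim0: "(\<lambda>i. energy M (\<lambda>x. f x - g i x)) \<longlonglongrightarrow> 0" by simp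
  show ?thesis
  proof (rule approximable_limit[OF fL2])
    fix \<epsilon> :: real assume "\<epsilon> > 0"
    then have "\<forall>\<^sub>F i in sequentially. energy M (\<lambda>x. f x - g i x) < \<epsilon>"
      using lim0 by (simp add: order_tendstoD)
    then obtain i where "energy M (\<lambda>x. f x - g i x) < \<epsilon>"
      using eventually_happens'[OF sequentially_bot] by blast
    then show "\<exists>g. approximable g \<and> energy M (\<lambda>x. f x - g x) < \<epsilon>" using g by blast
  qed
qed

text \<open>\<phi> is evaluated on the unit circle only, where Stone-Weierstrass approximates it
  uniformly by polynomials in the real and imaginary part. A uniform error d costs at most d^2 in
  energy, as the total mass is 1.\<close>

lemma approximable_continuous:
  fixes \<phi> :: "complex \<Rightarrow> real"
  assumes "continuous_on UNIV \<phi>"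
  shows "approximable (\<lambda>x. complex_of_real (\<phi> (wave 1 x)))"
proof -
  have meas: "(\<lambda>x. complex_of_real (\<phi> (wave 1 x))) \<in> borel_measurable borel"
    by (intro borel_measurable_continuous_onI continuous_intros
        continuous_on_compose2[OF assms]) auto
  have comp: "compact (sphere (0::complex) 1)" by simp
  have "compact (\<phi> ` sphere (0::complex) 1)"
    using assms by (intro compact_continuous_image continuous_on_subset[OF assms]) auto
  then obtain B where "\<forall>z\<in>sphere 0 1. \<bar>\<phi> z\<bar> \<le> B"
    using compact_imp_bounded[of "\<phi> ` sphere 0 1"] by (auto simp: bounded_iff)
  then have L2: "(\<lambda>x. complex_of_real (\<phi> (wave 1 x))) \<in> L2 M"
    using meas by (intro L2_bounded[where B = B]) (auto simp: measurable_cong_sets[OF sets_M refl])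
  show ?thesis
    unfolding approximable_def
  proof (intro conjI L2 allI impI)
    fix \<epsilon> :: real assume "\<epsilon> > 0"
    define d where "d = sqrt (\<epsilon> / 2)"
    have d: "d > 0" "d\<^sup>2 = \<epsilon> / 2" using \<open>\<epsilon> > 0\<close> by (auto simp: d_def)
    obtain g where g: "real_polynomial_function g"
        "\<And>z. z \<in> sphere 0 1 \<Longrightarrow> \<bar>\<phi> z - g z\<bar> < d"
      using Stone_Weierstrass_real_polynomial_function[OF comp continuous_on_subset[OF assms] d(1)]
      by auto
    let ?q = "\<lambda>x. complex_of_real (g (wave 1 x))"
    have q: "?q \<in> trig" by (rule real_polynomial_wave_trig[OF g(1)])
    have le: "(cmod (\<phi> (wave 1 x) - ?q x))\<^sup>2 \<le> d\<^sup>2" for x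
    proof (rule power_mono)
      show "cmod (\<phi> (wave 1 x) - ?q x) \<le> d"
        using g(2)[of "wave 1 x"] by (simp flip: of_real_diff)
    qed simp
    have "energy M (\<lambda>x. \<phi> (wave 1 x) - ?q x) \<le> (\<integral>x. d\<^sup>2 \<partial>M)"
      unfolding energy_def
      by (intro integral_mono L2_integrable_squared L2_diff L2 trig_L2 q) (use le in auto)
    also have "\<dots> < \<epsilon>" using d \<open>\<epsilon> > 0\<close> prob_space by simp
    finally show "\<exists>q\<in>trig. energy M (\<lambda>x. \<phi> (wave 1 x) - q x) < \<epsilon>"
      by (rule bexI[OF _ q])
  qed
qed

lemma AE_mass: "(AE x in M. 0 \<le> x \<and> x < 1) \<or> (AE x in M. x = 1)"
  using mass
proof
  assume "emeasure M {0..<1} = 1"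
  then have "AE x in M. x \<in> {0..<1}" by (intro AE_prob_1) (auto simp: measure_def)
  then show ?thesis by auto
next
  assume "emeasure M {1} = 1"
  then have "AE x in M. x \<in> {1}" by (intro AE_prob_1) (auto simp: measure_def)
  then show ?thesis by auto
qed

text \<open>In the main case the points x \<le> a of [0,1) correspond to a closed arc, by
  injectivity of \<open>wave 1\<close>, and its indicator is a limit of continuous functions of the
  distance to the arc. For a point mass at 1, or for a outside [0,1), the indicator is constant
  almost everywhere.\<close>

lemma approximable_indicator_atMost: "approximable (\<lambda>x. indicator {..a} x)"
proof -
  have meas: "(\<lambda>x. indicator {..a} x :: complex) \<in> borel_measurable M" by measurable
  have const: "approximable (\<lambda>x. indicator {..a} x)" if "AE x in M. indicator {..a} x = c" for c :: complex
    by (rule approximable_AE_cong[OF approximable_trig[OF trig_const[of c]] meas]) (use that in auto)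
  show ?thesis
  proof (cases "(AE x in M. x = 1) \<or> a < 0 \<or> 1 \<le> a")
    case True
    then consider "AE x in M. x = 1" | "AE x in M. 0 \<le> x \<and> x < 1" "a < 0" | "AE x in M. 0 \<le> x \<and> x < 1" "1 \<le> a"
      using AE_mass by blast
    then show ?thesis
    proof cases
      case 1 then show ?thesis by (intro const[of "indicator {..a} 1"]) (auto elim!: eventually_mono)
    next
      case 2 then show ?thesis by (intro const[of 0]) (auto elim!: eventually_mono simp: indicator_def)
    next
      case 3
      from 3(1) have "AE x in M. x \<le> a" by eventually_elim (use 3(2) in auto)
      then show ?thesis by (intro const[of 1]) (auto elim!: eventually_mono simp: indicator_def)
    qed
  next
    case False
    then have ae: "AE x in M. 0 \<le> x \<and> x < 1" and a: "0 \<le> a" "a < 1" using AE_mass by auto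
    define B where "B = wave 1 ` {0..a}"
    have "compact B" unfolding B_def by (intro compact_continuous_image continuous_intros) auto
    then have B: "closed B" "B \<noteq> {}" using a by (auto simp: compact_imp_closed B_def)
    define \<phi> where "\<phi> i z = max 0 (1 - real i * infdist z B)" for i z
    have cont: "continuous_on UNIV (\<phi> i)" for i
      unfolding \<phi>_def by (intro continuous_intros)
    show ?thesis
    proof (rule approximable_limit_seq)
      show "approximable (\<lambda>x. complex_of_real (\<phi> i (wave 1 x)))" for i
        by (rule approximable_continuous[OF cont])
      show "AE x in M. (\<lambda>i. complex_of_real (\<phi> i (wave 1 x))) \<longlonglongrightarrow> indicator {..a} x"
        using ae
      proof eventually_elim
        case (elim x)
        show ?case
        proof (cases "x \<le> a")
          case True
          then have "wave 1 x \<in> B" using elim by (auto simp: B_def)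
          then show ?thesis using True by (simp add: \<phi>_def)
        next
          case False
          have "wave 1 x \<notin> B"
          proof
            assume "wave 1 x \<in> B"
            then obtain y where y: "0 \<le> y" "y \<le> a" "wave 1 x = wave 1 y" by (auto simp: B_def)
            then have "x = y" using elim a by (intro wave_1_inj) auto
            then show False using y False by simp
          qed
          then have pos: "infdist (wave 1 x) B > 0"
            using B by (simp add: infdist_pos_not_in_closed)
          then obtain n where "real n * infdist (wave 1 x) B > 1"
            using reals_Archimedean3 by blast
          moreover have "real n * infdist (wave 1 x) B \<le> real i * infdist (wave 1 x) B" if "i \<ge> n" for i
            using that pos by (intro mult_right_mono) auto
          ultimately have "\<phi> i (wave 1 x) = 0" if "i \<ge> n" for i
            using that by (fastforce simp: \<phi>_def max_def)
          then have "\<forall>\<^sub>F i in sequentially. complex_of_real (\<phi> i (wave 1 x)) = indicator {..a} x"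
            using False by (auto simp: eventually_sequentially)
          then show ?thesis by (rule tendsto_eventually)
        qed
      qed
      show "(\<lambda>x. 1) \<in> L2 M" by (rule trig_L2[OF trig_const])
      show "cmod (complex_of_real (\<phi> i (wave 1 x))) \<le> cmod 1" for i x
        by (simp add: \<phi>_def infdist_nonneg)
    qed simp
  qed
qed

text \<open>Half-lines are an intersection-stable generator of the Borel sets, and the sets with
  approximable indicator form a Dynkin system, since \<open>approximable\<close> survives dominated
  limits.\<close>

lemma approximable_indicator:
  assumes "A \<in> sets borel"
  shows "approximable (\<lambda>x. indicator A x)"
proof -
  have "sets borel = sigma_sets UNIV (range (\<lambda>a::real. {..a}))"
    by (subst borel_eq_atMost) (auto intro: sets_measure_of)
  then have A: "A \<in> sigma_sets UNIV (range (\<lambda>a::real. {..a}))" using assms by simp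
  have stable: "Int_stable (range (\<lambda>a::real. {..a}))"
  proof -
    have "{..a} \<inter> {..b} = {..min a b}" for a b :: real by auto
    then show ?thesis by (auto simp: Int_stable_def)
  qed
  have "range (\<lambda>a::real. {..a}) \<subseteq> Pow UNIV" by simp
  from stable this A show ?thesis
  proof (induction rule: sigma_sets_induct_disjoint)
    case (basic A)
    then show ?case using approximable_indicator_atMost by auto
  next
    case empty
    then show ?case using approximable_trig[OF trig_zero] by simp
  next
    case (compl A)
    have "approximable (\<lambda>x. 1 + (- 1) * indicator A x)"
      by (intro approximable_add approximable_cmult compl approximable_trig trig_const)
    moreover have "(\<lambda>x. 1 + (- 1) * indicator A x) = (\<lambda>x. indicator (UNIV - A) x :: complex)"
      by (auto simp: indicator_def)
    ultimately show ?case by simp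
  next
    case (union A)
    have [measurable]: "A i \<in> sets borel" for i
      using union(2) \<open>sets borel = _\<close> by auto
    show ?case
    proof (rule approximable_limit_seq)
      show "approximable (\<lambda>x. \<Sum>i<n. indicator (A i) x)" for n
        by (intro approximable_sum union)
      have "(\<Sum>i<n. indicator (A i) x) = (indicator (\<Union>i<n. A i) x :: complex)" for n x
        using union(1) by (subst indicator_UN_disjoint) (auto simp: disjoint_family_on_def)
      moreover have "(\<lambda>n. indicator (\<Union>i<n. A i) x :: complex) \<longlonglongrightarrow> indicator (\<Union>i. A i) x" for x
        by (rule LIMSEQ_indicator_UN)
      ultimately show "AE x in M. (\<lambda>n. \<Sum>i<n. indicator (A i) x :: complex) \<longlonglongrightarrow> indicator (\<Union>i. A i) x"
        and "cmod (\<Sum>i<n. indicator (A i) x) \<le> cmod 1" for n x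
        by (simp_all add: indicator_def)
      show "(\<lambda>x. 1) \<in> L2 M" by (rule trig_L2[OF trig_const])
    qed simp
  qed
qed

lemma approximable_L2:
  assumes "f \<in> L2 M"
  shows "approximable f"
proof -
  note [measurable] = assms
  obtain s where s: "\<And>i. simple_function M (s i)" "\<And>x. (\<lambda>i. s i x) \<longlonglongrightarrow> f x"
      "\<And>i x. dist (s i x) 0 \<le> 2 * dist (f x) 0"
    using borel_measurable_implies_sequence_metric[of f M 0] assms by (auto simp: L2_def)
  show ?thesis
  proof (rule approximable_limit_seq[where g = s and h = "\<lambda>x. 2 * f x"])
    fix i
    have fin: "finite (range (s i))" using simple_functionD(1)[OF s(1)[of i]] by simp
    have "approximable (\<lambda>x. \<Sum>v\<in>range (s i). v * indicator (s i -` {v}) x)"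
      using simple_functionD(2)[OF s(1)[of i]]
      by (intro approximable_sum approximable_cmult approximable_indicator) auto
    moreover have "(\<Sum>v\<in>range (s i). v * indicator (s i -` {v}) x) = s i x" for x
    proof -
      have "(\<Sum>v\<in>range (s i). v * indicator (s i -` {v}) x) = (\<Sum>v\<in>range (s i). if v = s i x then v else 0)"
        by (intro sum.cong) (auto simp: indicator_def)
      then show ?thesis using fin by simp
    qed
    ultimately show "approximable (s i)" by simp
  qed (use s L2_cmult[OF assms, of 2] in \<open>auto simp: norm_mult\<close>)
qed

end

section \<open>Fourier series for Lebesgue measure\<close>

lemma integral_lebesgue_unit:
  fixes f :: "real \<Rightarrow> complex"
  assumes "f \<in> borel_measurable borel"
  shows "(\<integral>x. f x \<partial>lebesgue_unit) = (\<integral>x. indicator {0..1} x *\<^sub>R f x \<partial>lborel)"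
proof -
  have "lebesgue_unit = density lborel (\<lambda>x. ennreal (indicator {0..1} x))"
    by (auto simp: uniform_measure_def indicator_def intro!: density_cong)
  then show ?thesis using assms by (simp add: integral_density)
qed

lemma circle_measure_lebesgue_unit: "circle_measure lebesgue_unit"
proof -
  have "prob_space lebesgue_unit" by (rule prob_space_uniform_measure) auto
  moreover have "emeasure lebesgue_unit {0..<1} = 1"
  proof -
    have "{0..1} \<inter> {0..<1} = {0..<1::real}" by auto
    then show ?thesis by (subst emeasure_uniform_measure) auto
  qed
  ultimately show ?thesis by (simp add: circle_measure_def circle_measure_axioms_def)
qed

interpretation unit: circle_measure lebesgue_unit
  by (rule circle_measure_lebesgue_unit)

lemma integral_wave_lebesgue_unit:
  "(\<integral>x. wave k x \<partial>lebesgue_unit) = (if k = 0 then 1 else 0)"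
proof (cases "k = 0")
  case True
  then show ?thesis using unit.prob_space by simp
next
  case False
  define F where "F x = wave k x / (2 * pi * \<i> * of_int k)" for x
  have "(\<integral>x. wave k x \<partial>lebesgue_unit) = (\<integral>x. indicator {0..1} x *\<^sub>R wave k x \<partial>lborel)"
    by (rule integral_lebesgue_unit) simp
  also have "\<dots> = F 1 - F 0"
  proof (rule integral_FTC_Icc)
    show "(F has_vector_derivative wave k x) (at x within {0..1})" for x
    proof -
      define c where "c = 2 * of_real pi * \<i> * of_int k"
      have "c \<noteq> 0" using False by (simp add: c_def)
      then have "((\<lambda>z. exp (c * z) / c) has_field_derivative exp (c * of_real x)) (at (of_real x))"
        by (auto intro!: derivative_eq_intros)
      then have "((\<lambda>x. exp (c * of_real x) / c) has_vector_derivative exp (c * of_real x))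
          (at x within {0..1})"
        by (rule has_vector_derivative_real_field)
      then show ?thesis by (simp add: F_def[abs_def] wave_def[abs_def] expi_def c_def mult_ac)
    qed
    show "continuous_on {0..1} (wave k)" by (intro continuous_intros)
  qed simp
  also have "\<dots> = 0"
    by (simp add: F_def wave_def expi_eq_cis cis_multiple_2pi)
  finally show ?thesis using False by simp
qed

lemma (in prob_space) energy_add:
  assumes "f \<in> L2 M" "g \<in> L2 M"
  shows "energy M (\<lambda>z. f z + g z) = energy M f + energy M g + 2 * Re (\<integral>z. f z * cnj (g z) \<partial>M)"
proof -
  define h where "h z = f z * cnj (g z)" for z
  have h: "integrable M h"
    unfolding h_def[abs_def] by (intro L2_integrable_mult L2_cnj assms)
  have "energy M (\<lambda>z. f z + g z) = (\<integral>z. (cmod (f z))\<^sup>2 + (cmod (g z))\<^sup>2 + 2 * Re (h z) \<partial>M)"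
    unfolding energy_def
    by (intro Bochner_Integration.integral_cong)
       (simp_all only: cmod_power2 h_def, simp_all add: power2_eq_square algebra_simps)
  also have "\<dots> = energy M f + energy M g + 2 * Re (\<integral>z. h z \<partial>M)"
    using assms h by (simp add: energy_def L2_integrable_squared)
  finally show ?thesis by (simp add: h_def)
qed

text \<open>Parseval. In the induction the new frequency j is orthogonal to every k in I because j -
  k \<noteq> 0.\<close>

lemma energy_trig_lebesgue_unit:
  assumes "finite I"
  shows "energy lebesgue_unit (\<lambda>x. \<Sum>k\<in>I. c k * wave k x) = (\<Sum>k\<in>I. (cmod (c k))\<^sup>2)"
  using assms
proof (induction I rule: finite_induct)
  case (insert j I)
  have L2: "(\<lambda>x. \<Sum>k\<in>I. c k * wave k x) \<in> L2 lebesgue_unit"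
    by (intro L2_sum L2_cmult unit.wave_L2)
  have "(\<integral>x. c j * wave j x * cnj (\<Sum>k\<in>I. c k * wave k x) \<partial>lebesgue_unit)
      = (\<integral>x. (\<Sum>k\<in>I. c j * cnj (c k) * wave (j - k) x) \<partial>lebesgue_unit)"
    by (simp add: sum_distrib_left cnj_wave wave_diff mult_ac)
  also have "\<dots> = (\<Sum>k\<in>I. \<integral>x. c j * cnj (c k) * wave (j - k) x \<partial>lebesgue_unit)"
    by (intro Bochner_Integration.integral_sum unit.L2_integrable L2_cmult unit.wave_L2)
  also have "\<dots> = 0"
    using insert.hyps by (intro sum.neutral) (auto simp: integral_wave_lebesgue_unit)
  finally have cross: "(\<integral>x. c j * wave j x * cnj (\<Sum>k\<in>I. c k * wave k x) \<partial>lebesgue_unit) = 0" .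
  have "energy lebesgue_unit (\<lambda>x. c j * wave j x) = (cmod (c j))\<^sup>2"
    unfolding energy_def using unit.prob_space by (simp add: norm_mult)
  then show ?case
    using insert unit.energy_add[OF L2_cmult[OF unit.wave_L2, of "c j" j] L2] cross by simp
qed (simp add: energy_def)

text \<open>Passes from the nonnegative integral to real numbers. The two integrals agree because
  the differences are assumed to be in \<open>L2\<close>.\<close>

lemma L2_tendsto_iff_energy:
  assumes "\<And>i. (\<lambda>z. S i z - g z) \<in> L2 M"
  shows "L2_tendsto M S g F \<longleftrightarrow> ((\<lambda>i. energy M (\<lambda>z. S i z - g z)) \<longlongrightarrow> 0) F"
  unfolding L2_tendsto_def nn_integral_energy[OF assms]
  using tendsto_ennreal_iff[of "\<lambda>i. energy M (\<lambda>z. S i z - g z)" F 0] by simp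

lemma energy_minus_commute: "energy M (\<lambda>z. f z - g z) = energy M (\<lambda>z. g z - f z)"
  by (simp add: energy_def norm_minus_commute)

text \<open>Pythagoras: the error of the Fourier sum is orthogonal to all frequencies in I, and any
  competitor differs from the Fourier sum by a combination of these.\<close>

lemma Fourier_best_approximation:
  assumes f: "f \<in> L2 lebesgue_unit" and I: "finite I"
  defines "d \<equiv> \<lambda>k. \<integral>x. f x * wave (- k) x \<partial>lebesgue_unit"
  shows "energy lebesgue_unit (\<lambda>x. f x - (\<Sum>k\<in>I. d k * wave k x))
      \<le> energy lebesgue_unit (\<lambda>x. f x - (\<Sum>k\<in>I. c k * wave k x))"
proof -
  let ?S = "\<lambda>x. \<Sum>k\<in>I. d k * wave k x" and ?D = "\<lambda>x. \<Sum>k\<in>I. (d k - c k) * wave k x"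
  have L2: "?S \<in> L2 lebesgue_unit" "?D \<in> L2 lebesgue_unit"
    by (intro L2_sum L2_cmult unit.wave_L2)+
  have orth: "(\<integral>x. (f x - ?S x) * wave (- k) x \<partial>lebesgue_unit) = 0" if "k \<in> I" for k
  proof -
    have "(\<integral>x. (f x - ?S x) * wave (- k) x \<partial>lebesgue_unit)
        = (\<integral>x. f x * wave (- k) x - (\<Sum>j\<in>I. d j * wave (j - k) x) \<partial>lebesgue_unit)"
      by (intro Bochner_Integration.integral_cong refl)
         (simp only: left_diff_distrib sum_distrib_right wave_diff mult.assoc)
    also have "\<dots> = d k - (\<Sum>j\<in>I. \<integral>x. d j * wave (j - k) x \<partial>lebesgue_unit)"
      unfolding d_def
      by (subst Bochner_Integration.integral_diff, (intro L2_integrable_mult f unit.wave_L2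
            Bochner_Integration.integrable_sum unit.L2_integrable L2_cmult)+,
          subst Bochner_Integration.integral_sum)
         (auto intro: unit.L2_integrable L2_cmult unit.wave_L2)
    also have "\<dots> = d k - (\<Sum>j\<in>I. if j = k then d j else 0)"
      by (intro arg_cong2[where f = "(-)"] sum.cong) (auto simp: integral_wave_lebesgue_unit)
    also have "\<dots> = 0" using that I by simp
    finally show ?thesis .
  qed
  have "(\<integral>x. (f x - ?S x) * cnj (?D x) \<partial>lebesgue_unit)
      = (\<integral>x. (\<Sum>k\<in>I. cnj (d k - c k) * ((f x - ?S x) * wave (- k) x)) \<partial>lebesgue_unit)"
    by (simp add: sum_distrib_left cnj_wave mult_ac)
  also have "\<dots> = (\<Sum>k\<in>I. \<integral>x. cnj (d k - c k) * ((f x - ?S x) * wave (- k) x) \<partial>lebesgue_unit)"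
    by (intro Bochner_Integration.integral_sum integrable_mult_right L2_integrable_mult L2_diff f L2
        unit.wave_L2)
  also have "\<dots> = 0" using orth by (intro sum.neutral) simp
  finally have "energy lebesgue_unit (\<lambda>x. (f x - ?S x) + ?D x)
      = energy lebesgue_unit (\<lambda>x. f x - ?S x) + energy lebesgue_unit ?D"
    using unit.energy_add[OF L2_diff[OF f L2(1)] L2(2)] by simp
  moreover have "(f x - ?S x) + ?D x = f x - (\<Sum>k\<in>I. c k * wave k x)" for x
    by (simp add: left_diff_distrib sum_subtractf)
  ultimately show ?thesis by simp
qed

text \<open>A partial sum over any range containing the frequencies of a trigonometric polynomial q
  approximates f at least as well as q does. The range may be asymmetric, so both ends can go to
  infinity independently.\<close>

theorem Fourier_series_lebesgue_unit:
  assumes f: "f \<in> L2 lebesgue_unit"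
  shows "\<exists>d. L2_sums_bilateral lebesgue_unit (\<lambda>l x. d l * wave l x) f"
proof -
  define d where "d k = (\<integral>x. f x * wave (- k) x \<partial>lebesgue_unit)" for k
  let ?S = "\<lambda>(A, B) x. \<Sum>k\<in>{- int A..int B}. d k * wave k x"
  have L2: "(\<lambda>x. ?S i x - f x) \<in> L2 lebesgue_unit" for i
    by (cases i) (simp, intro L2_diff L2_sum L2_cmult unit.wave_L2 f)
  have "((\<lambda>i. energy lebesgue_unit (\<lambda>x. ?S i x - f x)) \<longlongrightarrow> 0) (sequentially \<times>\<^sub>F sequentially)"
  proof (rule tendstoI)
    fix \<epsilon> :: real assume "\<epsilon> > 0"
    then obtain q where q: "q \<in> trig" "energy lebesgue_unit (\<lambda>x. f x - q x) < \<epsilon>"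
      using unit.approximable_L2[OF f] unfolding unit.approximable_def by blast
    then obtain N c where c: "q = (\<lambda>x. \<Sum>k\<in>{- int N..int N}. c k * wave k x)"
      using trig_representation by blast
    have "energy lebesgue_unit (\<lambda>x. ?S (A, B) x - f x) < \<epsilon>" if "N \<le> A" "N \<le> B" for A B
    proof -
      define c' where "c' k = (if k \<in> {- int N..int N} then c k else 0)" for k
      have "q x = (\<Sum>k\<in>{- int A..int B}. c' k * wave k x)" for x
        unfolding c using that by (intro sum.mono_neutral_cong_left) (auto simp: c'_def)
      then show ?thesis
        using Fourier_best_approximation[OF f, of "{- int A..int B}" c'] q(2)
        by (simp add: d_def energy_minus_commute[of _ _ f])
    qed
    then show "\<forall>\<^sub>F i in sequentially \<times>\<^sub>F sequentially.
        dist (energy lebesgue_unit (\<lambda>x. ?S i x - f x)) 0 < \<epsilon>"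
      unfolding eventually_prod_sequentially by (intro exI[of _ N]) auto
  qed
  then have "L2_tendsto lebesgue_unit ?S f (sequentially \<times>\<^sub>F sequentially)"
    using L2_tendsto_iff_energy[of ?S f lebesgue_unit] L2 by blast
  then show ?thesis using f by (auto simp: L2_sums_bilateral_def)
qed

section \<open>The Kaczmarz algorithm for singular measures\<close>

text \<open>This is the residual after k steps, not the approximant. Step k projects away the unit
  vector \<open>wave (int k)\<close>. As the exponentials need not be orthogonal in L2 of M, a later
  step disturbs what the earlier ones achieved, and the coefficients are in general not the Fourier
  coefficients of f.\<close>

fun kaczmarz :: "real measure \<Rightarrow> (real \<Rightarrow> complex) \<Rightarrow> nat \<Rightarrow> real \<Rightarrow> complex" where
  "kaczmarz M f 0 = f"
| "kaczmarz M f (Suc k) = (\<lambda>x. kaczmarz M f k x -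
     (\<integral>u. kaczmarz M f k u * wave (- int k) u \<partial>M) * wave (int k) x)"

definition kaczmarz_coeff :: "real measure \<Rightarrow> (real \<Rightarrow> complex) \<Rightarrow> nat \<Rightarrow> complex" where
  "kaczmarz_coeff M f k = (\<integral>u. kaczmarz M f k u * wave (- int k) u \<partial>M)"

lemma kaczmarz_Suc:
  "kaczmarz M f (Suc k) = (\<lambda>x. kaczmarz M f k x - kaczmarz_coeff M f k * wave (int k) x)"
  by (simp add: kaczmarz_coeff_def)

declare kaczmarz.simps(2) [simp del]

lemma kaczmarz_eq_diff:
  "kaczmarz M f N x = f x - (\<Sum>k<N. kaczmarz_coeff M f k * wave (int k) x)"
  by (induction N) (simp_all add: kaczmarz_Suc)

context circle_measure
begin

lemma kaczmarz_L2: "f \<in> L2 M \<Longrightarrow> kaczmarz M f k \<in> L2 M"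
proof (induction k)
  case (Suc k)
  then show ?case unfolding kaczmarz_Suc by (intro L2_diff L2_cmult wave_L2)
qed simp

text \<open>A step is an orthogonal projection: \<open>wave (int k)\<close> has norm 1 because its
  modulus is 1 and M has mass 1, and the coefficient is the inner product with it.\<close>

lemma kaczmarz_energy_Suc:
  assumes "f \<in> L2 M"
  shows "energy M (kaczmarz M f (Suc k)) = energy M (kaczmarz M f k) - (cmod (kaczmarz_coeff M f k))\<^sup>2"
proof -
  let ?r = "kaczmarz M f k" and ?c = "kaczmarz_coeff M f k"
  have r: "?r \<in> L2 M" by (rule kaczmarz_L2[OF assms])
  have "(\<integral>x. ?r x * cnj (- ?c * wave (int k) x) \<partial>M)
      = (\<integral>x. - cnj ?c * (?r x * wave (- int k) x) \<partial>M)"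
    by (simp add: cnj_wave mult_ac)
  also have "\<dots> = - cnj ?c * ?c" by (simp add: kaczmarz_coeff_def)
  also have "Re \<dots> = - (cmod ?c)\<^sup>2"
    unfolding cmod_power2 by (simp add: power2_eq_square)
  finally have "energy M (\<lambda>x. ?r x + (- ?c) * wave (int k) x)
      = energy M ?r + energy M (\<lambda>x. (- ?c) * wave (int k) x) - 2 * (cmod ?c)\<^sup>2"
    using energy_add[OF r L2_cmult[OF wave_L2, of "- ?c" "int k"]] by simp
  moreover have "energy M (\<lambda>x. (- ?c) * wave (int k) x) = (cmod ?c)\<^sup>2"
    unfolding energy_def using prob_space by (simp add: norm_mult)
  ultimately show ?thesis by (simp add: kaczmarz_Suc)
qed

text \<open>Thus the residual tends to 0 exactly when the squared coefficients add up to the energy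
  of f, which turns convergence into a question about numbers.\<close>

lemma kaczmarz_energy:
  "f \<in> L2 M \<Longrightarrow> energy M (kaczmarz M f N) = energy M f - (\<Sum>k<N. (cmod (kaczmarz_coeff M f k))\<^sup>2)"
  by (induction N) (simp_all add: kaczmarz_energy_Suc)

lemma kaczmarz_energy_le: "f \<in> L2 M \<Longrightarrow> energy M (kaczmarz M f N) \<le> energy M f"
  by (simp add: kaczmarz_energy sum_nonneg)

lemma kaczmarz_linear:
  assumes "f \<in> L2 M" "g \<in> L2 M"
  shows "kaczmarz M (\<lambda>x. f x + c * g x) k = (\<lambda>x. kaczmarz M f k x + c * kaczmarz M g k x)"
proof (induction k)
  case (Suc k)
  have "kaczmarz_coeff M (\<lambda>x. f x + c * g x) k
      = (\<integral>u. kaczmarz M f k u * wave (- int k) u + c * (kaczmarz M g k u * wave (- int k) u) \<partial>M)"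
    unfolding kaczmarz_coeff_def Suc by (simp add: algebra_simps)
  also have "\<dots> = kaczmarz_coeff M f k + c * kaczmarz_coeff M g k"
    using assms by (simp add: kaczmarz_coeff_def L2_integrable_mult kaczmarz_L2 wave_L2)
  finally show ?case by (simp add: kaczmarz_Suc Suc algebra_simps)
qed simp

definition effective :: "(real \<Rightarrow> complex) \<Rightarrow> bool" where
  "effective f \<longleftrightarrow> f \<in> L2 M \<and> (\<lambda>k. energy M (kaczmarz M f k)) \<longlonglongrightarrow> 0"

lemma effective_linear:
  assumes "effective f" "effective g"
  shows "effective (\<lambda>x. f x + c * g x)"
proof -
  have L2: "f \<in> L2 M" "g \<in> L2 M" using assms by (auto simp: effective_def)
  have "energy M (kaczmarz M (\<lambda>x. f x + c * g x) k)
      \<le> 2 * energy M (kaczmarz M f k) + 2 * ((cmod c)\<^sup>2 * energy M (kaczmarz M g k))" for k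
    unfolding kaczmarz_linear[OF L2] energy_cmult[symmetric]
    by (intro energy_add_le L2_cmult kaczmarz_L2 L2)
  note le = this
  have lim: "(\<lambda>k. 2 * energy M (kaczmarz M f k) + 2 * ((cmod c)\<^sup>2 * energy M (kaczmarz M g k)))
      \<longlonglongrightarrow> 2 * 0 + 2 * ((cmod c)\<^sup>2 * 0)"
    using assms by (intro tendsto_intros) (auto simp: effective_def)
  have "(\<lambda>k. energy M (kaczmarz M (\<lambda>x. f x + c * g x) k)) \<longlonglongrightarrow> 0"
  proof (rule Lim_null_comparison)
    show "\<forall>\<^sub>F k in sequentially. norm (energy M (kaczmarz M (\<lambda>x. f x + c * g x) k))
        \<le> 2 * energy M (kaczmarz M f k) + 2 * ((cmod c)\<^sup>2 * energy M (kaczmarz M g k))"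
      using le by simp
  qed (use lim in simp)
  then show ?thesis using L2 by (simp add: effective_def L2_add L2_cmult)
qed

lemma effective_one: "effective (\<lambda>x. 1)"
proof -
  have "kaczmarz M (\<lambda>x. 1) (Suc k) = (\<lambda>x. 0)" for k
    by (induction k) (use prob_space in \<open>simp_all add: kaczmarz_Suc kaczmarz_coeff_def\<close>)
  then have "(\<lambda>k. energy M (kaczmarz M (\<lambda>x. 1) (Suc k))) \<longlonglongrightarrow> 0" by (simp add: energy_def)
  then show ?thesis
    using LIMSEQ_imp_Suc trig_L2[OF trig_const] by (auto simp: effective_def)
qed

text \<open>With mean 0 the step for frequency 0 is idle. Multiplication by e(-x) carries the
  remaining frequencies 1, 2, ... to 0, 1, ... and preserves inner products, so the algorithm
  restarts on e(-x) f.\<close>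

lemma kaczmarz_shift:
  assumes "f \<in> L2 M" "(\<integral>x. f x \<partial>M) = 0"
  shows "kaczmarz M f (Suc k) = (\<lambda>x. wave 1 x * kaczmarz M (\<lambda>x. wave (-1) x * f x) k x)"
proof (induction k)
  case 0
  then show ?case using assms by (simp add: kaczmarz_Suc kaczmarz_coeff_def mult.assoc[symmetric])
next
  case (Suc k)
  have w: "wave (- int (Suc k)) x * wave 1 x = wave (- int k) x" for x
    by (simp flip: wave_add)
  have "kaczmarz_coeff M f (Suc k) = kaczmarz_coeff M (\<lambda>x. wave (-1) x * f x) k"
    unfolding kaczmarz_coeff_def Suc w[symmetric] by (simp add: mult_ac)
  then show ?case
    unfolding kaczmarz_Suc[of M f "Suc k"] Suc
    by (simp add: kaczmarz_Suc algebra_simps wave_add[of 1 "int k"])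
qed

text \<open>Subtracting the mean c makes \<open>kaczmarz_shift\<close> applicable. For f the
  correction is a multiple of 1; after multiplication by e(-x) it is a multiple of e(-x), and here
  the effectiveness of \<open>wave (-1)\<close> enters.\<close>

lemma effective_shift:
  assumes f: "f \<in> L2 M" and e: "effective (wave (-1))"
  shows "effective f \<longleftrightarrow> effective (\<lambda>x. wave (-1) x * f x)"
proof -
  define c where "c = (\<integral>x. f x \<partial>M)"
  define f0 where "f0 x = f x + (- c) * 1" for x
  define g where "g x = wave (-1) x * f x" for x
  define g0 where "g0 x = wave (-1) x * f0 x" for x
  have f0: "f0 \<in> L2 M" unfolding f0_def[abs_def]
    by (intro L2_add[OF f] L2_cmult trig_L2 trig_const)
  have g0: "g0 \<in> L2 M" unfolding g0_def[abs_def]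
    using L2_mult_unimodular[OF f0, of "wave (-1)"] by (simp add: mult.commute measurable_cong_sets[OF sets_M refl])
  have "(\<integral>x. f0 x \<partial>M) = 0"
    using L2_integrable[OF f] prob_space by (simp add: f0_def c_def)
  then have "energy M (kaczmarz M f0 (Suc k)) = energy M (kaczmarz M g0 k)" for k
    unfolding kaczmarz_shift[OF f0 \<open>(\<integral>x. f0 x \<partial>M) = 0\<close>] g0_def[abs_def] by (simp add: energy_def norm_mult)
  then have "effective f0 \<longleftrightarrow> effective g0"
    using f0 g0 filterlim_sequentially_Suc[of "\<lambda>k. energy M (kaczmarz M f0 k)"] by (simp add: effective_def)
  moreover have "effective f \<longleftrightarrow> effective f0"
  proof
    assume "effective f" then show "effective f0"
      unfolding f0_def[abs_def] by (rule effective_linear[OF _ effective_one])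
  next
    assume "effective f0"
    then have "effective (\<lambda>x. f0 x + c * 1)" by (rule effective_linear[OF _ effective_one])
    then show "effective f" by (simp add: f0_def)
  qed
  moreover have "effective g \<longleftrightarrow> effective g0"
  proof
    assume "effective g"
    then have "effective (\<lambda>x. g x + (- c) * wave (-1) x)" by (rule effective_linear[OF _ e])
    then show "effective g0" by (simp add: g_def[abs_def] g0_def[abs_def] f0_def algebra_simps)
  next
    assume "effective g0"
    then have "effective (\<lambda>x. g0 x + c * wave (-1) x)" by (rule effective_linear[OF _ e])
    then show "effective g" by (simp add: g_def[abs_def] g0_def[abs_def] f0_def algebra_simps)
  qed
  ultimately show ?thesis by (simp add: g_def[abs_def])
qed

lemma effective_L2:
  assumes e: "effective (wave (-1))" and f: "f \<in> L2 M"
  shows "effective f"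
proof -
  \<comment> \<open>e(-x) times \<open>wave k\<close> is \<open>wave (k - 1)\<close>, so starting
    from the constant 1 effectiveness spreads to all frequencies in both directions.\<close>
  have step: "effective (wave k) \<longleftrightarrow> effective (wave (k - 1))" for k
    using effective_shift[OF wave_L2[of k] e] by (simp flip: wave_add add: fun_eq_iff)
  have wave: "effective (wave k)" for k
  proof (induction k rule: int_induct[where k = 0])
    case base
    then show ?case using effective_one by (simp add: wave_0[abs_def])
  next
    case (step1 i)
    then show ?case using step[of "i + 1"] by simp
  next
    case (step2 i)
    then show ?case using step[of i] by simp
  qed
  have zero: "effective (\<lambda>x. 0)" using effective_linear[OF effective_one effective_one, of "-1"] by simp
  have trig: "effective q" if "q \<in> trig" for q
    using that
  proof (induction rule: trig.induct)
    case trig_zero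
    show ?case by (rule zero)
  next
    case (trig_add_wave f c k)
    show ?case by (rule effective_linear[OF trig_add_wave.IH wave])
  qed
  have "(\<lambda>k. energy M (kaczmarz M f k)) \<longlonglongrightarrow> 0"
  proof (rule tendstoI)
    fix \<epsilon> :: real assume "\<epsilon> > 0"
    then have "\<epsilon> / 4 > 0" by simp
    then obtain q where q: "q \<in> trig" "energy M (\<lambda>x. f x - q x) < \<epsilon> / 4"
      using approximable_L2[OF f] unfolding approximable_def by meson
    let ?g = "\<lambda>x. f x - q x"
    have L2: "q \<in> L2 M" "?g \<in> L2 M" using q f trig_L2 by (auto intro: L2_diff)
    \<comment> \<open>Projections do not increase energy, so the part f - q stays small in every
      step, uniformly in k.\<close>
    have le: "energy M (kaczmarz M f k) \<le> 2 * energy M (kaczmarz M q k) + \<epsilon> / 2" for k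
    proof -
      have "kaczmarz M f k = (\<lambda>x. kaczmarz M q k x + kaczmarz M ?g k x)"
        using kaczmarz_linear[OF L2, of 1 k] by simp
      then have "energy M (kaczmarz M f k) \<le> 2 * energy M (kaczmarz M q k) + 2 * energy M (kaczmarz M ?g k)"
        using energy_add_le[OF kaczmarz_L2[OF L2(1)] kaczmarz_L2[OF L2(2)]] by simp
      then show ?thesis using kaczmarz_energy_le[OF L2(2), of k] q(2) by simp
    qed
    have "(\<lambda>k. energy M (kaczmarz M q k)) \<longlonglongrightarrow> 0" using trig[OF q(1)] by (simp add: effective_def)
    then have "\<forall>\<^sub>F k in sequentially. energy M (kaczmarz M q k) < \<epsilon> / 4"
      using \<open>\<epsilon> / 4 > 0\<close> by (rule order_tendstoD)
    then show "\<forall>\<^sub>F k in sequentially. dist (energy M (kaczmarz M f k)) 0 < \<epsilon>"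
    proof eventually_elim
      case (elim k)
      then show ?case using le[of k] by simp
    qed
  qed
  then show ?thesis using f by (simp add: effective_def)
qed

end

section \<open>Bessel's inequality and Poisson kernels\<close>

text \<open>Fatou reduces the bound to partial sums, where Parseval is exact. Absolute summability
  ensures that the partial sums converge at every point.\<close>

lemma Bessel_absolutely_summable:
  fixes \<alpha> :: "nat \<Rightarrow> complex"
  assumes "summable (\<lambda>k. cmod (\<alpha> k))" and "\<And>N. (\<Sum>k<N. (cmod (\<alpha> k))\<^sup>2) \<le> B"
  shows "(\<integral>\<^sup>+ \<theta>. ennreal ((cmod (\<Sum>k. \<alpha> k * wave (int k) \<theta>))\<^sup>2) \<partial>lebesgue_unit) \<le> ennreal B"
proof -
  let ?S = "\<lambda>N \<theta>. \<Sum>k<N. \<alpha> k * wave (int k) \<theta>"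
  have "summable (\<lambda>k. \<alpha> k * wave (int k) \<theta>)" for \<theta>
    by (rule summable_norm_cancel) (simp add: norm_mult assms(1))
  then have "(\<lambda>N. ennreal ((cmod (?S N \<theta>))\<^sup>2)) \<longlonglongrightarrow> ennreal ((cmod (\<Sum>k. \<alpha> k * wave (int k) \<theta>))\<^sup>2)" for \<theta>
    by (intro tendsto_intros summable_LIMSEQ)
  then have "ennreal ((cmod (\<Sum>k. \<alpha> k * wave (int k) \<theta>))\<^sup>2) = liminf (\<lambda>N. ennreal ((cmod (?S N \<theta>))\<^sup>2))" for \<theta>
    by (intro lim_imp_Liminf[symmetric]) auto
  then have "(\<integral>\<^sup>+ \<theta>. ennreal ((cmod (\<Sum>k. \<alpha> k * wave (int k) \<theta>))\<^sup>2) \<partial>lebesgue_unit)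
      = (\<integral>\<^sup>+ \<theta>. liminf (\<lambda>N. ennreal ((cmod (?S N \<theta>))\<^sup>2)) \<partial>lebesgue_unit)"
    by simp
  also have "\<dots> \<le> liminf (\<lambda>N. \<integral>\<^sup>+ \<theta>. ennreal ((cmod (?S N \<theta>))\<^sup>2) \<partial>lebesgue_unit)"
    by (intro nn_integral_liminf) measurable
  also have "\<dots> \<le> ennreal B"
  proof -
    have "(\<integral>\<^sup>+ \<theta>. ennreal ((cmod (?S N \<theta>))\<^sup>2) \<partial>lebesgue_unit) \<le> ennreal B" for N
    proof -
      have "(\<integral>\<^sup>+ \<theta>. ennreal ((cmod (?S N \<theta>))\<^sup>2) \<partial>lebesgue_unit) = ennreal (energy lebesgue_unit (?S N))"
        by (intro nn_integral_energy L2_sum L2_cmult unit.wave_L2)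
      also have "energy lebesgue_unit (?S N) = (\<Sum>k<N. (cmod (\<alpha> k))\<^sup>2)"
        using energy_trig_lebesgue_unit[of "int ` {..<N}" "\<lambda>k. \<alpha> (nat k)"]
        by (simp add: sum.reindex inj_on_def)
      finally show ?thesis using assms(2)[of N] by (simp add: ennreal_leI)
    qed
    then have "liminf (\<lambda>N. \<integral>\<^sup>+ \<theta>. ennreal ((cmod (?S N \<theta>))\<^sup>2) \<partial>lebesgue_unit) \<le> liminf (\<lambda>N. ennreal B)"
      by (intro Liminf_mono always_eventually) auto
    then show ?thesis by (simp add: Liminf_const)
  qed
  finally show ?thesis .
qed

definition poisson :: "real \<Rightarrow> real \<Rightarrow> real \<Rightarrow> real" where
  "poisson r \<theta> x = (1 - r\<^sup>2) / (cmod (1 - r * wave 1 \<theta> * wave (-1) x))\<^sup>2"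

lemma poisson_measurable [measurable]: "(\<lambda>(\<theta>, x). poisson r \<theta> x) \<in> borel_measurable (borel \<Otimes>\<^sub>M borel)"
  unfolding poisson_def by measurable

lemma poisson_nonneg: "0 \<le> r \<Longrightarrow> r < 1 \<Longrightarrow> 0 \<le> poisson r \<theta> x"
  by (simp add: poisson_def power_le_one)

lemma poisson_denominator:
  fixes r :: real
  assumes "0 \<le> r" "r < 1"
  shows "1 - r \<le> cmod (1 - r * wave 1 \<theta> * wave (-1) x)"
  using norm_triangle_ineq2[of 1 "r * wave 1 \<theta> * wave (-1) x"] assms by (simp add: norm_mult)

text \<open>The kernel is 1 - r^2 times the squared modulus of a geometric series in e(\<theta> -
  x). The coefficients of that series have square sum 1 / (1 - r^2), so Bessel's inequality yields
  1.\<close>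

lemma nn_integral_poisson_le:
  fixes r :: real
  assumes r: "0 \<le> r" "r < 1"
  shows "(\<integral>\<^sup>+ \<theta>. ennreal (poisson r \<theta> x) \<partial>lebesgue_unit) \<le> 1"
proof -
  define \<alpha> where "\<alpha> k = of_real (r ^ k) * wave (- int k) x" for k
  have norm: "cmod (\<alpha> k) = r ^ k" for k using r by (simp add: \<alpha>_def norm_mult norm_power)
  have r2: "r\<^sup>2 < 1" using r by (simp add: power_less_one_iff abs_square_less_1)
  have "(\<Sum>k<N. (cmod (\<alpha> k))\<^sup>2) \<le> 1 / (1 - r\<^sup>2)" for N
  proof -
    have "(\<Sum>k<N. (r\<^sup>2) ^ k) \<le> (\<Sum>k. (r\<^sup>2) ^ k)"
      using r2 by (intro sum_le_suminf) (auto intro: summable_geometric)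
    moreover have "(cmod (\<alpha> k))\<^sup>2 = (r\<^sup>2) ^ k" for k
      by (simp add: norm power_mult[symmetric] mult.commute)
    ultimately show ?thesis using r2 suminf_geometric[of "r\<^sup>2"] by simp
  qed
  then have le: "(\<integral>\<^sup>+ \<theta>. ennreal ((cmod (\<Sum>k. \<alpha> k * wave (int k) \<theta>))\<^sup>2) \<partial>lebesgue_unit) \<le> ennreal (1 / (1 - r\<^sup>2))"
    using r by (intro Bessel_absolutely_summable) (auto simp: norm intro: summable_geometric)
  have "poisson r \<theta> x = (1 - r\<^sup>2) * (cmod (\<Sum>k. \<alpha> k * wave (int k) \<theta>))\<^sup>2" for \<theta>
  proof -
    have "\<alpha> k * wave (int k) \<theta> = (r * wave 1 \<theta> * wave (-1) x) ^ k" for k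
      by (simp add: \<alpha>_def power_mult_distrib wave_of_nat cnj_wave[symmetric])
    moreover have "(\<Sum>k. (r * wave 1 \<theta> * wave (-1) x) ^ k) = 1 / (1 - r * wave 1 \<theta> * wave (-1) x)"
      using r by (intro suminf_geometric) (simp add: norm_mult)
    ultimately show ?thesis by (simp add: poisson_def norm_divide power_divide)
  qed
  then have "(\<integral>\<^sup>+ \<theta>. ennreal (poisson r \<theta> x) \<partial>lebesgue_unit)
      = (\<integral>\<^sup>+ \<theta>. ennreal (1 - r\<^sup>2) * ennreal ((cmod (\<Sum>k. \<alpha> k * wave (int k) \<theta>))\<^sup>2) \<partial>lebesgue_unit)"
    using r2 by (simp add: ennreal_mult)
  also have "\<dots> = ennreal (1 - r\<^sup>2) * (\<integral>\<^sup>+ \<theta>. ennreal ((cmod (\<Sum>k. \<alpha> k * wave (int k) \<theta>))\<^sup>2) \<partial>lebesgue_unit)"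
    by (intro nn_integral_cmult) measurable
  also have "\<dots> \<le> ennreal (1 - r\<^sup>2) * ennreal (1 / (1 - r\<^sup>2))"
    by (intro mult_left_mono le) auto
  also have "\<dots> = 1" using r2 by (simp flip: ennreal_mult)
  finally show ?thesis .
qed

section \<open>The generating function of the Kaczmarz coefficients of e(-x)\<close>

context circle_measure
begin

abbreviation shift_coeff :: "nat \<Rightarrow> complex" where
  "shift_coeff k \<equiv> kaczmarz_coeff M (wave (-1)) k"

abbreviation moment :: "nat \<Rightarrow> complex" where
  "moment k \<equiv> \<integral>x. wave (- int k) x \<partial>M"

lemma expectation_wave_0 [simp]: "expectation (wave 0) = 1"
  unfolding wave_0_eq by simp

lemma energy_wave: "energy M (wave k) = 1"
  using prob_space by (simp add: energy_def)

lemma sum_shift_coeff_squared_le: "(\<Sum>k<N. (cmod (shift_coeff k))\<^sup>2) \<le> 1"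
  using kaczmarz_energy[OF wave_L2[of "-1"], of N] energy_nonneg[of M "kaczmarz M (wave (-1)) N"]
  by (simp add: energy_wave)

lemma norm_shift_coeff_le: "cmod (shift_coeff k) \<le> 1"
proof -
  have "(cmod (shift_coeff k))\<^sup>2 \<le> (\<Sum>j<Suc k. (cmod (shift_coeff j))\<^sup>2)" by (simp add: sum_nonneg)
  then have "(cmod (shift_coeff k))\<^sup>2 \<le> 1\<^sup>2" using sum_shift_coeff_squared_le[of "Suc k"] by simp
  then show ?thesis by (rule power2_le_imp_le) simp
qed

lemma norm_moment_le: "cmod (moment k) \<le> 1"
proof -
  have "cmod (moment k) \<le> (\<integral>x. cmod (wave (- int k) x) \<partial>M)" by (rule integral_norm_bound)
  then show ?thesis using prob_space by simp
qed

text \<open>Coefficient N pairs the residual, e(-x) minus the terms found so far, with exponential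
  N. The function e(-x) contributes moment N + 1 and the term k contributes moment N - k; solved for
  the former, with \<open>moment 0\<close> = 1 supplying the summand k = N, this is the coefficient
  form of A = 1 + z C A.\<close>

lemma moment_Suc: "moment (Suc N) = (\<Sum>k\<le>N. shift_coeff k * moment (N - k))"
proof -
  have "shift_coeff N = (\<integral>x. wave (-1) x * wave (- int N) x - (\<Sum>k<N. shift_coeff k * (wave (int k) x * wave (- int N) x)) \<partial>M)"
    unfolding kaczmarz_coeff_def[of _ _ N] kaczmarz_eq_diff
    by (simp add: left_diff_distrib sum_distrib_right mult.assoc)
  also have "\<dots> = moment (Suc N) - (\<Sum>k<N. shift_coeff k * moment (N - k))"
  proof -
    have 1: "wave (-1) x * wave (- int N) x = wave (- int (Suc N)) x" for x
      by (simp flip: wave_add)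
    have "wave (int k) x * wave (- int N) x = wave (- int (N - k)) x" if "k < N" for k x
      using that by (simp flip: wave_add add: of_nat_diff)
    then have 2: "(\<Sum>k<N. shift_coeff k * (wave (int k) x * wave (- int N) x)) = (\<Sum>k<N. shift_coeff k * wave (- int (N - k)) x)" for x
      by simp
    show ?thesis
      unfolding 1 2
      by (simp add: Bochner_Integration.integral_diff Bochner_Integration.integral_sum
          L2_integrable wave_L2 L2_sum L2_cmult)
  qed
  finally have "moment (Suc N) = (\<Sum>k<N. shift_coeff k * moment (N - k)) + shift_coeff N * moment 0"
    by simp
  then show ?thesis by (simp add: lessThan_Suc_atMost[symmetric])
qed

text \<open>
  The generating functions satisfy A = 1 + z C A, so b = z C has 1 - b = 1 / A. As 2 Re A - 1 is the
  Poisson integral of the measure, 1 - |b|^2 is that Poisson integral times |1 - b|^2.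
\<close>

lemma one_minus_norm_generating_function_le:
  fixes r :: real
  assumes r: "0 \<le> r" "r < 1" and z: "z = of_real r * wave 1 \<theta>"
  shows "ennreal (1 - (cmod (z * (\<Sum>k. shift_coeff k * z ^ k)))\<^sup>2)
      \<le> min 1 (4 * (\<integral>\<^sup>+ x. ennreal (poisson r \<theta> x) \<partial>M))"
proof -
  have nz: "cmod z = r" using r by (simp add: z norm_mult)
  have geo: "summable (\<lambda>k. r ^ k)" using r by (intro summable_geometric) simp
  have sc: "summable (\<lambda>k. norm (shift_coeff k * z ^ k))"
    by (rule summable_comparison_test[OF _ geo])
       (use r norm_shift_coeff_le in \<open>auto simp: norm_mult norm_power nz intro!: mult_left_le_one_le\<close>)
  have sa: "summable (\<lambda>k. norm (moment k * z ^ k))"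
    by (rule summable_comparison_test[OF _ geo])
       (use r norm_moment_le in \<open>auto simp: norm_mult norm_power nz intro!: mult_left_le_one_le\<close>)
  define A where "A = (\<Sum>k. moment k * z ^ k)"
  define C where "C = (\<Sum>k. shift_coeff k * z ^ k)"
  define D where "D x = 1 - z * wave (-1) x" for x
  have Dr: "D x = 1 - r * wave 1 \<theta> * wave (-1) x" for x by (simp add: D_def z)
  have D: "1 - r \<le> cmod (D x)" for x unfolding Dr by (rule poisson_denominator[OF r])
  then have D0: "D x \<noteq> 0" for x using r by (metis diff_gt_0_iff_gt norm_zero not_le)
  have [measurable]: "D \<in> borel_measurable borel" unfolding D_def[abs_def] by measurable
  have "A = 1 + z * C * A"
  proof -
    have "C * A = (\<Sum>N. \<Sum>k\<le>N. (shift_coeff k * z ^ k) * (moment (N - k) * z ^ (N - k)))"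
      unfolding A_def C_def by (rule Cauchy_product[OF sc sa])
    also have "\<dots> = (\<Sum>N. moment (Suc N) * z ^ N)"
      unfolding moment_Suc sum_distrib_right
      by (intro suminf_cong sum.cong refl) (simp add: power_add[symmetric])
    finally have "z * C * A = z * (\<Sum>N. moment (Suc N) * z ^ N)" by simp
    also have "\<dots> = (\<Sum>N. moment (Suc N) * z ^ Suc N)"
    \<comment> \<open>Summability of the shifted series is obtained by cancelling a factor z; for z
      = 0 both sides vanish.\<close>
    proof (cases "z = 0")
      case False
      have "summable (\<lambda>N. z * (moment (Suc N) * z ^ N))"
        using summable_Suc_iff[of "\<lambda>k. moment k * z ^ k"] summable_norm_cancel[OF sa]
        by (simp add: mult_ac)
      then have "summable (\<lambda>N. moment (Suc N) * z ^ N)" using False by (simp add: summable_cmult_iff)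
      then show ?thesis by (subst suminf_mult[symmetric]) (simp_all add: mult_ac)
    qed simp
    also have "\<dots> = A - 1"
      unfolding A_def suminf_split_head[OF summable_norm_cancel[OF sa]] by simp
    finally show ?thesis by simp
  qed
  then have AC: "A * (1 - z * C) = 1" by (simp add: algebra_simps)
  \<comment> \<open>A is a Cauchy integral of M: the geometric series in z e(-x) may be integrated
    termwise because its terms have modulus r^k.\<close>
  have A: "A = (\<integral>x. 1 / D x \<partial>M)"
  proof -
    have pw: "(\<lambda>k. wave (- int k) x * z ^ k) = (\<lambda>k. (z * wave (-1) x) ^ k)" for x
      by (simp add: power_mult_distrib wave_of_nat cnj_wave[symmetric] mult.commute)
    have "A = (\<Sum>k. \<integral>x. wave (- int k) x * z ^ k \<partial>M)"
      unfolding A_def by simp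
    also have "\<dots> = (\<integral>x. (\<Sum>k. wave (- int k) x * z ^ k) \<partial>M)"
    proof (rule integral_suminf[symmetric])
      show "integrable M (\<lambda>x. wave (- int k) x * z ^ k)" for k
        by (intro integrable_mult_left L2_integrable wave_L2)
      show "AE x in M. summable (\<lambda>k. norm (wave (- int k) x * z ^ k))"
        using geo by (simp add: norm_mult norm_power nz)
      show "summable (\<lambda>k. \<integral>x. norm (wave (- int k) x * z ^ k) \<partial>M)"
        using geo prob_space by (simp add: norm_mult norm_power nz)
    qed
    also have "\<dots> = (\<integral>x. 1 / D x \<partial>M)"
    proof (rule Bochner_Integration.integral_cong)
      show "(\<Sum>k. wave (- int k) x * z ^ k) = 1 / D x" for x
        unfolding pw D_def using r by (intro suminf_geometric) (simp add: norm_mult nz)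
    qed simp
    finally show ?thesis .
  qed
  have int: "integrable M (\<lambda>x. 1 / D x)"
  proof (rule integrable_const_bound[where B = "1 / (1 - r)"])
    show "AE x in M. norm (1 / D x) \<le> 1 / (1 - r)"
      using D r by (auto simp: norm_divide intro!: divide_left_mono mult_pos_pos D0)
  qed (simp add: measurable_cong_sets[OF sets_M refl])
  \<comment> \<open>The Poisson kernel from the Cauchy kernel: expand |1 - D x|^2 = r^2 and divide
    by |D x|^2.\<close>
  have p: "poisson r \<theta> x = 2 * Re (1 / D x) - 1" for x
  proof -
    have n1: "cmod (1 - D x) = r" using r by (simp add: D_def norm_mult nz)
    have "r\<^sup>2 = (cmod (1 - D x))\<^sup>2" by (simp add: n1)
    then have "1 - r\<^sup>2 = 2 * Re (D x) - (cmod (D x))\<^sup>2"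
      unfolding cmod_power2 by (simp add: power2_eq_square algebra_simps)
    then show ?thesis
      unfolding poisson_def Dr[symmetric] Re_divide'
      using D0[of x] by (simp add: diff_divide_distrib Re_divide cmod_power2 complex_eq_iff)
  qed
  have intp: "integrable M (poisson r \<theta>)" unfolding p[abs_def] using int by simp
  have ReA: "(\<integral>x. poisson r \<theta> x \<partial>M) = 2 * Re A - 1"
    unfolding p A using int prob_space by simp
  define P where "P = 2 * Re A - 1"
  have P: "0 \<le> P" "(\<integral>\<^sup>+ x. ennreal (poisson r \<theta> x) \<partial>M) = ennreal P"
    using ReA poisson_nonneg[OF r] nn_integral_eq_integral[OF intp]
    by (auto simp: P_def intro: integral_nonneg simp flip: ReA)
  define w where "w = 1 - z * C"
  have "A \<noteq> 0" "w \<noteq> 0" using AC by (auto simp: w_def)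
  have eq: "1 - (cmod (z * C))\<^sup>2 = P * (cmod w)\<^sup>2"
  proof -
    have "A = 1 / w" using AC \<open>w \<noteq> 0\<close> by (simp add: w_def field_simps)
    then have "Re A = Re w / (cmod w)\<^sup>2" by (simp add: Re_divide cmod_power2)
    moreover have "(cmod w)\<^sup>2 \<noteq> 0" using \<open>w \<noteq> 0\<close> by simp
    ultimately have "P * (cmod w)\<^sup>2 = 2 * Re w - (cmod w)\<^sup>2"
      by (simp add: P_def field_simps)
    then have "P * (cmod w)\<^sup>2 = 1 - (cmod (1 - w))\<^sup>2"
      unfolding cmod_power2 by (simp add: power2_eq_square algebra_simps)
    then show ?thesis by (simp add: w_def)
  qed
  then have "(cmod (z * C))\<^sup>2 \<le> 1\<^sup>2" using P(1) by (smt (verit) mult_nonneg_nonneg one_power2 zero_le_power2)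
  then have "cmod (z * C) \<le> 1" by (rule power2_le_imp_le) simp
  \<comment> \<open>Here w is 1 - b, and |b| \<le> 1 has just been read off from the identity. The
    square of the bound 2 is the constant 4.\<close>
  then have "cmod w \<le> 2" unfolding w_def using norm_triangle_ineq4[of 1 "z * C"] by simp
  then have "(cmod w)\<^sup>2 \<le> 2\<^sup>2" by (intro power_mono) auto
  then have "1 - (cmod (z * C))\<^sup>2 \<le> 4 * P" unfolding eq using P(1) mult_left_mono[of "(cmod w)\<^sup>2" 4 P] by simp
  then have "ennreal (1 - (cmod (z * C))\<^sup>2) \<le> 4 * ennreal P"
    using P(1) by (metis ennreal_leI ennreal_mult' ennreal_numeral zero_le_numeral)
  moreover have "ennreal (1 - (cmod (z * C))\<^sup>2) \<le> 1"
    using ennreal_leI[of "1 - (cmod (z * C))\<^sup>2" 1] by simp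
  ultimately show ?thesis by (simp add: P C_def)
qed

section \<open>Boundary behaviour for singular measures\<close>

text \<open>Inner regularity. Compared with the null set itself, compactness gives each point off L
  whose image on the circle avoids that of L a positive distance to this image, which is what bounds
  the Poisson kernel.\<close>

lemma singular_compact_subset:
  assumes "lebesgue_singular M" "\<epsilon> > 0"
  obtains L where "compact L" "L \<subseteq> {0..1}" "emeasure lborel L = 0" "emeasure M (- L) \<le> ennreal \<epsilon>"
proof -
  obtain A where A: "A \<in> sets borel" "emeasure lborel A = 0" "emeasure M (- A) = 0"
    using assms(1) by (auto simp: lebesgue_singular_def)
  define B where "B = A \<inter> {0..1}"
  have [measurable]: "A \<in> sets borel" "B \<in> sets borel" using A by (auto simp: B_def)
  have "AE x in M. x \<in> A"
    using A by (intro AE_I[of _ _ "- A"]) auto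
  moreover have "AE x in M. x \<in> {0..1}"
    using AE_mass
  proof
    assume "AE x in M. 0 \<le> x \<and> x < 1"
    then show ?thesis by eventually_elim auto
  next
    assume "AE x in M. x = 1"
    then show ?thesis by eventually_elim auto
  qed
  ultimately have "AE x in M. x \<in> B" by eventually_elim (auto simp: B_def)
  then have B1: "emeasure M B = 1" by (subst emeasure_eq_1_AE) auto
  have "emeasure M B = (SUP L\<in>{L. L \<subseteq> B \<and> compact L}. emeasure M L)"
    by (rule inner_regular) auto
  then have "1 - ennreal \<epsilon> < (SUP L\<in>{L. L \<subseteq> B \<and> compact L}. emeasure M L)"
    using B1 assms(2) by (simp add: ennreal_between)
  then obtain L where L: "L \<subseteq> B" "compact L" "1 - ennreal \<epsilon> < emeasure M L"
    by (auto simp: less_SUP_iff)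
  show ?thesis
  proof
    have [measurable]: "L \<in> sets borel" using L by (simp add: compact_imp_closed borel_closed)
    show "compact L" "L \<subseteq> {0..1}" using L by (auto simp: B_def)
    have "emeasure lborel L \<le> emeasure lborel A" using L by (intro emeasure_mono) (auto simp: B_def)
    then show "emeasure lborel L = 0" using A by simp
    have "measure M L \<ge> 1 - \<epsilon>"
    proof (rule ccontr)
      assume "\<not> measure M L \<ge> 1 - \<epsilon>"
      then have "emeasure M L \<le> ennreal (1 - \<epsilon>)"
        unfolding emeasure_eq_measure by (intro ennreal_leI) simp
      also have "\<dots> = 1 - ennreal \<epsilon>" using assms(2) by (simp flip: ennreal_minus)
      finally show False using L(3) by simp
    qed
    then have "measure M (UNIV - L) \<le> \<epsilon>" using prob_compl[of L] by simp
    then show "emeasure M (- L) \<le> ennreal \<epsilon>" 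
      by (simp add: emeasure_eq_measure Compl_eq_Diff_UNIV ennreal_leI)
  qed
qed

text \<open>Let \<delta> be the distance on the circle from \<theta> to L. From \<delta> \<le> |1 -
  u| \<le> |1 - r u| + (1 - r) \<le> 2 |1 - r u| the denominator of the kernel is at least (\<delta>
  / 2)^2 on L, while its numerator 1 - r^2 tends to 0.\<close>

lemma poisson_tendsto_off_compact:
  assumes L: "compact L" "L \<subseteq> {0..1}" and \<theta>: "0 < \<theta>" "\<theta> < 1" "\<theta> \<notin> L"
    and r: "\<And>j. 0 \<le> r j" "\<And>j. r j < 1" "r \<longlonglongrightarrow> 1"
  shows "(\<lambda>j. \<integral>\<^sup>+ x. indicator L x * ennreal (poisson (r j) \<theta> x) \<partial>M) \<longlonglongrightarrow> 0"
proof (cases "L = {}")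
  case False
  define B where "B = wave 1 ` L"
  have "compact B" unfolding B_def by (intro compact_continuous_image continuous_intros L)
  have "wave 1 \<theta> \<notin> B"
  proof
    assume "wave 1 \<theta> \<in> B"
    then obtain x where x: "x \<in> L" "wave 1 \<theta> = wave 1 x" by (auto simp: B_def)
    \<comment> \<open>The points 0 and 1 of L lie over the same point of the circle, hence the
      strict bounds on \<theta>.\<close>
    show False
    proof (cases "x = 1")
      case True
      then have "wave 1 \<theta> = wave 1 0" using x by (simp add: wave_def expi_eq_cis)
      then have "\<theta> = 0" using \<theta> by (intro wave_1_inj) auto
      then show False using \<theta> by simp
    next
      case False
      then have "0 \<le> x" "x < 1" using L x by force+
      then have "\<theta> = x" using \<theta> x by (intro wave_1_inj) auto
      then show False using \<theta> x by simp
    qed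
  qed
  define \<delta> where "\<delta> = infdist (wave 1 \<theta>) B"
  have \<delta>: "\<delta> > 0" unfolding \<delta>_def
    using \<open>compact B\<close> \<open>wave 1 \<theta> \<notin> B\<close> False
    by (intro infdist_pos_not_in_closed) (auto simp: compact_imp_closed B_def)
  have le: "poisson (r j) \<theta> x \<le> 4 * (1 - (r j)\<^sup>2) / \<delta>\<^sup>2" if "x \<in> L" for j x
  proof -
    define u where "u = wave 1 \<theta> * wave (-1) x"
    have "cmod u = 1" by (simp add: u_def norm_mult)
    have "\<delta> \<le> dist (wave 1 \<theta>) (wave 1 x)"
      unfolding \<delta>_def using that by (intro infdist_le) (auto simp: B_def)
    also have "\<dots> = cmod ((wave 1 \<theta> - wave 1 x) * wave (-1) x)" by (simp add: dist_norm norm_mult)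
    also have "\<dots> = cmod (1 - u)" by (simp add: u_def algebra_simps norm_minus_commute)
    also have "\<dots> \<le> cmod (1 - r j * u) + cmod (r j * u - u)"
      using norm_triangle_ineq[of "1 - r j * u" "r j * u - u"] by simp
    also have "cmod (r j * u - u) = 1 - r j"
    proof -
      have "r j * u - u = of_real (r j - 1) * u" by (simp add: algebra_simps)
      then have "cmod (r j * u - u) = \<bar>r j - 1\<bar>" using \<open>cmod u = 1\<close> by (simp only: norm_mult norm_of_real mult_1_right)
      then show ?thesis using r(2)[of j] by simp
    qed
    also have "\<dots> \<le> cmod (1 - r j * u)"
      using poisson_denominator[OF r(1,2), of j \<theta> x] by (simp add: u_def mult.assoc)
    finally have "\<delta> / 2 \<le> cmod (1 - r j * u)" by simp
    then have "(\<delta> / 2)\<^sup>2 \<le> (cmod (1 - r j * u))\<^sup>2" "0 < cmod (1 - r j * u)"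
      using \<delta> by (auto intro!: power_mono)
    then have "poisson (r j) \<theta> x \<le> (1 - (r j)\<^sup>2) / (\<delta> / 2)\<^sup>2"
      unfolding poisson_def mult.assoc u_def[symmetric]
      using \<delta> r(1,2)[of j] by (intro divide_left_mono mult_pos_pos zero_less_power) (auto simp: power_le_one)
    then show ?thesis by (simp add: power_divide mult.commute)
  qed
  have "(\<lambda>j. ennreal (4 * (1 - (r j)\<^sup>2) / \<delta>\<^sup>2)) \<longlonglongrightarrow> ennreal (4 * (1 - 1\<^sup>2) / \<delta>\<^sup>2)"
    by (intro tendsto_intros r) (use \<delta> in auto)
  then have lim: "(\<lambda>j. ennreal (4 * (1 - (r j)\<^sup>2) / \<delta>\<^sup>2)) \<longlonglongrightarrow> 0" by simp
  have up: "(\<integral>\<^sup>+ x. indicator L x * ennreal (poisson (r j) \<theta> x) \<partial>M)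
      \<le> ennreal (4 * (1 - (r j)\<^sup>2) / \<delta>\<^sup>2)" for j
  proof -
    have "(\<integral>\<^sup>+ x. indicator L x * ennreal (poisson (r j) \<theta> x) \<partial>M)
        \<le> (\<integral>\<^sup>+ x. ennreal (4 * (1 - (r j)\<^sup>2) / \<delta>\<^sup>2) \<partial>M)"
      using le by (intro nn_integral_mono) (auto simp: indicator_def intro: ennreal_leI)
    then show ?thesis by (simp add: emeasure_eq_measure)
  qed
  show ?thesis
    by (rule tendsto_sandwich[OF always_eventually always_eventually tendsto_const lim])
       (use up in auto)
qed simp

text \<open>By Bessel |b|^2 has integral at most S over each circle, so 1 - S is at most the
  integral of the bound on 1 - |b|^2. The Poisson integral is split at a compact null set L missing
  mass at most \<epsilon> / 4. The missing part contributes at most \<epsilon>, because the kernel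
  has integral at most 1 in \<theta>. The part from L tends to 0 almost everywhere, and the minimum
  with 1 is the majorant that lets the limit pass under the integral.\<close>

lemma sum_shift_coeff_squared_eq_1:
  assumes sing: "lebesgue_singular M" and S: "\<And>N. (\<Sum>k<N. (cmod (shift_coeff k))\<^sup>2) \<le> S" "S \<le> 1"
  shows "S = 1"
proof (rule antisym[OF S(2)], rule field_le_epsilon)
  fix \<epsilon> :: real assume "\<epsilon> > 0"
  then obtain L where L: "compact L" "L \<subseteq> {0..1}" "emeasure lborel L = 0" "emeasure M (- L) \<le> ennreal (\<epsilon> / 4)"
    using singular_compact_subset[OF sing, of "\<epsilon> / 4"] by auto
  have [measurable]: "L \<in> sets borel" using L by (simp add: compact_imp_closed borel_closed)
  interpret P: pair_sigma_finite lebesgue_unit M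
    by (simp add: pair_sigma_finite_def sigma_finite_measure_axioms unit.sigma_finite_measure_axioms)
  define r where "r j = 1 - 1 / real (Suc j)" for j
  have r: "0 \<le> r j" "r j < 1" for j by (auto simp: r_def field_simps)
  have rlim: "r \<longlonglongrightarrow> 1"
    using tendsto_diff[OF tendsto_const LIMSEQ_inverse_real_of_nat, of 1] by (simp add: r_def[abs_def] inverse_eq_divide)
  define P1 where "P1 j \<theta> = (\<integral>\<^sup>+ x. indicator L x * ennreal (poisson (r j) \<theta> x) \<partial>M)" for j \<theta>
  define P2 where "P2 j \<theta> = (\<integral>\<^sup>+ x. indicator (- L) x * ennreal (poisson (r j) \<theta> x) \<partial>M)" for j \<theta>
  have [measurable]: "P1 j \<in> borel_measurable borel" "P2 j \<in> borel_measurable borel" for j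
    unfolding P1_def[abs_def] P2_def[abs_def] by measurable
  have le: "ennreal (1 - S) \<le> (\<integral>\<^sup>+ \<theta>. min 1 (4 * P1 j \<theta>) \<partial>lebesgue_unit) + ennreal \<epsilon>" for j
  proof -
    let ?z = "\<lambda>\<theta>. of_real (r j) * wave 1 \<theta>"
    let ?F = "\<lambda>\<theta>. \<Sum>k. (shift_coeff k * of_real (r j) ^ k) * wave (int k) \<theta>"
    have F: "(\<Sum>k. shift_coeff k * (?z \<theta>) ^ k) = ?F \<theta>" for \<theta>
      by (simp add: power_mult_distrib wave_of_nat mult.assoc)
    have [measurable]: "?F \<in> borel_measurable borel" by measurable
    have "(\<integral>\<^sup>+ \<theta>. ennreal ((cmod (?F \<theta>))\<^sup>2) \<partial>lebesgue_unit) \<le> ennreal S"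
    proof (rule Bessel_absolutely_summable)
      show "summable (\<lambda>k. cmod (shift_coeff k * of_real (r j) ^ k))"
        by (rule summable_comparison_test[of _ "\<lambda>k. r j ^ k"])
           (use r[of j] norm_shift_coeff_le in \<open>auto simp: norm_mult norm_power intro!: mult_left_le_one_le summable_geometric\<close>)
      have "(cmod (shift_coeff k * of_real (r j) ^ k))\<^sup>2 \<le> (cmod (shift_coeff k))\<^sup>2" for k
        using r[of j] by (intro power_mono) (auto simp: norm_mult norm_power power_le_one mult_left_le)
      then show "(\<Sum>k<N. (cmod (shift_coeff k * of_real (r j) ^ k))\<^sup>2) \<le> S" for N
        using sum_mono[of "{..<N}" "\<lambda>k. (cmod (shift_coeff k * of_real (r j) ^ k))\<^sup>2" "\<lambda>k. (cmod (shift_coeff k))\<^sup>2"] S(1)[of N] by auto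
    qed
    moreover have "ennreal 1 \<le> (\<integral>\<^sup>+ \<theta>. (min 1 (4 * P1 j \<theta>) + 4 * P2 j \<theta>) + ennreal ((cmod (?F \<theta>))\<^sup>2) \<partial>lebesgue_unit)"
    proof -
      have "1 \<le> (min 1 (4 * P1 j \<theta>) + 4 * P2 j \<theta>) + ennreal ((cmod (?F \<theta>))\<^sup>2)" for \<theta>
      proof -
        let ?w = "?z \<theta> * ?F \<theta>"
        have "(\<integral>\<^sup>+ x. ennreal (poisson (r j) \<theta> x) \<partial>M) = P1 j \<theta> + P2 j \<theta>"
          unfolding P1_def P2_def
          by (subst nn_integral_add[symmetric]) (auto simp: indicator_def intro!: nn_integral_cong)
        then have "ennreal (1 - (cmod ?w)\<^sup>2) \<le> min 1 (4 * (P1 j \<theta> + P2 j \<theta>))"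
          using one_minus_norm_generating_function_le[OF r refl, of j \<theta>] unfolding F by simp
        also have "\<dots> \<le> min 1 (4 * P1 j \<theta>) + 4 * P2 j \<theta>"
          by (simp add: distrib_left min_def add_increasing2)
        finally have 1: "ennreal (1 - (cmod ?w)\<^sup>2) \<le> min 1 (4 * P1 j \<theta>) + 4 * P2 j \<theta>" .
        have "(cmod ?w)\<^sup>2 \<le> (cmod (?F \<theta>))\<^sup>2"
          using r[of j] by (intro power_mono) (auto simp: norm_mult intro!: mult_left_le_one_le)
        \<comment> \<open>\<open>ennreal\<close> cuts negative numbers off at 0, so the positive
          part is made explicit before the sum is split.\<close>
        then have "1 \<le> max 0 (1 - (cmod ?w)\<^sup>2) + (cmod (?F \<theta>))\<^sup>2" by linarith
        then have "ennreal 1 \<le> ennreal (max 0 (1 - (cmod ?w)\<^sup>2) + (cmod (?F \<theta>))\<^sup>2)" by (rule ennreal_leI)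
        also have "\<dots> = ennreal (1 - (cmod ?w)\<^sup>2) + ennreal ((cmod (?F \<theta>))\<^sup>2)"
          by (subst ennreal_plus) (auto simp: max_def ennreal_neg)
        finally show ?thesis using 1 by (simp add: order_trans[OF _ add_right_mono])
      qed
      then have "(\<integral>\<^sup>+ \<theta>. 1 \<partial>lebesgue_unit) \<le> (\<integral>\<^sup>+ \<theta>. (min 1 (4 * P1 j \<theta>) + 4 * P2 j \<theta>) + ennreal ((cmod (?F \<theta>))\<^sup>2) \<partial>lebesgue_unit)"
        by (intro nn_integral_mono)
      then show ?thesis using unit.emeasure_space_1 by simp
    qed
    moreover have "(\<integral>\<^sup>+ \<theta>. P2 j \<theta> \<partial>lebesgue_unit) \<le> ennreal (\<epsilon> / 4)"
    proof -
      have "(\<integral>\<^sup>+ \<theta>. P2 j \<theta> \<partial>lebesgue_unit)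
          = (\<integral>\<^sup>+ x. \<integral>\<^sup>+ \<theta>. indicator (- L) x * ennreal (poisson (r j) \<theta> x) \<partial>lebesgue_unit \<partial>M)"
        unfolding P2_def by (rule P.Fubini'[symmetric]) measurable
      also have "\<dots> = (\<integral>\<^sup>+ x. indicator (- L) x * (\<integral>\<^sup>+ \<theta>. ennreal (poisson (r j) \<theta> x) \<partial>lebesgue_unit) \<partial>M)"
        by (intro nn_integral_cong nn_integral_cmult) measurable
      also have "\<dots> \<le> (\<integral>\<^sup>+ x. indicator (- L) x * 1 \<partial>M)"
        by (intro nn_integral_mono mult_left_mono nn_integral_poisson_le r) auto
      also have "\<dots> = emeasure M (- L)" by simp
      finally show ?thesis using L(4) by (rule order_trans)
    qed
    ultimately have "ennreal 1 \<le> ((\<integral>\<^sup>+ \<theta>. min 1 (4 * P1 j \<theta>) \<partial>lebesgue_unit) + 4 * ennreal (\<epsilon> / 4)) + ennreal S"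
      by (simp add: nn_integral_add nn_integral_cmult)
         (meson add_mono mult_left_mono order_refl order_trans zero_le)
    also have "4 * ennreal (\<epsilon> / 4) = ennreal \<epsilon>"
      using \<open>\<epsilon> > 0\<close> by (simp flip: ennreal_numeral ennreal_mult)
    finally have "ennreal 1 - ennreal S \<le> (\<integral>\<^sup>+ \<theta>. min 1 (4 * P1 j \<theta>) \<partial>lebesgue_unit) + ennreal \<epsilon>"
      by (subst ennreal_minus_le_iff) (auto simp: add_ac)
    moreover have "0 \<le> S" using S(1)[of 0] by simp
    ultimately show ?thesis by (simp add: ennreal_minus del: ennreal_1)
  qed
  have "(\<lambda>j. \<integral>\<^sup>+ \<theta>. min 1 (4 * P1 j \<theta>) \<partial>lebesgue_unit) \<longlonglongrightarrow> (\<integral>\<^sup>+ \<theta>. 0 \<partial>lebesgue_unit)"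
  proof (rule nn_integral_dominated_convergence[where w = "\<lambda>_. 1"])
    have "AE \<theta> in lebesgue_unit. \<theta> \<in> {0..1}"
      by (rule AE_uniform_measureI) auto
    moreover have "AE \<theta> in lebesgue_unit. \<theta> \<notin> {0, 1}"
    proof (rule AE_uniform_measureI)
      show "AE \<theta> in lborel. \<theta> \<in> {0..1} \<longrightarrow> \<theta> \<notin> {0, 1}"
        using AE_lborel_singleton[of 0] AE_lborel_singleton[of 1] by eventually_elim auto
    qed simp
    moreover have "AE \<theta> in lebesgue_unit. \<theta> \<notin> L"
    proof (rule AE_uniform_measureI)
      have "AE x in lborel. x \<notin> L" using L(3) by (intro AE_not_in) auto
      then show "AE x in lborel. x \<in> {0..1} \<longrightarrow> x \<notin> L" by eventually_elim auto
    qed simp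
    ultimately show "AE \<theta> in lebesgue_unit. (\<lambda>j. min 1 (4 * P1 j \<theta>)) \<longlonglongrightarrow> 0"
    proof eventually_elim
      case (elim \<theta>)
      have "(\<lambda>j. P1 j \<theta>) \<longlonglongrightarrow> 0"
        unfolding P1_def using elim by (intro poisson_tendsto_off_compact L r rlim) auto
      then have "(\<lambda>j. 4 * P1 j \<theta>) \<longlonglongrightarrow> 4 * 0" by (intro ennreal_tendsto_cmult) auto
      then have "(\<lambda>j. min 1 (4 * P1 j \<theta>)) \<longlonglongrightarrow> min 1 0" by (intro tendsto_min tendsto_const) simp
      then show ?case by simp
    qed
    show "(\<integral>\<^sup>+ x. 1 \<partial>lebesgue_unit) < \<infinity>" using unit.emeasure_space_1 by simp
  qed (auto simp: min_def)
  then have "(\<lambda>j. (\<integral>\<^sup>+ \<theta>. min 1 (4 * P1 j \<theta>) \<partial>lebesgue_unit) + ennreal \<epsilon>) \<longlonglongrightarrow> 0 + ennreal \<epsilon>"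
    by (intro tendsto_intros) simp
  then have "ennreal (1 - S) \<le> ennreal \<epsilon>" using le by (intro LIMSEQ_le_const[where X = "\<lambda>j. (\<integral>\<^sup>+ \<theta>. min 1 (4 * P1 j \<theta>) \<partial>lebesgue_unit) + ennreal \<epsilon>"]) auto
  then show "1 \<le> S + \<epsilon>" using \<open>\<epsilon> > 0\<close> by simp
qed

theorem kaczmarz_converges:
  assumes "lebesgue_singular M" "f \<in> L2 M"
  shows "(\<lambda>k. energy M (kaczmarz M f k)) \<longlonglongrightarrow> 0"
proof -
  define S where "S = (\<Sum>k. (cmod (shift_coeff k))\<^sup>2)"
  have sums: "summable (\<lambda>k. (cmod (shift_coeff k))\<^sup>2)"
    by (rule bounded_imp_summable[where B = 1]) (use sum_shift_coeff_squared_le[of "Suc _"] in \<open>auto simp: lessThan_Suc_atMost\<close>)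
  have "(\<Sum>k<N. (cmod (shift_coeff k))\<^sup>2) \<le> S" for N
    unfolding S_def by (rule sum_le_suminf[OF sums]) auto
  moreover have "S \<le> 1" unfolding S_def by (rule suminf_le_const[OF sums sum_shift_coeff_squared_le])
  ultimately have "S = 1" by (rule sum_shift_coeff_squared_eq_1[OF assms(1)])
  then have "(\<lambda>N. energy M (wave (-1)) - (\<Sum>k<N. (cmod (shift_coeff k))\<^sup>2)) \<longlonglongrightarrow> 1 - 1"
    using summable_LIMSEQ[OF sums] by (intro tendsto_diff) (auto simp: S_def energy_wave)
  then have "effective (wave (-1))"
    by (simp add: effective_def wave_L2 kaczmarz_energy)
  then show ?thesis using effective_L2[OF _ assms(2)] by (simp add: effective_def)
qed

corollary kaczmarz_sums:
  assumes "lebesgue_singular M" "f \<in> L2 M"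
  shows "L2_sums M (\<lambda>k x. kaczmarz_coeff M f k * wave (int k) x) f"
proof -
  let ?S = "\<lambda>N x. \<Sum>k<N. kaczmarz_coeff M f k * wave (int k) x"
  have "(\<lambda>x. ?S N x - f x) \<in> L2 M" for N
    by (intro L2_diff L2_sum L2_cmult wave_L2 assms)
  moreover have "energy M (\<lambda>x. ?S N x - f x) = energy M (kaczmarz M f N)" for N
    unfolding kaczmarz_eq_diff[abs_def] by (rule energy_minus_commute)
  ultimately show ?thesis
    using L2_tendsto_iff_energy[of ?S f M sequentially] kaczmarz_converges[OF assms] assms
    by (simp add: L2_sums_def)
qed

end

section \<open>Expansions along a disintegration\<close>

text \<open>Nonnegativity of the variance.\<close>

lemma (in prob_space) norm_expectation_squared_le:
  fixes f :: "'a \<Rightarrow> complex"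
  assumes "f \<in> L2 M"
  shows "(cmod (expectation f))\<^sup>2 \<le> energy M f"
proof -
  let ?c = "expectation f"
  have c: "(\<lambda>x. - ?c) \<in> L2 M" by (intro L2_bounded) auto
  have "expectation (\<lambda>x. f x * cnj (- ?c)) = ?c * cnj (- ?c)"
    using L2_integrable[OF assms] by simp
  also have "Re \<dots> = - (cmod ?c)\<^sup>2"
    unfolding cmod_power2 by (simp add: power2_eq_square)
  finally have "energy M (\<lambda>x. f x + - ?c) = energy M f - (cmod ?c)\<^sup>2"
    unfolding energy_add[OF assms c] using prob_space by (simp add: energy_def)
  then show ?thesis using energy_nonneg[of M "\<lambda>x. f x + - ?c"] by linarith
qed

text \<open>Brings a series on the base back to the plane: the factor w, later a fibre exponential,
  does not change the modulus of a difference, and what remains depends on the base coordinate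
  only.\<close>

lemma L2_tendsto_lift:
  assumes [measurable]: "\<beta> \<in> borel_measurable M" "\<And>i. S i \<in> borel_measurable borel" "g \<in> borel_measurable borel"
    and w: "\<And>z. cmod (w z) = 1"
    and S: "L2_tendsto (distr M borel \<beta>) S g F"
  shows "L2_tendsto M (\<lambda>i z. S i (\<beta> z) * w z) (\<lambda>z. g (\<beta> z) * w z) F"
proof -
  have "cmod (S i (\<beta> z) * w z - g (\<beta> z) * w z) = cmod (S i (\<beta> z) - g (\<beta> z))" for i z
    by (simp flip: left_diff_distrib add: norm_mult w)
  then have "(\<integral>\<^sup>+ z. ennreal ((cmod (S i (\<beta> z) * w z - g (\<beta> z) * w z))\<^sup>2) \<partial>M)
      = (\<integral>\<^sup>+ s. ennreal ((cmod (S i s - g s))\<^sup>2) \<partial>distr M borel \<beta>)" for i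
    by (simp add: nn_integral_distr)
  then show ?thesis using S by (simp add: L2_tendsto_def)
qed

lemma L2_lift:
  assumes [measurable]: "\<beta> \<in> borel_measurable M" and "w \<in> borel_measurable M"
    and "\<And>z. cmod (w z) = 1" "g \<in> L2 (distr M borel \<beta>)"
  shows "(\<lambda>z. g (\<beta> z) * w z) \<in> L2 M"
proof (rule L2_mult_unimodular)
  have [measurable]: "g \<in> borel_measurable borel" using assms(4) by (simp add: L2_def)
  show "(\<lambda>z. g (\<beta> z)) \<in> L2 M"
    using assms(4) by (simp add: L2_def integrable_distr_eq)
qed (use assms in auto)

text \<open>Base and fibre coordinates are kept abstract so that vertical slices over the first axis
  and horizontal slices over the second one are two instances of the same argument.\<close>

locale slicing = prob_space \<mu> for \<mu> :: "(real \<times> real) measure" +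
  fixes c :: "real \<Rightarrow> real \<Rightarrow> real \<times> real" and \<beta> \<upsilon> :: "real \<times> real \<Rightarrow> real" and \<rho> :: "real \<Rightarrow> real measure"
  assumes sets_\<mu> [measurable_cong, simp]: "sets \<mu> = sets borel"
    and c_measurable [measurable]: "\<And>s. c s \<in> borel_measurable borel"
    and base_measurable [measurable]: "\<beta> \<in> borel_measurable borel"
    and fibre_measurable [measurable]: "\<upsilon> \<in> borel_measurable borel"
    and base_c [simp]: "\<beta> (c s u) = s"
    and fibre_c [simp]: "\<upsilon> (c s u) = u"
    and c_base_fibre [simp]: "c (\<beta> z) (\<upsilon> z) = z"
    and disintegration: "is_disintegration c \<mu> (distr \<mu> borel \<beta>) \<rho>"
begin

abbreviation marginal :: "real measure" where
  "marginal \<equiv> distr \<mu> borel \<beta>"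

lemma slice_prob_space: "prob_space (\<rho> s)"
  and sets_slice [measurable_cong, simp]: "sets (\<rho> s) = sets borel"
  using disintegration by (auto simp: is_disintegration_def)

lemma space_slice [simp]: "space (\<rho> s) = UNIV"
  using sets_eq_imp_space_eq[OF sets_slice] by simp

lemma space_\<mu> [simp]: "space \<mu> = UNIV"
  using sets_eq_imp_space_eq[OF sets_\<mu>] by simp

lemma disintegrate:
  fixes f :: "real \<times> real \<Rightarrow> complex"
  assumes "integrable \<mu> f"
  shows "AE s in marginal. integrable (\<rho> s) (\<lambda>u. f (c s u))"
    and "integrable marginal (\<lambda>s. \<integral>u. f (c s u) \<partial>\<rho> s)"
    and "(\<integral>z. f z \<partial>\<mu>) = (\<integral>s. (\<integral>u. f (c s u) \<partial>\<rho> s) \<partial>marginal)"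
  using disintegration assms by (simp_all add: is_disintegration_def)

lemma disintegrate_L2:
  assumes "h \<in> L2 \<mu>"
  shows "AE s in marginal. (\<lambda>u. h (c s u)) \<in> L2 (\<rho> s)"
    and "integrable marginal (\<lambda>s. energy (\<rho> s) (\<lambda>u. h (c s u)))"
    and "energy \<mu> h = (\<integral>s. energy (\<rho> s) (\<lambda>u. h (c s u)) \<partial>marginal)"
proof -
  have [measurable]: "h \<in> borel_measurable borel"
    using assms by (simp add: L2_def measurable_cong_sets[OF sets_\<mu> refl])
  \<comment> \<open>The disintegration formula is stated for complex integrands, so the squared
    modulus is embedded and then projected back.\<close>
  have int: "integrable \<mu> (\<lambda>z. complex_of_real ((cmod (h z))\<^sup>2))"
    using L2_integrable_squared[OF assms] by (simp only: complex_of_real_integrable_eq)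
  note d = disintegrate[OF int, unfolded integral_complex_of_real complex_of_real_integrable_eq]
  show "AE s in marginal. (\<lambda>u. h (c s u)) \<in> L2 (\<rho> s)"
    using d(1) by eventually_elim (simp add: L2_def)
  show "integrable marginal (\<lambda>s. energy (\<rho> s) (\<lambda>u. h (c s u)))"
    unfolding energy_def by (rule d(2))
  show "energy \<mu> h = (\<integral>s. energy (\<rho> s) (\<lambda>u. h (c s u)) \<partial>marginal)"
    unfolding energy_def using d(3) by (simp only: of_real_eq_iff)
qed

text \<open>The indicator of the exceptional set has energy 0, so almost all of its slices have
  energy 0.\<close>

lemma disintegrate_AE:
  assumes [measurable]: "{z. P z} \<in> sets borel" and P: "AE z in \<mu>. P z"
  shows "AE s in marginal. AE u in \<rho> s. P (c s u)"
proof -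
  define h :: "real \<times> real \<Rightarrow> complex" where "h z = (if P z then 0 else 1)" for z
  have [measurable]: "Measurable.pred borel P" by (simp add: pred_def)
  have "h \<in> borel_measurable borel" unfolding h_def[abs_def] by measurable
  then have h: "h \<in> L2 \<mu>"
    by (intro L2_bounded[where B = 1]) (auto simp: h_def measurable_cong_sets[OF sets_\<mu> refl])
  have "energy \<mu> h = 0"
    unfolding energy_def by (rule integral_eq_zero_AE) (use P in \<open>auto simp: h_def\<close>)
  then have "AE s in marginal. energy (\<rho> s) (\<lambda>u. h (c s u)) = 0"
    using integral_nonneg_eq_0_iff_AE[OF disintegrate_L2(2)[OF h]] disintegrate_L2(3)[OF h] by simp
  then show ?thesis
    using disintegrate_L2(1)[OF h]
  proof eventually_elim
    case (elim s)
    then have "AE u in \<rho> s. (cmod (h (c s u)))\<^sup>2 = 0"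
      unfolding energy_def using integral_nonneg_eq_0_iff_AE[OF L2_integrable_squared[OF elim(2)]] by simp
    then show ?case by eventually_elim (auto simp: h_def split: if_splits)
  qed
qed

text \<open>The residuals of all slices glued into one function on the plane, to which the
  disintegration formula can be applied.\<close>

definition slice_residual :: "(real \<times> real \<Rightarrow> complex) \<Rightarrow> nat \<Rightarrow> real \<times> real \<Rightarrow> complex" where
  "slice_residual f k z = kaczmarz (\<rho> (\<beta> z)) (\<lambda>u. f (c (\<beta> z) u)) k (\<upsilon> z)"

definition slice_coeff :: "(real \<times> real \<Rightarrow> complex) \<Rightarrow> nat \<Rightarrow> real \<Rightarrow> complex" where
  "slice_coeff f k s = kaczmarz_coeff (\<rho> s) (\<lambda>u. f (c s u)) k"

lemma slice_residual_c: "slice_residual f k (c s u) = kaczmarz (\<rho> s) (\<lambda>u. f (c s u)) k u"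
  by (simp add: slice_residual_def)

lemma slice_coeff_eq: "slice_coeff f k s = (\<integral>u. slice_residual f k (c s u) * wave (- int k) (\<upsilon> (c s u)) \<partial>\<rho> s)"
  by (simp add: slice_coeff_def kaczmarz_coeff_def slice_residual_c)

lemma slice_residual_Suc:
  "slice_residual f (Suc k) = (\<lambda>z. slice_residual f k z - slice_coeff f k (\<beta> z) * wave (int k) (\<upsilon> z))"
  by (simp add: slice_residual_def slice_coeff_def kaczmarz_Suc fun_eq_iff)

text \<open>The coefficient is a slice integral of the L2 function h: the disintegration formula
  makes it measurable, and its square is bounded by the slice energy of h, which is integrable over
  the base.\<close>

lemma slice_coeff_L2:
  assumes R: "slice_residual f k \<in> L2 \<mu>"
  shows "slice_coeff f k \<in> L2 marginal"
proof -
  define h where "h z = slice_residual f k z * wave (- int k) (\<upsilon> z)" for z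
  have h: "h \<in> L2 \<mu>" unfolding h_def[abs_def] by (rule L2_mult_unimodular[OF R]) auto
  have G: "slice_coeff f k s = (\<integral>u. h (c s u) \<partial>\<rho> s)" for s
    by (simp add: slice_coeff_eq h_def)
  have [measurable]: "slice_coeff f k \<in> borel_measurable marginal"
    unfolding G[abs_def] using disintegrate(2)[OF L2_integrable[OF h]] by (rule borel_measurable_integrable)
  have "AE s in marginal. (cmod (slice_coeff f k s))\<^sup>2 \<le> energy (\<rho> s) (\<lambda>u. h (c s u))"
    using disintegrate_L2(1)[OF h]
    by eventually_elim (auto simp: G intro: prob_space.norm_expectation_squared_le[OF slice_prob_space])
  then have "integrable marginal (\<lambda>s. (cmod (slice_coeff f k s))\<^sup>2)"
    by (intro Bochner_Integration.integrable_bound[OF disintegrate_L2(2)[OF h]]) auto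
  then show ?thesis by (simp add: L2_def)
qed

lemma slice_residual_0: "slice_residual f 0 = f"
  by (simp add: slice_residual_def fun_eq_iff)

text \<open>Each residual in L2 makes the next coefficient a square integrable function on the base,
  and subtracting this coefficient times a unimodular factor gives the next residual.\<close>

lemma slice_residual_L2:
  assumes "f \<in> L2 \<mu>"
  shows "slice_residual f k \<in> L2 \<mu>"
proof (induction k)
  case (Suc k)
  have "(\<lambda>z. slice_coeff f k (\<beta> z) * wave (int k) (\<upsilon> z)) \<in> L2 \<mu>"
    by (rule L2_lift[OF _ _ _ slice_coeff_L2[OF Suc]]) auto
  then show ?case unfolding slice_residual_Suc by (rule L2_diff[OF Suc])
qed (simp add: slice_residual_0 assms)

lemma slice_residual_eq_diff:
  "slice_residual f N z = f z - (\<Sum>k<N. slice_coeff f k (\<beta> z) * wave (int k) (\<upsilon> z))"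
  by (induction N) (simp_all add: slice_residual_Suc slice_residual_0)

text \<open>Slicewise convergence is integrated over the base. The energy of the slice of f is the
  majorant, since the algorithm never increases energy.\<close>

lemma slice_expansion:
  assumes f: "f \<in> L2 \<mu>"
    and slices: "AE s in marginal. circle_measure (\<rho> s) \<and> lebesgue_singular (\<rho> s)"
  shows "L2_sums \<mu> (\<lambda>k z. slice_coeff f k (\<beta> z) * wave (int k) (\<upsilon> z)) f"
proof -
  have R: "slice_residual f N \<in> L2 \<mu>" for N by (rule slice_residual_L2[OF f])
  have "(\<lambda>N. \<integral>s. energy (\<rho> s) (\<lambda>u. slice_residual f N (c s u)) \<partial>marginal) \<longlonglongrightarrow> (\<integral>s. 0 \<partial>marginal)"
  proof (rule integral_dominated_convergence)
    show "AE s in marginal. (\<lambda>N. energy (\<rho> s) (\<lambda>u. slice_residual f N (c s u))) \<longlonglongrightarrow> 0"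
      using slices disintegrate_L2(1)[OF f]
      by eventually_elim
         (auto simp: slice_residual_c intro: circle_measure.kaczmarz_converges)
    show "AE s in marginal. norm (energy (\<rho> s) (\<lambda>u. slice_residual f N (c s u)))
        \<le> energy (\<rho> s) (\<lambda>u. f (c s u))" for N
      using slices disintegrate_L2(1)[OF f]
      by eventually_elim
         (auto simp: slice_residual_c intro: circle_measure.kaczmarz_energy_le)
    show "integrable marginal (\<lambda>s. energy (\<rho> s) (\<lambda>u. f (c s u)))"
      by (rule disintegrate_L2(2)[OF f])
    show "(\<lambda>s. energy (\<rho> s) (\<lambda>u. slice_residual f N (c s u))) \<in> borel_measurable marginal" for N
      by (rule borel_measurable_integrable[OF disintegrate_L2(2)[OF R]])
  qed simp
  then have lim: "(\<lambda>N. energy \<mu> (slice_residual f N)) \<longlonglongrightarrow> 0"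
    by (simp add: disintegrate_L2(3)[OF R])
  let ?S = "\<lambda>N z. \<Sum>k<N. slice_coeff f k (\<beta> z) * wave (int k) (\<upsilon> z)"
  have res: "slice_residual f N = (\<lambda>z. f z - ?S N z)" for N
    by (simp add: slice_residual_eq_diff fun_eq_iff)
  have "(\<lambda>z. ?S N z - f z) \<in> L2 \<mu>" for N
    using L2_minus[OF R[of N]] by (simp add: res)
  moreover have "energy \<mu> (\<lambda>z. ?S N z - f z) = energy \<mu> (slice_residual f N)" for N
    unfolding res by (rule energy_minus_commute)
  ultimately show ?thesis
    using L2_tendsto_iff_energy[of ?S f \<mu> sequentially] lim f by (simp add: L2_sums_def)
qed

theorem iterated_expansion:
  assumes f: "f \<in> L2 \<mu>"
    and slices: "AE s in marginal. circle_measure (\<rho> s) \<and> lebesgue_singular (\<rho> s)"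
    and base: "circle_measure marginal" "lebesgue_singular marginal"
  shows "\<exists>d. L2_iterated_sums \<mu> (\<lambda>k l z. d k l * expi (of_nat k * \<upsilon> z + of_nat l * \<beta> z)) f"
proof -
  let ?G = "\<lambda>k. slice_coeff f k"
  define d where "d k l = kaczmarz_coeff marginal (?G k) l" for k l
  have G: "?G k \<in> L2 marginal" for k by (intro slice_coeff_L2 slice_residual_L2 f)
  have "L2_sums \<mu> (\<lambda>l z. d k l * expi (of_nat k * \<upsilon> z + of_nat l * \<beta> z))
      (\<lambda>z. ?G k (\<beta> z) * wave (int k) (\<upsilon> z))" for k
    unfolding L2_sums_def
  proof
    show "(\<lambda>z. ?G k (\<beta> z) * wave (int k) (\<upsilon> z)) \<in> L2 \<mu>" by (rule L2_lift[OF _ _ _ G]) auto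
    have [measurable]: "?G k \<in> borel_measurable borel" using G by (simp add: L2_def)
    have "L2_tendsto marginal (\<lambda>N s. \<Sum>l<N. d k l * wave (int l) s) (?G k) sequentially"
      using circle_measure.kaczmarz_sums[OF base G[of k]] by (simp add: L2_sums_def d_def)
    then have "L2_tendsto \<mu> (\<lambda>N z. (\<Sum>l<N. d k l * wave (int l) (\<beta> z)) * wave (int k) (\<upsilon> z))
        (\<lambda>z. ?G k (\<beta> z) * wave (int k) (\<upsilon> z)) sequentially"
      by (intro L2_tendsto_lift) auto
    moreover have "(\<Sum>l<N. d k l * wave (int l) (\<beta> z)) * wave (int k) (\<upsilon> z)
        = (\<Sum>l<N. d k l * expi (of_nat k * \<upsilon> z + of_nat l * \<beta> z))" for N z
      unfolding sum_distrib_right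
      by (intro sum.cong refl) (simp add: wave_def expi_eq_cis mult.assoc cis_mult distrib_left add.commute)
    ultimately show "L2_tendsto \<mu> (\<lambda>N z. \<Sum>l<N. d k l * expi (of_nat k * \<upsilon> z + of_nat l * \<beta> z))
        (\<lambda>z. ?G k (\<beta> z) * wave (int k) (\<upsilon> z)) sequentially" by simp
  qed
  then show ?thesis
    using slice_expansion[OF f slices] unfolding L2_iterated_sums_def
    by (intro exI[of _ d] exI[of _ "\<lambda>k z. ?G k (\<beta> z) * wave (int k) (\<upsilon> z)"]) auto
qed

theorem iterated_expansion_bilateral:
  assumes f: "f \<in> L2 \<mu>"
    and slices: "AE s in marginal. circle_measure (\<rho> s) \<and> lebesgue_singular (\<rho> s)"
    and base: "marginal = lebesgue_unit"
  shows "\<exists>d. L2_iterated_sums_bilateral \<mu> (\<lambda>k l z. d k l * expi (of_nat k * \<upsilon> z + of_int l * \<beta> z)) f"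
proof -
  let ?G = "\<lambda>k. slice_coeff f k"
  have G: "?G k \<in> L2 marginal" for k by (intro slice_coeff_L2 slice_residual_L2 f)
  then have "\<forall>k. \<exists>d. L2_sums_bilateral marginal (\<lambda>l x. d l * wave l x) (?G k)"
    using Fourier_series_lebesgue_unit unfolding base by blast
  then obtain d where d: "\<And>k. L2_sums_bilateral marginal (\<lambda>l x. d k l * wave l x) (?G k)"
    by metis
  have "L2_sums_bilateral \<mu> (\<lambda>l z. d k l * expi (of_nat k * \<upsilon> z + of_int l * \<beta> z))
      (\<lambda>z. ?G k (\<beta> z) * wave (int k) (\<upsilon> z))" for k
    unfolding L2_sums_bilateral_def
  proof
    show "(\<lambda>z. ?G k (\<beta> z) * wave (int k) (\<upsilon> z)) \<in> L2 \<mu>" by (rule L2_lift[OF _ _ _ G]) auto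
    have [measurable]: "?G k \<in> borel_measurable borel" using G by (simp add: L2_def)
    let ?I = "\<lambda>i. {- int (fst i)..int (snd i)}"
    have "L2_tendsto marginal (\<lambda>i s. \<Sum>l\<in>?I i. d k l * wave l s) (?G k) (sequentially \<times>\<^sub>F sequentially)"
      using d[of k] by (simp add: L2_sums_bilateral_def case_prod_unfold)
    then have "L2_tendsto \<mu> (\<lambda>i z. (\<Sum>l\<in>?I i. d k l * wave l (\<beta> z)) * wave (int k) (\<upsilon> z))
        (\<lambda>z. ?G k (\<beta> z) * wave (int k) (\<upsilon> z)) (sequentially \<times>\<^sub>F sequentially)"
      by (intro L2_tendsto_lift) auto
    moreover have "(\<Sum>l\<in>I. d k l * wave l (\<beta> z)) * wave (int k) (\<upsilon> z)
        = (\<Sum>l\<in>I. d k l * expi (of_nat k * \<upsilon> z + of_int l * \<beta> z))" for I z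
      unfolding sum_distrib_right
      by (intro sum.cong refl) (simp add: wave_def expi_eq_cis mult.assoc cis_mult distrib_left add.commute)
    ultimately show "L2_tendsto \<mu> (\<lambda>(A, B) z. \<Sum>l\<in>{- int A..int B}. d k l * expi (of_nat k * \<upsilon> z + of_int l * \<beta> z))
        (\<lambda>z. ?G k (\<beta> z) * wave (int k) (\<upsilon> z)) (sequentially \<times>\<^sub>F sequentially)"
      by (simp add: case_prod_unfold)
  qed
  then show ?thesis
    using slice_expansion[OF f slices] unfolding L2_iterated_sums_bilateral_def
    by (intro exI[of _ d] exI[of _ "\<lambda>k z. ?G k (\<beta> z) * wave (int k) (\<upsilon> z)"]) auto
qed

end

section \<open>Self-similar measures on the line\<close>

text \<open>Self-similarity is recorded for distribution functions because this is what invariance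
  under continuous test functions yields directly. Some weights may be 0, namely those of empty
  columns or rows.\<close>

locale self_similar = prob_space \<nu> for \<nu> :: "real measure" +
  fixes N :: nat and q :: "nat \<Rightarrow> real"
  assumes sets_\<nu> [measurable_cong, simp]: "sets \<nu> = sets borel"
    and N: "2 \<le> N"
    and q_nonneg: "\<And>i. i < N \<Longrightarrow> 0 \<le> q i" and q_sum: "(\<Sum>i<N. q i) = 1"
    and support: "AE x in \<nu>. 0 \<le> x \<and> x \<le> 1"
    and cdf_similar: "\<And>a. cdf \<nu> a = (\<Sum>i<N. q i * cdf \<nu> (real N * a - real i))"
begin

lemma space_\<nu> [simp]: "space \<nu> = UNIV"
  using sets_eq_imp_space_eq[OF sets_\<nu>] by simp

lemma real_distribution_\<nu>: "real_distribution \<nu>"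
  by (simp add: real_distribution_def real_distribution_axioms_def prob_space_axioms)

lemma nn_integral_indicator_map:
  assumes [measurable]: "A \<in> sets borel"
  shows "(\<integral>\<^sup>+ x. indicator A ((x + real i) / real N) \<partial>\<nu>) = emeasure \<nu> {x. (x + real i) / real N \<in> A}"
proof -
  have "(\<integral>\<^sup>+ x. indicator A ((x + real i) / real N) \<partial>\<nu>)
      = (\<integral>\<^sup>+ x. indicator {x. (x + real i) / real N \<in> A} x \<partial>\<nu>)"
    by (intro nn_integral_cong) (simp add: indicator_def)
  then show ?thesis by simp
qed

text \<open>\<nu>' is the law of (x + i) / N for x drawn from \<nu> and an independent digit i drawn
  with weights q. Its distribution function is that of \<nu>, so the two measures agree and the
  formula for \<nu>' transfers.\<close>

lemma nn_integral_similar: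
  assumes [measurable]: "h \<in> borel_measurable borel"
  shows "(\<integral>\<^sup>+ x. h x \<partial>\<nu>) = (\<Sum>i<N. ennreal (q i) * (\<integral>\<^sup>+ x. h ((x + real i) / real N) \<partial>\<nu>))"
proof -
  let ?P = "point_measure {..<N} (\<lambda>i. ennreal (q i))"
  let ?g = "\<lambda>(i, x). (x + real i) / real N"
  define \<nu>' where "\<nu>' = distr (?P \<Otimes>\<^sub>M \<nu>) borel ?g"
  have g: "?g \<in> borel_measurable (?P \<Otimes>\<^sub>M \<nu>)"
  proof -
    have "?g \<in> borel_measurable (count_space {..<N} \<Otimes>\<^sub>M \<nu>)"
      by (rule measurable_pair_measure_countable1) auto
    also have "borel_measurable (count_space {..<N} \<Otimes>\<^sub>M \<nu>) = borel_measurable (?P \<Otimes>\<^sub>M \<nu>)"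
      by (intro measurable_cong_sets sets_pair_measure_cong) (auto simp: sets_point_measure)
    finally show ?thesis .
  qed
  have nn: "(\<integral>\<^sup>+ x. f x \<partial>\<nu>') = (\<Sum>i<N. ennreal (q i) * (\<integral>\<^sup>+ x. f ((x + real i) / real N) \<partial>\<nu>))"
    if [measurable]: "f \<in> borel_measurable borel" for f
  proof -
    have "(\<integral>\<^sup>+ x. f x \<partial>\<nu>') = (\<integral>\<^sup>+ z. f (?g z) \<partial>(?P \<Otimes>\<^sub>M \<nu>))"
      unfolding \<nu>'_def by (rule nn_integral_distr[OF g]) simp
    also have "\<dots> = (\<integral>\<^sup>+ i. \<integral>\<^sup>+ x. f (?g (i, x)) \<partial>\<nu> \<partial>?P)"
      by (rule nn_integral_fst[symmetric]) (rule measurable_compose[OF g that])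
    also have "\<dots> = (\<Sum>i<N. ennreal (q i) * (\<integral>\<^sup>+ x. f ((x + real i) / real N) \<partial>\<nu>))"
      by (simp add: nn_integral_point_measure_finite)
    finally show ?thesis .
  qed
  have em: "emeasure \<nu>' A = (\<Sum>i<N. ennreal (q i) * emeasure \<nu> {x. (x + real i) / real N \<in> A})"
    if [measurable]: "A \<in> sets borel" for A
  proof -
    have "emeasure \<nu>' A = (\<integral>\<^sup>+ x. indicator A x \<partial>\<nu>')"
      by (simp add: \<nu>'_def that)
    also have "\<dots> = (\<Sum>i<N. ennreal (q i) * (\<integral>\<^sup>+ x. indicator A ((x + real i) / real N) \<partial>\<nu>))"
      by (intro nn) simp
    also have "\<dots> = (\<Sum>i<N. ennreal (q i) * emeasure \<nu> {x. (x + real i) / real N \<in> A})"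
      by (simp only: nn_integral_indicator_map that)
    finally show ?thesis .
  qed
  have "prob_space \<nu>'"
  proof
    have "emeasure \<nu>' UNIV = (\<Sum>i<N. ennreal (q i))"
      using emeasure_space_1 by (simp add: em)
    also have "\<dots> = ennreal (\<Sum>i<N. q i)" by (rule sum_ennreal) (simp add: q_nonneg)
    finally show "emeasure \<nu>' (space \<nu>') = 1" by (simp add: q_sum \<nu>'_def)
  qed
  then interpret \<nu>': prob_space \<nu>' .
  have rd: "real_distribution \<nu>'"
    by (simp add: real_distribution_def real_distribution_axioms_def \<nu>'.prob_space_axioms) (simp add: \<nu>'_def)
  have "cdf \<nu>' a = cdf \<nu> a" for a
  proof -
    have "{x. (x + real i) / real N \<in> {..a}} = {..real N * a - real i}" for i
      using N by (auto simp: field_simps)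
    then have "emeasure \<nu>' {..a} = (\<Sum>i<N. ennreal (q i) * ennreal (cdf \<nu> (real N * a - real i)))"
      by (simp only: em[OF atMost_borel] cdf_def emeasure_eq_measure)
    also have "\<dots> = (\<Sum>i<N. ennreal (q i * cdf \<nu> (real N * a - real i)))"
      using q_nonneg by (intro sum.cong) (auto simp: ennreal_mult cdf_def)
    also have "\<dots> = ennreal (\<Sum>i<N. q i * cdf \<nu> (real N * a - real i))"
      by (rule sum_ennreal) (simp add: q_nonneg cdf_def)
    also have "\<dots> = ennreal (cdf \<nu> a)" by (simp flip: cdf_similar)
    finally show ?thesis by (simp add: \<nu>'.emeasure_eq_measure cdf_def)
  qed
  then have "\<nu>' = \<nu>" by (intro cdf_unique rd real_distribution_\<nu>) auto
  then show ?thesis using nn[OF assms] by simp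
qed

lemma emeasure_similar:
  assumes "A \<in> sets borel"
  shows "emeasure \<nu> A = (\<Sum>i<N. ennreal (q i) * emeasure \<nu> {x. (x + real i) / real N \<in> A})"
  using nn_integral_similar[of "indicator A"] assms by (simp add: nn_integral_indicator_map)

section \<open>Mass at the endpoints\<close>

lemma emeasure_outside:
  assumes "A \<inter> {0..1} = {}" shows "emeasure \<nu> A = 0"
proof (cases "A \<in> sets borel")
  case True
  have "AE x in \<nu>. x \<notin> A" using support by eventually_elim (use assms in auto)
  then show ?thesis using True by (subst (asm) AE_iff_measurable[of A]) auto
qed (simp add: emeasure_notin_sets)

lemma q_eq_0:
  assumes "q i = 1" "i < N" "j < N" "j \<noteq> i" shows "q j = 0"
proof -
  have "(\<Sum>k\<in>{..<N} - {i}. q k) = 0"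
    using q_sum assms sum.remove[of "{..<N}" i q] by simp
  then show ?thesis using assms q_nonneg by (subst (asm) sum_nonneg_eq_0_iff) auto
qed

text \<open>
  Each of the points 0 and 1 is fixed by only one of the maps and avoided by the other ones.
\<close>

lemma atom_0: "emeasure \<nu> {0} = 0 \<or> q 0 = 1"
proof -
  have "{x. (x + real i) / real N \<in> {0}} = {- real i}" for i
    using N by (auto simp: field_simps)
  note eq = this
  have "emeasure \<nu> {0} = (\<Sum>i<N. ennreal (q i) * emeasure \<nu> {- real i})"
    using emeasure_similar[of "{0}"] unfolding eq by simp
  also have "\<dots> = (\<Sum>i\<in>{0}. ennreal (q i) * emeasure \<nu> {- real i})"
    using N by (intro sum.mono_neutral_right) (auto simp: emeasure_outside)
  finally have "emeasure \<nu> {0} = ennreal (q 0) * emeasure \<nu> {0}" by simp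
  then have "measure \<nu> {0} = q 0 * measure \<nu> {0}"
    using q_nonneg[of 0] N by (simp add: emeasure_eq_measure ennreal_mult[symmetric])
  then show ?thesis by (simp add: emeasure_eq_measure)
qed

lemma atom_1: "emeasure \<nu> {1} = 0 \<or> q (N - 1) = 1"
proof -
  have "{x. (x + real i) / real N \<in> {1}} = {real N - real i}" for i
    using N by (auto simp: field_simps)
  note eq = this
  have "emeasure \<nu> {1} = (\<Sum>i<N. ennreal (q i) * emeasure \<nu> {real N - real i})"
    using emeasure_similar[of "{1}"] unfolding eq by simp
  also have "\<dots> = (\<Sum>i\<in>{N - 1}. ennreal (q i) * emeasure \<nu> {real N - real i})"
    using N by (intro sum.mono_neutral_right) (auto intro!: emeasure_outside)
  finally have "emeasure \<nu> {1} = ennreal (q (N - 1)) * emeasure \<nu> {1}" using N by (simp add: of_nat_diff)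
  then have "measure \<nu> {1} = q (N - 1) * measure \<nu> {1}"
    using q_nonneg[of "N - 1"] N by (simp add: emeasure_eq_measure ennreal_mult[symmetric])
  then show ?thesis by (simp add: emeasure_eq_measure)
qed

text \<open>The only map with positive weight contracts towards 1 by the factor 1 / N, so the mean
  distance I to 1 satisfies I = I / N.\<close>

lemma mass_at_1:
  assumes "q (N - 1) = 1"
  shows "AE x in \<nu>. x = 1"
proof -
  have N0: "real N > 0" using N by simp
  have int: "integrable \<nu> (\<lambda>x. 1 - x)"
    by (rule integrable_const_bound[where B = 1]) (use support in auto)
  define I where "I = (\<integral>x. 1 - x \<partial>\<nu>)"
  have nn: "(\<integral>\<^sup>+ x. ennreal (1 - x) \<partial>\<nu>) = ennreal I"
    unfolding I_def by (rule nn_integral_eq_integral[OF int]) (use support in auto)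
  have "I \<ge> 0" unfolding I_def by (rule integral_nonneg_AE) (use support in auto)
  have "(\<integral>\<^sup>+ x. ennreal (1 - x) \<partial>\<nu>)
      = (\<Sum>i<N. ennreal (q i) * (\<integral>\<^sup>+ x. ennreal (1 - (x + real i) / real N) \<partial>\<nu>))"
    by (rule nn_integral_similar) simp
  also have "\<dots> = (\<Sum>i\<in>{N - 1}. ennreal (q i) * (\<integral>\<^sup>+ x. ennreal (1 - (x + real i) / real N) \<partial>\<nu>))"
    using N q_eq_0[OF assms] by (intro sum.mono_neutral_right) auto
  also have "\<dots> = (\<integral>\<^sup>+ x. ennreal (1 / real N) * ennreal (1 - x) \<partial>\<nu>)"
  proof -
    have "ennreal (1 - (x + real (N - 1)) / real N) = ennreal (1 / real N) * ennreal (1 - x)" for x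
      using N by (subst ennreal_mult'[symmetric]) (auto simp: of_nat_diff field_simps)
    then show ?thesis using assms by simp
  qed
  also have "\<dots> = ennreal (1 / real N) * ennreal I"
    by (subst nn_integral_cmult) (simp_all add: nn)
  finally have "ennreal I = ennreal (I / real N)"
    unfolding nn using \<open>I \<ge> 0\<close> by (simp add: ennreal_mult[symmetric])
  then have "I = I / real N" using \<open>I \<ge> 0\<close> by (simp add: ennreal_inj)
  then have "I = 0" using N by (simp add: field_simps)
  then have "AE x in \<nu>. 1 - x = 0"
    unfolding I_def using integral_nonneg_eq_0_iff_AE[OF int] support by auto
  then show ?thesis by eventually_elim simp
qed

lemma circle_measure_\<nu>: "circle_measure \<nu>"
proof -
  have "emeasure \<nu> {0..<1} = 1 \<or> emeasure \<nu> {1} = 1"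
    using atom_1
  proof
    assume "emeasure \<nu> {1} = 0"
    then have "AE x in \<nu>. x \<notin> {1}" by (intro AE_not_in) auto
    with support have "AE x in \<nu>. x \<in> {0..<1}" by eventually_elim auto
    then show ?thesis by (subst emeasure_eq_1_AE) auto
  next
    assume "q (N - 1) = 1"
    then have "AE x in \<nu>. x \<in> {1}" using mass_at_1 by simp
    then show ?thesis by (subst (2) emeasure_eq_1_AE) auto
  qed
  then show ?thesis by (simp add: circle_measure_def circle_measure_axioms_def prob_space_axioms)
qed

section \<open>Singularity for non-uniform weights\<close>

definition cell :: "nat \<Rightarrow> nat \<Rightarrow> real set" where
  "cell k a = {real a / real N ^ k..<(real a + 1) / real N ^ k}"

lemma cell_sets [measurable]: "cell k a \<in> sets borel"
  by (simp add: cell_def)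

text \<open>In the index i * N^k + a the digit i is the leading one, that is, the digit of the map
  applied last. Half-open cells together with x < 1 keep the images of different maps
  disjoint.\<close>

lemma cell_Suc:
  assumes "a < N ^ k" "0 \<le> x" "x < 1"
  shows "(x + real j) / real N \<in> cell (Suc k) (i * N ^ k + a) \<longleftrightarrow> j = i \<and> x \<in> cell k a"
proof -
  have N0: "real N > 0" and Nk: "real N ^ k > 0" using N by auto
  have le: "real a + 1 \<le> real N ^ k" using assms(1) by (metis of_nat_Suc of_nat_le_iff of_nat_power Suc_leI add.commute)
  have "(x + real j) / real N \<in> cell (Suc k) (i * N ^ k + a)
      \<longleftrightarrow> real i + real a / real N ^ k \<le> x + real j \<and> x + real j < real i + (real a + 1) / real N ^ k"
  proof -
    have "real (i * N ^ k + a) / real N ^ Suc k = (real i + real a / real N ^ k) / real N"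
      "(real (i * N ^ k + a) + 1) / real N ^ Suc k = (real i + (real a + 1) / real N ^ k) / real N"
      using N0 Nk by (simp_all add: field_simps)
    then show ?thesis
      using N0 unfolding cell_def by (simp only: atLeastLessThan_iff) (simp add: divide_le_cancel divide_less_cancel)
  qed
  also have "\<dots> \<longleftrightarrow> j = i \<and> x \<in> cell k a"
  proof
    assume L: "real i + real a / real N ^ k \<le> x + real j \<and> x + real j < real i + (real a + 1) / real N ^ k"
    have "(real a + 1) / real N ^ k \<le> 1" "0 \<le> real a / real N ^ k" using le Nk by auto
    then have "real j < real i + 1" "real i < real j + 1" using L assms by linarith+
    then have "j = i" by linarith
    then show "j = i \<and> x \<in> cell k a" using L by (auto simp: cell_def)
  qed (auto simp: cell_def)
  finally show ?thesis .
qed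

lemma measure_cell_Suc:
  assumes "emeasure \<nu> {0..<1} = 1" "i < N" "a < N ^ k"
  shows "measure \<nu> (cell (Suc k) (i * N ^ k + a)) = q i * measure \<nu> (cell k a)"
proof -
  have ae: "AE x in \<nu>. x \<in> {0..<1}" using assms(1) by (intro AE_prob_1) (auto simp: measure_def)
  have "emeasure \<nu> {x. (x + real j) / real N \<in> cell (Suc k) (i * N ^ k + a)}
      = (if j = i then emeasure \<nu> (cell k a) else 0)" for j
  proof -
    have "emeasure \<nu> {x. (x + real j) / real N \<in> cell (Suc k) (i * N ^ k + a)}
        = emeasure \<nu> (if j = i then cell k a else {})"
    proof (rule emeasure_eq_AE)
      show "AE x in \<nu>. x \<in> {x. (x + real j) / real N \<in> cell (Suc k) (i * N ^ k + a)}
          \<longleftrightarrow> x \<in> (if j = i then cell k a else {})"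
        using ae by eventually_elim (simp add: cell_Suc[OF assms(3)])
    qed auto
    then show ?thesis by simp
  qed
  then have "emeasure \<nu> (cell (Suc k) (i * N ^ k + a)) = ennreal (q i) * emeasure \<nu> (cell k a)"
    using assms(2) by (subst emeasure_similar) (auto simp: if_distrib[of "(*) _"] cong: if_cong)
  then show ?thesis
    using q_nonneg[OF assms(2)] by (simp add: emeasure_eq_measure ennreal_mult[symmetric])
qed

text \<open>
  Unless the weights are uniform, the Hellinger affinity to Lebesgue measure on the cells of level k
  decays geometrically, which separates the two measures.
\<close>

lemma hellinger_cells:
  assumes "emeasure \<nu> {0..<1} = 1"
  shows "(\<Sum>a<N ^ k. sqrt (measure \<nu> (cell k a) / real N ^ k)) = (\<Sum>i<N. sqrt (q i / real N)) ^ k"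
proof (induction k)
  case 0
  then show ?case using assms by (simp add: cell_def measure_def)
next
  case (Suc k)
  let ?H = "\<lambda>b. sqrt (measure \<nu> (cell (Suc k) b) / real N ^ Suc k)"
  have "(\<Sum>b<N ^ Suc k. ?H b) = (\<Sum>i<N. \<Sum>b\<in>{i * N ^ k..<i * N ^ k + N ^ k}. ?H b)"
    by (simp add: sum.nat_group[where k = "N ^ k" and n = N])
  also have "\<dots> = (\<Sum>i<N. \<Sum>a<N ^ k. ?H (i * N ^ k + a))"
    by (rule sum.cong[OF refl], subst sum.atLeastLessThan_shift_0) (simp add: atLeast0LessThan)
  also have "\<dots> = (\<Sum>i<N. \<Sum>a<N ^ k. sqrt (q i / real N) * sqrt (measure \<nu> (cell k a) / real N ^ k))"
    by (intro sum.cong refl) (simp add: measure_cell_Suc[OF assms] real_sqrt_mult[symmetric])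
  also have "\<dots> = (\<Sum>i<N. sqrt (q i / real N)) ^ Suc k"
    by (simp add: sum_distrib_left[symmetric] sum_distrib_right[symmetric] Suc)
  finally show ?case .
qed

text \<open>Twice the gap to 1 is the squared Euclidean distance of the vectors with entries sqrt (q
  i) and sqrt (1 / N), since both are unit vectors.\<close>

lemma hellinger_less_1:
  assumes "\<exists>i<N. q i \<noteq> 1 / real N"
  shows "(\<Sum>i<N. sqrt (q i / real N)) < 1"
proof -
  have N0: "real N > 0" using N by simp
  let ?d = "\<lambda>i. (sqrt (q i) - sqrt (1 / real N))\<^sup>2"
  obtain i where i: "i < N" "q i \<noteq> 1 / real N" using assms by blast
  have "0 < ?d i" using i q_nonneg[of i] N0 by simp
  then have "0 < (\<Sum>i<N. ?d i)" using i by (intro sum_pos2[of _ i]) auto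
  also have "(\<Sum>i<N. ?d i) = (\<Sum>i<N. q i + 1 / real N - 2 * sqrt (q i / real N))"
    using q_nonneg N0 by (intro sum.cong) (auto simp: power2_diff real_sqrt_mult[symmetric] real_sqrt_divide power_divide)
  also have "\<dots> = 2 - 2 * (\<Sum>i<N. sqrt (q i / real N))"
    using N0 q_sum by (simp add: sum_subtractf sum.distrib sum_distrib_left)
  finally show ?thesis by simp
qed

lemma cells_cover: "x \<in> {0..<1} \<Longrightarrow> \<exists>a<N ^ k. x \<in> cell k a"
proof -
  assume x: "x \<in> {0..<1}"
  have Nk: "real N ^ k > 0" using N by auto
  define a where "a = nat \<lfloor>x * real N ^ k\<rfloor>"
  have a: "real a \<le> x * real N ^ k" "x * real N ^ k < real a + 1"
    using x Nk by (auto simp: a_def)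
  have "x * real N ^ k < 1 * real N ^ k" using x Nk by (intro mult_strict_right_mono) auto
  then have "real a < real N ^ k" using a by linarith
  then have "real a < real (N ^ k)" by (simp only: of_nat_power)
  then have "a < N ^ k" by (simp only: of_nat_less_iff)
  moreover have "x \<in> cell k a" using a Nk by (auto simp: cell_def field_simps)
  ultimately show ?thesis by blast
qed

text \<open>The smaller of two nonnegative numbers is at most their geometric mean. So the light
  cells, with measure at most their length, have total measure at most \<theta>^k, and the other
  cells have total length at most \<theta>^k. As \<theta> < 1, almost every point for \<nu> lies in
  only finitely many of the sets \<open>B k\<close>.\<close>

lemma singular_of_nonuniform:
  assumes mass: "emeasure \<nu> {0..<1} = 1" and "\<exists>i<N. q i \<noteq> 1 / real N"
  shows "lebesgue_singular \<nu>"
proof -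
  define \<theta> where "\<theta> = (\<Sum>i<N. sqrt (q i / real N))"
  have \<theta>: "0 \<le> \<theta>" "\<theta> < 1"
    using hellinger_less_1[OF assms(2)] q_nonneg by (auto simp: \<theta>_def intro!: sum_nonneg)
  have Nk: "real N ^ k > 0" for k using N by auto
  define Q where "Q k a = measure \<nu> (cell k a)" for k a
  have Q: "0 \<le> Q k a" for k a by (simp add: Q_def)
  define I where "I k = {a\<in>{..<N ^ k}. Q k a \<le> 1 / real N ^ k}" for k
  define B where "B k = (\<Union>a\<in>I k. cell k a)" for k
  define C where "C k = (\<Union>a\<in>{..<N ^ k} - I k. cell k a)" for k
  have fin: "finite (I k)" for k by (simp add: I_def)
  have [measurable]: "B k \<in> sets borel" "C k \<in> sets borel" for k
    using fin by (auto simp: B_def C_def)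
  have H: "(\<Sum>a<N ^ k. sqrt (Q k a / real N ^ k)) = \<theta> ^ k" for k
    unfolding Q_def \<theta>_def by (rule hellinger_cells[OF mass])
  have B: "emeasure \<nu> (B k) \<le> ennreal (\<theta> ^ k)" for k
  proof -
    have "emeasure \<nu> (B k) \<le> (\<Sum>a\<in>I k. emeasure \<nu> (cell k a))"
      unfolding B_def by (intro emeasure_subadditive_finite fin) auto
    also have "\<dots> = ennreal (\<Sum>a\<in>I k. Q k a)" by (simp add: Q_def emeasure_eq_measure)
    also have "(\<Sum>a\<in>I k. Q k a) \<le> (\<Sum>a\<in>I k. sqrt (Q k a / real N ^ k))"
    proof (intro sum_mono real_le_rsqrt)
      fix a assume "a \<in> I k"
      then have "Q k a * Q k a \<le> Q k a * (1 / real N ^ k)" using Q by (intro mult_left_mono) (auto simp: I_def)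
      then show "(Q k a)\<^sup>2 \<le> Q k a / real N ^ k" by (simp add: power2_eq_square)
    qed
    also have "\<dots> \<le> \<theta> ^ k"
      unfolding H[symmetric] using Q Nk by (intro sum_mono2) (auto simp: I_def intro!: divide_nonneg_pos)
    finally show ?thesis by (simp add: ennreal_leI)
  qed
  have C: "emeasure lborel (C k) \<le> ennreal (\<theta> ^ k)" for k
  proof -
    have "emeasure lborel (C k) \<le> (\<Sum>a\<in>{..<N ^ k} - I k. emeasure lborel (cell k a))"
      unfolding C_def by (intro emeasure_subadditive_finite) auto
    also have "\<dots> = ennreal (\<Sum>a\<in>{..<N ^ k} - I k. 1 / real N ^ k)"
    proof -
      have "emeasure lborel (cell k a) = ennreal (1 / real N ^ k)" for a
        using Nk[of k] by (simp add: cell_def divide_right_mono add_divide_distrib)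
      then show ?thesis by (simp only:) (rule sum_ennreal, simp)
    qed
    also have "(\<Sum>a\<in>{..<N ^ k} - I k. 1 / real N ^ k) \<le> (\<Sum>a\<in>{..<N ^ k} - I k. sqrt (Q k a / real N ^ k))"
    proof (intro sum_mono real_le_rsqrt)
      fix a assume "a \<in> {..<N ^ k} - I k"
      then have "1 / real N ^ k * (1 / real N ^ k) \<le> Q k a * (1 / real N ^ k)"
        using Nk[of k] by (intro mult_right_mono) (auto simp: I_def)
      then show "(1 / real N ^ k)\<^sup>2 \<le> Q k a / real N ^ k" by (simp add: power2_eq_square)
    qed
    also have "\<dots> \<le> \<theta> ^ k"
      unfolding H[symmetric] using Q Nk by (intro sum_mono2) (auto intro!: divide_nonneg_pos)
    finally show ?thesis by (simp add: ennreal_leI)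
  qed
  \<comment> \<open>The lower limit of the sets \<open>C k\<close>: a tail intersection lies in
    every later \<open>C k\<close> and is therefore Lebesgue null at once, so that Borel-Cantelli
    enters for \<nu> only.\<close>
  define A where "A = (\<Union>j. \<Inter>k\<in>{j..}. C k)"
  have [measurable]: "A \<in> sets borel" unfolding A_def by measurable
  have "emeasure lborel (\<Inter>k\<in>{j..}. C k) = 0" for j
  proof -
    have "emeasure lborel (\<Inter>k\<in>{j..}. C k) \<le> ennreal (\<theta> ^ k)" if "j \<le> k" for k
      using that by (intro order_trans[OF emeasure_mono C[of k]]) auto
    moreover have "(\<lambda>k. ennreal (\<theta> ^ k)) \<longlonglongrightarrow> ennreal 0"
      using \<theta> by (intro tendsto_ennrealI LIMSEQ_power_zero) auto
    ultimately have "emeasure lborel (\<Inter>k\<in>{j..}. C k) \<le> ennreal 0"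
      by (intro LIMSEQ_le_const[where X = "\<lambda>k. ennreal (\<theta> ^ k)"]) auto
    then show ?thesis by simp
  qed
  then have A0: "emeasure lborel A = 0"
    unfolding A_def by (intro emeasure_UN_eq_0) auto
  have "AE x in \<nu>. eventually (\<lambda>k. x \<in> space \<nu> - B k) sequentially"
  proof (rule borel_cantelli_AE1)
    show "summable (\<lambda>k. measure \<nu> (B k))"
    proof (rule summable_comparison_test)
      show "summable (\<lambda>k. \<theta> ^ k)" using \<theta> by (intro summable_geometric) simp
      have "measure \<nu> (B k) \<le> \<theta> ^ k" for k
        using B[of k] \<theta> by (simp add: emeasure_eq_measure)
      then show "\<exists>K. \<forall>k\<ge>K. norm (measure \<nu> (B k)) \<le> \<theta> ^ k" by simp
    qed
  qed (auto simp: emeasure_eq_measure)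
  moreover have "AE x in \<nu>. x \<in> {0..<1}" using mass by (intro AE_prob_1) (auto simp: measure_def)
  ultimately have "AE x in \<nu>. x \<in> A"
  proof eventually_elim
    case (elim x)
    have BC: "x \<in> B k \<or> x \<in> C k" for k
      using cells_cover[OF elim(2), of k] by (auto simp: B_def C_def)
    from elim(1) have "\<forall>\<^sub>F k in sequentially. x \<in> C k" by eventually_elim (use BC in auto)
    then show ?case by (auto simp: A_def eventually_sequentially)
  qed
  then have "emeasure \<nu> (- A) = 0"
    by (subst (asm) AE_iff_measurable[of "- A"]) auto
  then show ?thesis using A0 by (auto simp: lebesgue_singular_def)
qed

section \<open>Uniform weights and the dichotomy\<close>

lemma cdf_le_0: "a < 0 \<Longrightarrow> cdf \<nu> a = 0"
  using emeasure_outside[of "{..a}"] by (auto simp: cdf_def measure_def)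

lemma cdf_ge_1:
  assumes "1 \<le> a" shows "cdf \<nu> a = 1"
proof -
  have "AE x in \<nu>. x \<in> {..a}" using support by eventually_elim (use assms in auto)
  then show ?thesis unfolding cdf_def by (subst prob_eq_1) auto
qed

text \<open>Stripping the first digit of a divides the deviation of the distribution function from
  the identity by N. As the deviation is at most 1, it is at most N^(-k) for all k.\<close>

lemma cdf_uniform:
  assumes q: "\<And>i. i < N \<Longrightarrow> q i = 1 / real N" and "0 \<le> a" "a < 1"
  shows "cdf \<nu> a = a"
proof -
  have N0: "real N > 0" using N by simp
  have "\<bar>cdf \<nu> a - a\<bar> \<le> (1 / real N) ^ k" for k
    using \<open>0 \<le> a\<close> \<open>a < 1\<close>
  proof (induction k arbitrary: a)
    case 0
    have "0 \<le> cdf \<nu> a" "cdf \<nu> a \<le> 1" by (auto simp: cdf_def)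
    then show ?case using 0 by simp
  next
    case (Suc k)
    \<comment> \<open>i is the first N-adic digit of a and b the rescaled remainder. The images of
      [0,1] under maps with smaller digits lie entirely below a, those with larger digits above
      it.\<close>
    define i where "i = nat \<lfloor>real N * a\<rfloor>"
    define b where "b = real N * a - real i"
    have "0 \<le> real N * a" using Suc.prems by simp
    then have "real i = of_int \<lfloor>real N * a\<rfloor>" by (simp add: i_def)
    then have b: "0 \<le> b" "b < 1" unfolding b_def by linarith+
    have "real N * a < real N" using Suc.prems N0 by simp
    then have "i < N" using b by (simp add: b_def)
    have "cdf \<nu> (real N * a - real j) = (if j < i then 1 else if j = i then cdf \<nu> b else 0)" for j
    proof -
      consider "j < i" | "j = i" | "i < j" by linarith
      then show ?thesis
      proof cases
        case 1
        then have "real j + 1 \<le> real i" by linarith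
        then have "1 \<le> real N * a - real j" using b by (simp add: b_def)
        then show ?thesis using 1 by (simp add: cdf_ge_1)
      next
        case 3
        then have "real i + 1 \<le> real j" by linarith
        then have "real N * a - real j < 0" using b by (simp add: b_def)
        then show ?thesis using 3 by (simp add: cdf_le_0)
      qed (simp add: b_def)
    qed
    then have "cdf \<nu> a = (\<Sum>j<N. 1 / real N * (if j < i then 1 else if j = i then cdf \<nu> b else 0))"
      using q by (subst cdf_similar) simp
    also have "\<dots> = 1 / real N * (\<Sum>j<N. (if j < i then 1 else 0) + (if j = i then cdf \<nu> b else 0))"
      unfolding sum_distrib_left by (intro sum.cong) auto
    also have "(\<Sum>j<N. (if j < i then 1 else 0) + (if j = i then cdf \<nu> b else 0)) = real i + cdf \<nu> b"
    proof -
      have "{..<N} \<inter> {j. j < i} = {..<i}" using \<open>i < N\<close> by auto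
      then show ?thesis using \<open>i < N\<close> by (simp add: sum.distrib sum.If_cases)
    qed
    finally have "cdf \<nu> a - a = 1 / real N * (cdf \<nu> b - b)"
      using N0 by (simp add: b_def field_simps)
    then have "\<bar>cdf \<nu> a - a\<bar> = 1 / real N * \<bar>cdf \<nu> b - b\<bar>" using N0 by (simp add: abs_mult)
    also have "\<dots> \<le> 1 / real N * (1 / real N) ^ k"
      by (intro mult_left_mono Suc.IH b) auto
    finally show ?case by simp
  qed
  moreover have "(\<lambda>k. (1 / real N) ^ k) \<longlonglongrightarrow> 0" using N by (intro LIMSEQ_power_zero) simp
  ultimately have "\<bar>cdf \<nu> a - a\<bar> \<le> 0"
    by (intro LIMSEQ_le_const[where X = "\<lambda>k. (1 / real N) ^ k"]) auto
  then show ?thesis by simp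
qed

text \<open>Makes the two cases of the expansion exhaustive. A point mass at 1 is treated
  separately, because the cell argument presupposes mass on [0,1).\<close>

lemma singular_or_lebesgue: "lebesgue_singular \<nu> \<or> \<nu> = lebesgue_unit"
proof -
  interpret \<nu>: circle_measure \<nu> by (rule circle_measure_\<nu>)
  consider "emeasure \<nu> {1} = 1" | "emeasure \<nu> {0..<1} = 1" "\<exists>i<N. q i \<noteq> 1 / real N"
    | "\<forall>i<N. q i = 1 / real N"
    using \<nu>.mass by blast
  then show ?thesis
  proof cases
    case 1
    then have "AE x in \<nu>. x \<in> {1}" by (intro AE_prob_1) (auto simp: measure_def)
    then have "emeasure \<nu> (- {1}) = 0" by (subst (asm) AE_iff_measurable[of "- {1}"]) auto
    then show ?thesis unfolding lebesgue_singular_def by (intro disjI1 bexI[of _ "{1}"]) auto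
  next
    case 2
    then show ?thesis using singular_of_nonuniform by blast
  next
    case 3
    have rd: "real_distribution lebesgue_unit"
      by (simp add: real_distribution_def real_distribution_axioms_def unit.prob_space_axioms)
    have unit: "cdf lebesgue_unit a = (if a < 0 then 0 else if a < 1 then a else 1)" for a
    proof -
      have "{0..1} \<inter> {..a} = (if a < 0 then {} else if a < 1 then {0..a} else {0..1::real})" by auto
      then show ?thesis unfolding cdf_def measure_def by (subst emeasure_uniform_measure) (auto simp: divide_ennreal[of _ 1, simplified])
    qed
    have "cdf \<nu> a = cdf lebesgue_unit a" for a
      using cdf_le_0[of a] cdf_ge_1[of a] cdf_uniform[of a] 3 by (auto simp: unit)
    then have "\<nu> = lebesgue_unit" by (intro cdf_unique real_distribution_\<nu> rd) auto
    then show ?thesis ..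
  qed
qed

end

section \<open>Slices of carpets\<close>

text \<open>Invariance is known for continuous test functions only. These ramps equal 1 for g \<le>
  a and fall to 0 just beyond a, so they converge everywhere to the indicator of the closed
  half-line, and atoms at a cause no trouble.\<close>

lemma (in prob_space) expectation_ramp_tendsto:
  fixes g :: "'a \<Rightarrow> real"
  assumes [measurable]: "g \<in> borel_measurable M"
  shows "(\<lambda>k. \<integral>z. complex_of_real (max 0 (min 1 (1 - real k * (g z - a)))) \<partial>M)
    \<longlonglongrightarrow> complex_of_real (prob {z \<in> space M. g z \<le> a})"
proof -
  have "(\<lambda>k. \<integral>z. complex_of_real (max 0 (min 1 (1 - real k * (g z - a)))) \<partial>M)
    \<longlonglongrightarrow> (\<integral>z. complex_of_real (indicator {z \<in> space M. g z \<le> a} z) \<partial>M)"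
  proof (rule integral_dominated_convergence[where w = "\<lambda>_. 1"])
    have "(\<lambda>k. complex_of_real (max 0 (min 1 (1 - real k * (g z - a)))))
        \<longlonglongrightarrow> complex_of_real (indicator {z \<in> space M. g z \<le> a} z)" if "z \<in> space M" for z
    proof (cases "g z \<le> a")
      case True
      then have "1 - real k * (g z - a) \<ge> 1" for k by (simp add: mult_nonneg_nonpos)
      then show ?thesis using True that by (simp add: min_absorb1)
    next
      case False
      then obtain k0 where k0: "real k0 * (g z - a) > 1" using reals_Archimedean3[of "g z - a"] by auto
      have "max 0 (min 1 (1 - real k * (g z - a))) = 0" if "k \<ge> k0" for k
      proof -
        have "real k0 * (g z - a) \<le> real k * (g z - a)" using that False by (intro mult_right_mono) auto
        then show ?thesis using k0 by simp
      qed
      then have "\<forall>\<^sub>F k in sequentially. complex_of_real (max 0 (min 1 (1 - real k * (g z - a))))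
          = complex_of_real (indicator {z \<in> space M. g z \<le> a} z)"
        using False by (auto simp: eventually_sequentially)
      then show ?thesis by (rule tendsto_eventually)
    qed
    then show "AE z in M. (\<lambda>k. complex_of_real (max 0 (min 1 (1 - real k * (g z - a)))))
        \<longlonglongrightarrow> complex_of_real (indicator {z \<in> space M. g z \<le> a} z)" by simp
  qed (auto simp: norm_of_real)
  moreover have "(\<integral>z. complex_of_real (indicator {z \<in> space M. g z \<le> a} z) \<partial>M)
      = complex_of_real (prob {z \<in> space M. g z \<le> a})"
    by (subst integral_complex_of_real) (simp add: Int_def cong: conj_cong)
  ultimately show ?thesis by simp
qed

text \<open>A test function of \<beta> alone sees of each map only its digit in this direction, so
  the weights of maps with equal digit are added up.\<close>

lemma self_similar_marginal:
  fixes \<mu> :: "(real \<times> real) measure" and D :: "'d set"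
  assumes prob: "prob_space \<mu>" and sets [measurable_cong, simp]: "sets \<mu> = sets borel"
    and cont: "continuous_on UNIV \<beta>" and N: "2 \<le> N"
    and D: "finite D" "\<And>d. d \<in> D \<Longrightarrow> 0 \<le> w d" "(\<Sum>d\<in>D. w d) = 1" "\<And>d. d \<in> D \<Longrightarrow> dig d < N"
    and T: "\<And>d z. d \<in> D \<Longrightarrow> \<beta> (T d z) = (\<beta> z + real (dig d)) / real N"
    and inv: "\<And>f :: real \<times> real \<Rightarrow> complex. continuous_on UNIV f \<Longrightarrow>
      (\<integral>z. f z \<partial>\<mu>) = (\<Sum>d\<in>D. of_real (w d) * (\<integral>z. f (T d z) \<partial>\<mu>))"
    and support: "AE z in \<mu>. 0 \<le> \<beta> z \<and> \<beta> z \<le> 1"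
  shows "self_similar (distr \<mu> borel \<beta>) N (\<lambda>i. \<Sum>d | d \<in> D \<and> dig d = i. w d)"
proof -
  interpret prob_space \<mu> by (rule prob)
  have [measurable]: "\<beta> \<in> borel_measurable borel" by (rule borel_measurable_continuous_onI[OF cont])
  have space: "space \<mu> = UNIV" using sets_eq_imp_space_eq[OF sets] by simp
  have cdf: "cdf (distr \<mu> borel \<beta>) a = prob {z. \<beta> z \<le> a}" for a
    by (simp add: cdf_def measure_distr vimage_def space)
  define q where "q i = (\<Sum>d | d \<in> D \<and> dig d = i. w d)" for i
  have group: "(\<Sum>d\<in>D. w d * F (dig d)) = (\<Sum>i<N. q i * F i)" for F :: "nat \<Rightarrow> real"
  proof -
    have "(\<Sum>d\<in>D. w d * F (dig d)) = (\<Sum>i<N. \<Sum>d | d \<in> D \<and> dig d = i. w d * F (dig d))"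
      using D by (intro sum.group[symmetric]) auto
    also have "\<dots> = (\<Sum>i<N. q i * F i)" by (simp add: q_def sum_distrib_right)
    finally show ?thesis .
  qed
  have similar: "cdf (distr \<mu> borel \<beta>) a = (\<Sum>i<N. q i * cdf (distr \<mu> borel \<beta>) (real N * a - real i))" for a
  proof -
    define \<phi> where "\<phi> k z = complex_of_real (max 0 (min 1 (1 - real k * (\<beta> z - a))))" for k z
    have \<phi>: "continuous_on UNIV (\<phi> k)" for k
      unfolding \<phi>_def[abs_def] by (intro continuous_intros cont)
    have "(\<lambda>k. \<integral>z. \<phi> k z \<partial>\<mu>) \<longlonglongrightarrow> of_real (prob {z. \<beta> z \<le> a})"
      unfolding \<phi>_def using expectation_ramp_tendsto[of \<beta> a] by (simp add: space)
    moreover have "(\<lambda>k. \<integral>z. \<phi> k z \<partial>\<mu>)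
        \<longlonglongrightarrow> (\<Sum>d\<in>D. of_real (w d) * of_real (prob {z. (\<beta> z + real (dig d)) / real N \<le> a}))"
    proof -
      have "(\<lambda>k. \<integral>z. \<phi> k (T d z) \<partial>\<mu>) \<longlonglongrightarrow> of_real (prob {z. (\<beta> z + real (dig d)) / real N \<le> a})"
        if "d \<in> D" for d
        unfolding \<phi>_def T[OF that]
        using expectation_ramp_tendsto[of "\<lambda>z. (\<beta> z + real (dig d)) / real N" a] by (simp add: space)
      then show ?thesis unfolding inv[OF \<phi>] by (intro tendsto_intros)
    qed
    ultimately have "complex_of_real (prob {z. \<beta> z \<le> a})
        = (\<Sum>d\<in>D. of_real (w d) * of_real (prob {z. (\<beta> z + real (dig d)) / real N \<le> a}))"
      by (rule LIMSEQ_unique)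
    then have "complex_of_real (prob {z. \<beta> z \<le> a})
        = complex_of_real (\<Sum>d\<in>D. w d * prob {z. (\<beta> z + real (dig d)) / real N \<le> a})" by simp
    then have "prob {z. \<beta> z \<le> a} = (\<Sum>d\<in>D. w d * prob {z. (\<beta> z + real (dig d)) / real N \<le> a})"
      by (simp only: of_real_eq_iff)
    moreover have "{z. (\<beta> z + real i) / real N \<le> a} = {z. \<beta> z \<le> real N * a - real i}" for i
      using N by (auto simp: field_simps)
    ultimately show ?thesis
      using group[of "\<lambda>i. prob {z. \<beta> z \<le> real N * a - real i}"] by (simp add: cdf)
  qed
  have "prob_space (distr \<mu> borel \<beta>)" by (rule prob_space_distr) simp
  then have "self_similar (distr \<mu> borel \<beta>) N q"
  proof (intro self_similar.intro self_similar_axioms.intro)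
    show "0 \<le> q i" for i unfolding q_def using D by (intro sum_nonneg) auto
    show "(\<Sum>i<N. q i) = 1" using group[of "\<lambda>_. 1"] D by simp
    show "AE x in distr \<mu> borel \<beta>. 0 \<le> x \<and> x \<le> 1" using support by (simp add: AE_distr_iff)
    show "cdf (distr \<mu> borel \<beta>) a = (\<Sum>i<N. q i * cdf (distr \<mu> borel \<beta>) (real N * a - real i))" for a
      by (rule similar)
  qed (use N in auto)
  then show ?thesis by (simp add: q_def[abs_def])
qed

text \<open>At a maximum x of g one has N g(x) = g(x') + i \<le> g(x) + N - 1, hence g(x) \<le> 1.
  At a minimum the same argument with i \<ge> 0 gives the lower bound.\<close>

lemma self_affine_coordinate_bounds:
  fixes g :: "real \<times> real \<Rightarrow> real"
  assumes K: "compact K" "continuous_on K g" and N: "2 \<le> (N :: nat)"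
    and self: "\<And>z. z \<in> K \<Longrightarrow> \<exists>z'\<in>K. \<exists>i<N. g z = (g z' + real i) / real N"
    and z: "z \<in> K"
  shows "0 \<le> g z \<and> g z \<le> 1"
proof -
  have "K \<noteq> {}" using z by blast
  have N1: "real N - 1 > 0" using N by simp
  obtain x where x: "x \<in> K" "\<And>y. y \<in> K \<Longrightarrow> g y \<le> g x"
    using continuous_attains_sup[OF K(1) \<open>K \<noteq> {}\<close> K(2)] by blast
  obtain x' i where "x' \<in> K" "i < N" "g x = (g x' + real i) / real N" using self[OF x(1)] by blast
  then have "real N * g x = g x' + real i" "g x' \<le> g x" "real i \<le> real N - 1" using N x by auto
  then have "(real N - 1) * g x \<le> (real N - 1) * 1" by (simp add: left_diff_distrib)
  then have "g x \<le> 1" using N1 by (simp only: mult_le_cancel_left_pos)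
  obtain y where y: "y \<in> K" "\<And>x. x \<in> K \<Longrightarrow> g y \<le> g x"
    using continuous_attains_inf[OF K(1) \<open>K \<noteq> {}\<close> K(2)] by blast
  obtain y' j where "y' \<in> K" "j < N" "g y = (g y' + real j) / real N" using self[OF y(1)] by blast
  then have "real N * g y = g y' + real j" "g y \<le> g y'" using N y by auto
  then have "(real N - 1) * 0 \<le> (real N - 1) * g y" by (simp add: left_diff_distrib)
  then have "0 \<le> g y" using N1 by (simp only: mult_le_cancel_left_pos)
  then show ?thesis using \<open>g x \<le> 1\<close> x(2)[OF z] y(2)[OF z] by linarith
qed

lemma emeasure_lborel_similar:
  fixes B :: "real set"
  assumes "B \<in> sets borel" "0 < M"
  shows "emeasure lborel {u. M * u - t \<in> B} = emeasure lborel B / ennreal M"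
proof -
  have [measurable]: "B \<in> sets borel" by fact
  have "emeasure lborel B = (\<integral>\<^sup>+ x. indicator B x \<partial>lborel)" by simp
  also have "\<dots> = ennreal \<bar>M\<bar> * (\<integral>\<^sup>+ u. indicator B (- t + M * u) \<partial>lborel)"
    using assms by (intro nn_integral_real_affine) auto
  also have "(\<integral>\<^sup>+ u. indicator B (- t + M * u) \<partial>lborel) = (\<integral>\<^sup>+ u. indicator {u. M * u - t \<in> B} u \<partial>lborel)"
    by (intro nn_integral_cong) (simp add: indicator_def add.commute)
  also have "\<dots> = emeasure lborel {u. M * u - t \<in> B}" by simp
  finally have "emeasure lborel B = ennreal M * emeasure lborel {u. M * u - t \<in> B}" using assms by simp
  then show ?thesis using assms(2) by (simp add: ennreal_mult_divide_eq mult.commute[of "ennreal M"])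
qed

text \<open>
  The coordinate of the base comes first: a digit pair is (base digit, fibre digit), also when the
  base is the vertical axis.
\<close>

locale carpet = prob_space \<mu> for \<mu> :: "(real \<times> real) measure" +
  fixes c :: "real \<Rightarrow> real \<Rightarrow> real \<times> real" and \<beta> \<upsilon> :: "real \<times> real \<Rightarrow> real" and \<rho> :: "real \<Rightarrow> real measure"
    and N M :: nat and D :: "(nat \<times> nat) set" and w :: "nat \<times> nat \<Rightarrow> real"
    and T :: "nat \<times> nat \<Rightarrow> real \<times> real \<Rightarrow> real \<times> real" and K :: "(real \<times> real) set"
  assumes sets_carpet: "sets \<mu> = sets borel"
    and continuous: "continuous_on UNIV (\<lambda>x. c (fst x) (snd x))" "continuous_on UNIV \<beta>" "continuous_on UNIV \<upsilon>"
    and coordinates: "\<And>s u. \<beta> (c s u) = s" "\<And>s u. \<upsilon> (c s u) = u" "\<And>z. c (\<beta> z) (\<upsilon> z) = z"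
    and disintegration_carpet: "is_disintegration c \<mu> (distr \<mu> borel \<beta>) \<rho>"
    and sizes: "2 \<le> N" "2 \<le> M" and digits: "D \<subseteq> {..<N} \<times> {..<M}"
    and weights: "\<And>d. d \<in> D \<Longrightarrow> 0 < w d" "(\<Sum>d\<in>D. w d) = 1"
    and T: "\<And>d z. d \<in> D \<Longrightarrow> \<beta> (T d z) = (\<beta> z + real (fst d)) / real N"
      "\<And>d z. d \<in> D \<Longrightarrow> \<upsilon> (T d z) = (\<upsilon> z + real (snd d)) / real M"
    and K: "compact K" "K = (\<Union>d\<in>D. T d ` K)" "emeasure \<mu> (- K) = 0"
    and invariant: "\<And>f :: real \<times> real \<Rightarrow> complex. continuous_on UNIV f \<Longrightarrow>
      (\<integral>z. f z \<partial>\<mu>) = (\<Sum>d\<in>D. of_real (w d) * (\<integral>z. f (T d z) \<partial>\<mu>))"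
begin

sublocale slicing \<mu> c \<beta> \<upsilon> \<rho>
proof
  show "c s \<in> borel_measurable borel" for s
  proof (rule borel_measurable_continuous_onI)
    have "continuous_on UNIV ((\<lambda>x. c (fst x) (snd x)) \<circ> Pair s)"
      by (intro continuous_on_compose continuous_on_subset[OF continuous(1)] continuous_intros) auto
    then show "continuous_on UNIV (c s)" by (simp add: comp_def)
  qed
  show "\<beta> \<in> borel_measurable borel" "\<upsilon> \<in> borel_measurable borel"
    using continuous by (auto intro: borel_measurable_continuous_onI)
qed (use sets_carpet coordinates disintegration_carpet in auto)

lemma finite_D: "finite D"
  using digits by (rule finite_subset) simp

lemma K_digit:
  assumes "z \<in> K"
  obtains d z' where "d \<in> D" "z' \<in> K" "\<beta> z = (\<beta> z' + real (fst d)) / real N"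
    "\<upsilon> z = (\<upsilon> z' + real (snd d)) / real M" "fst d < N" "snd d < M"
proof -
  from assms K(2) obtain d z' where "d \<in> D" "z' \<in> K" "z = T d z'" by blast
  then show ?thesis using that[of d z'] T digits by auto
qed

lemma K_unit:
  assumes "z \<in> K"
  shows "0 \<le> \<beta> z \<and> \<beta> z \<le> 1" "0 \<le> \<upsilon> z \<and> \<upsilon> z \<le> 1"
proof -
  have base: "\<exists>z'\<in>K. \<exists>i<N. \<beta> z = (\<beta> z' + real i) / real N" if "z \<in> K" for z
  proof -
    from that obtain d z' where "d \<in> D" "z' \<in> K" "\<beta> z = (\<beta> z' + real (fst d)) / real N"
        "\<upsilon> z = (\<upsilon> z' + real (snd d)) / real M" "fst d < N" "snd d < M"
      by (rule K_digit)
    then show ?thesis by (intro bexI[of _ z'] exI[of _ "fst d"]) auto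
  qed
  show "0 \<le> \<beta> z \<and> \<beta> z \<le> 1"
    by (rule self_affine_coordinate_bounds[OF K(1) _ sizes(1) base assms])
       (rule continuous_on_subset[OF continuous(2)], simp)
  have fibre: "\<exists>z'\<in>K. \<exists>j<M. \<upsilon> z = (\<upsilon> z' + real j) / real M" if "z \<in> K" for z
  proof -
    from that obtain d z' where "d \<in> D" "z' \<in> K" "\<beta> z = (\<beta> z' + real (fst d)) / real N"
        "\<upsilon> z = (\<upsilon> z' + real (snd d)) / real M" "fst d < N" "snd d < M"
      by (rule K_digit)
    then show ?thesis by (intro bexI[of _ z'] exI[of _ "snd d"]) auto
  qed
  show "0 \<le> \<upsilon> z \<and> \<upsilon> z \<le> 1"
    by (rule self_affine_coordinate_bounds[OF K(1) _ sizes(2) fibre assms])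
       (rule continuous_on_subset[OF continuous(3)], simp)
qed

lemma K_sets [measurable]: "K \<in> sets borel"
  using K(1) by (simp add: compact_imp_closed borel_closed)

lemma AE_K: "AE z in \<mu>. z \<in> K"
  by (rule AE_I[of _ _ "- K"]) (use K(3) in auto)

abbreviation base_weight :: "nat \<Rightarrow> real" where
  "base_weight i \<equiv> \<Sum>d | d \<in> D \<and> fst d = i. w d"

sublocale base: self_similar marginal N base_weight
proof (rule self_similar_marginal[where T = T])
  show "AE z in \<mu>. 0 \<le> \<beta> z \<and> \<beta> z \<le> 1" using AE_K by eventually_elim (rule K_unit)
qed (use prob_space_axioms continuous sizes finite_D weights T invariant digits in \<open>auto intro: less_imp_le\<close>)

lemma circle_measure_fibre_marginal: "circle_measure (distr \<mu> borel \<upsilon>)"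
proof -
  have "self_similar (distr \<mu> borel \<upsilon>) M (\<lambda>j. \<Sum>d | d \<in> D \<and> snd d = j. w d)"
  proof (rule self_similar_marginal[where T = T])
    show "AE z in \<mu>. 0 \<le> \<upsilon> z \<and> \<upsilon> z \<le> 1" using AE_K by eventually_elim (rule K_unit)
  qed (use prob_space_axioms continuous sizes finite_D weights T invariant digits in \<open>auto intro: less_imp_le\<close>)
  then show ?thesis by (rule self_similar.circle_measure_\<nu>)
qed

text \<open>The slices need not be self-similar. Their endpoint alternative is inherited from the
  fibre marginal, which is, and it is the same alternative for almost all slices.\<close>

lemma circle_measure_slices: "AE s in marginal. circle_measure (\<rho> s)"
proof -
  interpret F: circle_measure "distr \<mu> borel \<upsilon>" by (rule circle_measure_fibre_marginal)
  have "(AE z in \<mu>. 0 \<le> \<upsilon> z \<and> \<upsilon> z < 1) \<or> (AE z in \<mu>. \<upsilon> z = 1)"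
    using F.AE_mass by (simp add: AE_distr_iff)
  then show ?thesis
  proof
    assume "AE z in \<mu>. 0 \<le> \<upsilon> z \<and> \<upsilon> z < 1"
    then have "AE s in marginal. AE u in \<rho> s. 0 \<le> \<upsilon> (c s u) \<and> \<upsilon> (c s u) < 1"
      by (intro disintegrate_AE) measurable
    then show ?thesis
    proof eventually_elim
      case (elim s)
      interpret S: prob_space "\<rho> s" by (rule slice_prob_space)
      have "emeasure (\<rho> s) {0..<1} = 1" by (subst S.emeasure_eq_1_AE) (use elim in auto)
      then show ?case
        by (simp add: circle_measure_def circle_measure_axioms_def S.prob_space_axioms)
    qed
  next
    assume "AE z in \<mu>. \<upsilon> z = 1"
    then have "AE s in marginal. AE u in \<rho> s. \<upsilon> (c s u) = 1"
      by (intro disintegrate_AE) measurable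
    then show ?thesis
    proof eventually_elim
      case (elim s)
      interpret S: prob_space "\<rho> s" by (rule slice_prob_space)
      have "emeasure (\<rho> s) {1} = 1" by (subst S.emeasure_eq_1_AE) (use elim in auto)
      then show ?case
        by (simp add: circle_measure_def circle_measure_axioms_def S.prob_space_axioms)
    qed
  qed
qed

section \<open>The length of the slices of the attractor\<close>

definition slice_length :: "real \<Rightarrow> ennreal" where
  "slice_length s = emeasure lborel {u. c s u \<in> K}"

lemma slice_sets [measurable]: "{u. c s u \<in> K} \<in> sets borel"
  by measurable

lemma slice_length_measurable [measurable]: "slice_length \<in> borel_measurable borel"
proof -
  have "{x. c (fst x) (snd x) \<in> K} \<in> sets borel"
    using continuous_closed_vimage[of K "\<lambda>x. c (fst x) (snd x)"] K(1) continuous(1)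
    by (auto simp: vimage_def compact_imp_closed continuous_on_eq_continuous_at intro: borel_closed)
  moreover have "sets (borel \<Otimes>\<^sub>M lborel) = sets (borel :: (real \<times> real) measure)"
    unfolding borel_prod[symmetric] by (rule sets_pair_measure_cong) auto
  ultimately have "{x. c (fst x) (snd x) \<in> K} \<in> sets (borel \<Otimes>\<^sub>M lborel)" by simp
  from lborel.measurable_emeasure_Pair[OF this] show ?thesis
    by (simp add: slice_length_def[abs_def] vimage_def)
qed

lemma base_weight_pos_iff: "0 < base_weight i \<longleftrightarrow> (\<exists>j. (i, j) \<in> D)"
proof
  assume "0 < base_weight i"
  then have "{d. d \<in> D \<and> fst d = i} \<noteq> {}" by (metis sum.empty less_irrefl)
  then show "\<exists>j. (i, j) \<in> D" by force
next
  assume "\<exists>j. (i, j) \<in> D"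
  then show "0 < base_weight i"
    using finite_D weights by (intro sum_pos) force+
qed

text \<open>The slice of K over (x + i) / N is covered by copies of the slice over x, scaled by 1 /
  M, one for each occupied cell of column i. A neighbouring column could interfere only on the
  common boundary, for x = 0 or x = 1. Then \<open>x0\<close> or \<open>x1\<close> makes i the first
  or last column, and there is no neighbour on the side in question.\<close>

lemma slice_length_map_le:
  assumes i: "0 < base_weight i" "i < N" and x: "0 \<le> x" "x \<le> 1"
    and x0: "x = 0 \<Longrightarrow> base_weight 0 = 1" and x1: "x = 1 \<Longrightarrow> base_weight (N - 1) = 1"
  shows "slice_length ((x + real i) / real N) \<le> ennreal (real (card {j. (i, j) \<in> D}) / real M) * slice_length x"
proof -
  let ?J = "{j. (i, j) \<in> D}"
  have M0: "0 < real M" using sizes by simp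
  have fin: "finite ?J" by (rule finite_subset[of _ "{..<M}"]) (use digits in auto)
  have sub: "{u. c ((x + real i) / real N) u \<in> K} \<subseteq> (\<Union>j\<in>?J. {u. real M * u - real j \<in> {v. c x v \<in> K}})"
  proof
    fix u assume "u \<in> {u. c ((x + real i) / real N) u \<in> K}"
    then have "c ((x + real i) / real N) u \<in> K" by simp
    then obtain d z where d: "d \<in> D" "z \<in> K" "(x + real i) / real N = (\<beta> z + real (fst d)) / real N"
        "u = (\<upsilon> z + real (snd d)) / real M" "fst d < N"
      by (rule K_digit) auto
    have eq: "x + real i = \<beta> z + real (fst d)" using d(3) sizes by simp
    have z: "0 \<le> \<beta> z" "\<beta> z \<le> 1" using K_unit[OF d(2)] by auto
    have pos: "0 < base_weight (fst d)" using d(1) base_weight_pos_iff[of "fst d"] by (metis prod.collapse)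
    have "fst d = i"
    proof (rule ccontr)
      assume ne: "fst d \<noteq> i"
      then consider "fst d < i" | "i < fst d" by linarith
      then show False
      proof cases
        case 1
        then have "real (fst d) + 1 \<le> real i" by linarith
        then have "x = 0" using eq x z by linarith
        then have "i = 0" using base.q_eq_0[OF x0, of i] i by force
        then show False using 1 by simp
      next
        case 2
        then have "real i + 1 \<le> real (fst d)" by linarith
        then have "x = 1" using eq x z by linarith
        then have "i = N - 1" using base.q_eq_0[OF x1, of i] i sizes by force
        then show False using 2 d(5) by simp
      qed
    qed
    moreover have "real M * u - real (snd d) = \<upsilon> z" using d(4) M0 by simp
    moreover have "c x (\<upsilon> z) = z" using eq \<open>fst d = i\<close> by simp
    ultimately show "u \<in> (\<Union>j\<in>?J. {u. real M * u - real j \<in> {v. c x v \<in> K}})"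
      using d(1,2) by (intro UN_I[of "snd d"]) auto
  qed
  have meas: "{u. real M * u - real j \<in> {v. c x v \<in> K}} \<in> sets borel" for j
    by measurable
  have "slice_length ((x + real i) / real N)
      \<le> emeasure lborel (\<Union>j\<in>?J. {u. real M * u - real j \<in> {v. c x v \<in> K}})"
    unfolding slice_length_def by (rule emeasure_mono[OF sub]) (use fin meas in auto)
  also have "\<dots> \<le> (\<Sum>j\<in>?J. emeasure lborel {u. real M * u - real j \<in> {v. c x v \<in> K}})"
    by (rule emeasure_subadditive_finite[OF fin]) (use meas in auto)
  also have "\<dots> = (\<Sum>j\<in>?J. slice_length x / ennreal (real M))"
    unfolding slice_length_def by (intro sum.cong refl emeasure_lborel_similar M0) simp
  also have "\<dots> = ennreal (real (card ?J) / real M) * slice_length x"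
    using M0 by (simp add: divide_ennreal[symmetric] ennreal_of_nat_eq_real_of_nat[symmetric]
        ennreal_times_divide ennreal_divide_times mult.commute)
  finally show ?thesis .
qed

text \<open>The strict inequality \<theta> < 1 comes from column i0: the cell (i0, j0) gives it
  positive weight, and the missing cell (i0, j1) makes its proportion of occupied cells less than
  1.\<close>

lemma slice_length_null:
  assumes hole: "(i0, j0) \<in> D" "j1 < M" "(i0, j1) \<notin> D"
  shows "AE s in marginal. slice_length s = 0"
proof -
  let ?n = "\<lambda>i. real (card {j. (i, j) \<in> D})"
  have M0: "0 < real M" using sizes by simp
  define \<theta> where "\<theta> = (\<Sum>i<N. base_weight i * (?n i / real M))"
  have J: "{j. (i, j) \<in> D} \<subseteq> {..<M}" for i using digits by auto
  have n_le: "?n i \<le> real M" for i using card_mono[OF _ J[of i]] by simp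
  have i0: "i0 < N" using hole digits by auto
  have "\<theta> < (\<Sum>i<N. base_weight i)"
    unfolding \<theta>_def
  proof (rule sum_strict_mono_ex1)
    show "\<forall>i\<in>{..<N}. base_weight i * (?n i / real M) \<le> base_weight i"
    proof
      fix i assume "i \<in> {..<N}"
      moreover have "?n i / real M \<le> 1" using n_le[of i] M0 by simp
      ultimately show "base_weight i * (?n i / real M) \<le> base_weight i"
        using mult_left_mono[of "?n i / real M" 1 "base_weight i"] base.q_nonneg by simp
    qed
    have "card {j. (i0, j) \<in> D} < card {..<M}"
      by (rule psubset_card_mono) (use J[of i0] hole in auto)
    then have "?n i0 / real M < 1" using M0 by simp
    moreover have "0 < base_weight i0" using base_weight_pos_iff hole by blast
    ultimately have "base_weight i0 * (?n i0 / real M) < base_weight i0 * 1"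
      by (rule mult_strict_left_mono)
    then show "\<exists>i\<in>{..<N}. base_weight i * (?n i / real M) < base_weight i" using i0 by auto
  qed simp
  then have \<theta>: "\<theta> < 1" by (simp add: base.q_sum)
  have \<theta>0: "0 \<le> \<theta>"
    unfolding \<theta>_def
  proof (rule sum_nonneg)
    fix i assume "i \<in> {..<N}"
    then have "0 \<le> base_weight i" by (intro base.q_nonneg) simp
    then show "0 \<le> base_weight i * (?n i / real M)" by (rule mult_nonneg_nonneg) simp
  qed
  have le1: "slice_length s \<le> 1" for s
  proof -
    have "slice_length s \<le> emeasure lborel {0..1::real}"
      unfolding slice_length_def
    proof (rule emeasure_mono)
      show "{u. c s u \<in> K} \<subseteq> {0..1}" using K_unit(2) by fastforce
    qed simp
    then show ?thesis by simp
  qed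
  define I where "I = (\<integral>\<^sup>+ s. slice_length s \<partial>marginal)"
  have "I \<le> (\<integral>\<^sup>+ s. 1 \<partial>marginal)" unfolding I_def by (intro nn_integral_mono le1)
  \<comment> \<open>Finiteness is essential: for infinite I the inequality I \<le> \<theta> I could
    not force I = 0.\<close>
  then have I1: "I \<le> 1" using base.emeasure_space_1 by simp
  then obtain r where r: "0 \<le> r" "I = ennreal r" using I1 by (cases I) (auto simp: top_unique)
  \<comment> \<open>The endpoint hypotheses of \<open>slice_length_map_le\<close> hold almost
    everywhere, as an endpoint is either null or has a column of weight 1.\<close>
  have ae: "AE x in marginal. (0 \<le> x \<and> x \<le> 1) \<and> (x = 0 \<longrightarrow> base_weight 0 = 1) \<and> (x = 1 \<longrightarrow> base_weight (N - 1) = 1)"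
  proof -
    have "AE x in marginal. x = 0 \<longrightarrow> base_weight 0 = 1"
      using base.atom_0
    proof
      assume "emeasure marginal {0} = 0"
      then have "AE x in marginal. x \<notin> {0}" by (intro AE_not_in) auto
      then show ?thesis by eventually_elim auto
    qed simp
    moreover have "AE x in marginal. x = 1 \<longrightarrow> base_weight (N - 1) = 1"
      using base.atom_1
    proof
      assume "emeasure marginal {1} = 0"
      then have "AE x in marginal. x \<notin> {1}" by (intro AE_not_in) auto
      then show ?thesis by eventually_elim auto
    qed simp
    ultimately show ?thesis using base.support by eventually_elim auto
  qed
  have "I = (\<Sum>i<N. ennreal (base_weight i) * (\<integral>\<^sup>+ x. slice_length ((x + real i) / real N) \<partial>marginal))"
    unfolding I_def by (rule base.nn_integral_similar) simp
  also have "\<dots> \<le> (\<Sum>i<N. ennreal (base_weight i) * (ennreal (?n i / real M) * I))"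
  proof (rule sum_mono)
    fix i assume "i \<in> {..<N}"
    then have i: "i < N" by simp
    show "ennreal (base_weight i) * (\<integral>\<^sup>+ x. slice_length ((x + real i) / real N) \<partial>marginal)
        \<le> ennreal (base_weight i) * (ennreal (?n i / real M) * I)"
    proof (cases "0 < base_weight i")
      case True
      have "(\<integral>\<^sup>+ x. slice_length ((x + real i) / real N) \<partial>marginal)
          \<le> (\<integral>\<^sup>+ x. ennreal (?n i / real M) * slice_length x \<partial>marginal)"
        by (rule nn_integral_mono_AE)
           (use ae in \<open>eventually_elim, use slice_length_map_le[OF True i] in blast\<close>)
      also have "\<dots> = ennreal (?n i / real M) * I"
        unfolding I_def by (rule nn_integral_cmult) simp
      finally show ?thesis by (rule mult_left_mono) simp
    next
      case False
      then show ?thesis using base.q_nonneg[OF i] by (simp add: ennreal_neg)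
    qed
  qed
  also have "\<dots> = (\<Sum>i<N. ennreal (base_weight i * (?n i / real M) * r))"
  proof (rule sum.cong[OF refl])
    fix i assume "i \<in> {..<N}"
    have mult: "ennreal x * (ennreal y * ennreal r) = ennreal (x * y * r)" if "0 \<le> x" "0 \<le> y" for x y
      using that r(1) by (simp add: ennreal_mult mult.assoc)
    show "ennreal (base_weight i) * (ennreal (?n i / real M) * I) = ennreal (base_weight i * (?n i / real M) * r)"
      unfolding r(2) by (rule mult) (use base.q_nonneg[of i] \<open>i \<in> {..<N}\<close> in simp_all)
  qed
  also have "\<dots> = ennreal (\<Sum>i<N. base_weight i * (?n i / real M) * r)"
    using base.q_nonneg r by (intro sum_ennreal) simp
  also have "\<dots> = ennreal (\<theta> * r)" by (simp add: \<theta>_def sum_distrib_right)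
  finally have "r \<le> \<theta> * r" using r \<theta>0 by simp
  then have "(1 - \<theta>) * r \<le> 0" by (simp add: algebra_simps)
  then have "r = 0" using \<theta> r(1) by (simp add: mult_le_0_iff)
  then have "(\<integral>\<^sup>+ s. slice_length s \<partial>marginal) = 0" using r I_def by simp
  then show ?thesis by (subst (asm) nn_integral_0_iff_AE) auto
qed

text \<open>The slice of K itself separates the two measures: it carries \<rho> s for almost every s
  and almost always has length 0.\<close>

theorem singular_slices:
  assumes "(i0, j0) \<in> D" "j1 < M" "(i0, j1) \<notin> D"
  shows "AE s in marginal. lebesgue_singular (\<rho> s)"
proof -
  have "AE s in marginal. AE u in \<rho> s. c s u \<in> K"
    by (rule disintegrate_AE[OF _ AE_K]) simp
  then show ?thesis
    using slice_length_null[OF assms]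
  proof eventually_elim
    case (elim s)
    have "emeasure (\<rho> s) (- {u. c s u \<in> K}) = 0"
      using elim(1) by (subst (asm) AE_iff_measurable[of "- {u. c s u \<in> K}"]) auto
    then show ?case
      unfolding lebesgue_singular_def using elim(2)
      by (intro bexI[of _ "{u. c s u \<in> K}"]) (auto simp: slice_length_def)
  qed
qed

theorem slices_and_expansions:
  assumes "(i0, j0) \<in> D" "j1 < M" "(i0, j1) \<notin> D"
  shows "(AE s in marginal. lebesgue_singular (\<rho> s)) \<and>
    (lebesgue_singular marginal \<or> marginal = lebesgue_unit) \<and>
    (lebesgue_singular marginal \<longrightarrow>
      (\<forall>f\<in>L2 \<mu>. \<exists>d. L2_iterated_sums \<mu> (\<lambda>k l z. d k l * expi (of_nat k * \<upsilon> z + of_nat l * \<beta> z)) f)) \<and>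
    (marginal = lebesgue_unit \<longrightarrow>
      (\<forall>f\<in>L2 \<mu>. \<exists>d. L2_iterated_sums_bilateral \<mu> (\<lambda>k l z. d k l * expi (of_nat k * \<upsilon> z + of_int l * \<beta> z)) f))"
proof -
  have slices: "AE s in marginal. circle_measure (\<rho> s) \<and> lebesgue_singular (\<rho> s)"
    using circle_measure_slices singular_slices[OF assms] by eventually_elim auto
  show ?thesis
    using singular_slices[OF assms] base.singular_or_lebesgue
      iterated_expansion[OF _ slices base.circle_measure_\<nu>] iterated_expansion_bilateral[OF _ slices]
    by blast
qed

end

section \<open>The weight conditions\<close>

lemma finite_ones: "finite (ones m n t)"
  by (rule finite_subset[of _ "{..<n} \<times> {..<m}"]) (auto simp: ones_def)

lemma powr_ln_divide_ln: "1 < a \<Longrightarrow> 0 < b \<Longrightarrow> a powr (ln b / ln a) = (b::real)"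
  by (simp add: powr_def)

text \<open>If all r nonempty columns are full, every row contains r ones. With \<alpha> = ln m / ln
  n this gives \<xi>1 = (m r^\<alpha>)^(1/\<alpha>) = n r, because m^(1/\<alpha>) = n; so the
  hypothesis bounds each of the r column weights by a number below 1 / r, although they add up to
  1.\<close>

lemma column_hole:
  assumes "2 \<le> m" "m \<le> n" "(\<Sum>(i, j)\<in>ones m n t. p i j) = 1"
    and gamma: "max_column_weight m n t p < real n / xi1 m n t"
  obtains i j j' where "(i, j) \<in> ones m n t" "j' < m" "(i, j') \<notin> ones m n t"
proof -
  have "\<exists>i j j'. (i, j) \<in> ones m n t \<and> j' < m \<and> (i, j') \<notin> ones m n t"
  proof (rule ccontr)
    assume "\<not> ?thesis"
    then have full: "(i, j) \<in> ones m n t \<Longrightarrow> j' < m \<Longrightarrow> (i, j') \<in> ones m n t" for i j j' by blast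
    define C where "C = fst ` ones m n t"
    define r where "r = card C"
    have C: "finite C" "C \<subseteq> {..<n}" using finite_ones by (auto simp: C_def ones_def)
    have "ones m n t \<noteq> {}" using assms(3) by auto
    then have r: "0 < r" using C by (auto simp: r_def C_def card_gt_0_iff)
    have ones: "(i, j) \<in> ones m n t \<longleftrightarrow> i \<in> C \<and> j < m" for i j
      using full by (auto simp: C_def image_iff ones_def)
    have "{i. i < n \<and> t i j = 1} = C" if "j < m" for j
      using ones[of _ j] that by (auto simp: ones_def)
    then have row: "row_count n t j = r" if "j < m" for j using that by (simp add: row_count_def r_def)
    define \<alpha> where "\<alpha> = ln (real m) / ln (real n)"
    have mn: "1 < real m" "1 < real n" using assms by auto
    then have \<alpha>: "\<alpha> > 0" "ln (real n) / ln (real m) = 1 / \<alpha>" by (auto simp: \<alpha>_def)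
    have "xi1 m n t = (real m * real r powr \<alpha>) powr (1 / \<alpha>)"
      unfolding xi1_def by (simp add: row \<alpha>_def)
    also have "\<dots> = real m powr (1 / \<alpha>) * (real r powr \<alpha>) powr (1 / \<alpha>)"
      by (rule powr_mult)
    also have "real m powr (1 / \<alpha>) = real n"
      unfolding \<alpha>(2)[symmetric] using mn by (intro powr_ln_divide_ln) auto
    also have "(real r powr \<alpha>) powr (1 / \<alpha>) = real r"
      using \<alpha>(1) r by (simp add: powr_powr)
    finally have bound: "max_column_weight m n t p < 1 / real r" using gamma mn by simp
    let ?W = "\<lambda>i. \<Sum>j | j < m \<and> t i j = 1. p i j"
    have "1 = (\<Sum>i\<in>C. \<Sum>j<m. p i j)"
    proof -
      have "ones m n t = C \<times> {..<m}" using ones by auto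
      then show ?thesis using assms(3) by (simp add: sum.cartesian_product)
    qed
    also have "\<dots> = (\<Sum>i\<in>C. ?W i)"
    proof (rule sum.cong[OF refl])
      fix i assume "i \<in> C"
      then have "{j. j < m \<and> t i j = 1} = {..<m}" using ones[of i] by (auto simp: ones_def)
      then show "(\<Sum>j<m. p i j) = ?W i" by simp
    qed
    also have "\<dots> \<le> (\<Sum>i\<in>C. max_column_weight m n t p)"
      unfolding max_column_weight_def using C by (intro sum_mono Max_ge) auto
    also have "\<dots> = real r * max_column_weight m n t p" by (simp add: r_def)
    also have "\<dots> < real r * (1 / real r)" using bound r by (intro mult_strict_left_mono) auto
    also have "\<dots> = 1" using r by simp
    finally show False by simp
  qed
  then show ?thesis using that by blast
qed

text \<open>If all r nonempty rows are full, each contributes n^\<alpha> = m to \<xi>2, where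
  \<alpha> = ln m / ln n, and the empty rows contribute 0. Thus \<xi>2 = r m, and again r weights
  below 1 / r would have to add up to 1.\<close>

lemma row_hole:
  assumes "2 \<le> m" "m \<le> n" "(\<Sum>(i, j)\<in>ones m n t. p i j) = 1"
    and gamma: "max_row_weight m n t p < real m / xi2 m n t"
  obtains i j i' where "(i, j) \<in> ones m n t" "i' < n" "(i', j) \<notin> ones m n t"
proof -
  have "\<exists>i j i'. (i, j) \<in> ones m n t \<and> i' < n \<and> (i', j) \<notin> ones m n t"
  proof (rule ccontr)
    assume "\<not> ?thesis"
    then have full: "(i, j) \<in> ones m n t \<Longrightarrow> i' < n \<Longrightarrow> (i', j) \<in> ones m n t" for i j i' by blast
    define R where "R = snd ` ones m n t"
    define r where "r = card R"
    have R: "finite R" "R \<subseteq> {..<m}" using finite_ones by (auto simp: R_def ones_def)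
    have "ones m n t \<noteq> {}" using assms(3) by auto
    then have r: "0 < r" using R by (auto simp: r_def R_def card_gt_0_iff)
    have ones: "(i, j) \<in> ones m n t \<longleftrightarrow> i < n \<and> j \<in> R" for i j
      using full by (force simp: R_def image_iff ones_def)
    have "{i. i < n \<and> t i j = 1} = (if j \<in> R then {..<n} else {})" if "j < m" for j
      using ones[of _ j] that by (auto simp: ones_def)
    then have row: "row_count n t j = (if j \<in> R then n else 0)" if "j < m" for j
      using that by (simp add: row_count_def)
    have mn: "1 < real m" "1 < real n" using assms by auto
    have "xi2 m n t = (\<Sum>j<m. if j \<in> R then real m else 0)"
      unfolding xi2_def using mn by (intro sum.cong refl) (simp add: row powr_ln_divide_ln)
    also have "\<dots> = real r * real m"
      using R by (simp add: sum.If_cases Int_absorb1 r_def)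
    finally have bound: "max_row_weight m n t p < 1 / real r" using gamma mn by simp
    let ?W = "\<lambda>j. \<Sum>i | i < n \<and> t i j = 1. p i j"
    have "1 = (\<Sum>j\<in>R. \<Sum>i<n. p i j)"
    proof -
      have "ones m n t = {..<n} \<times> R" using ones by auto
      then have "1 = (\<Sum>i<n. \<Sum>j\<in>R. p i j)" using assms(3) by (simp add: sum.cartesian_product)
      then show ?thesis by (subst sum.swap) simp
    qed
    also have "\<dots> = (\<Sum>j\<in>R. ?W j)"
    proof (rule sum.cong[OF refl])
      fix j assume "j \<in> R"
      then have "{i. i < n \<and> t i j = 1} = {..<n}" using ones[of _ j] by (auto simp: ones_def)
      then show "(\<Sum>i<n. p i j) = ?W j" by simp
    qed
    also have "\<dots> \<le> (\<Sum>j\<in>R. max_row_weight m n t p)"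
      unfolding max_row_weight_def using R by (intro sum_mono Max_ge) auto
    also have "\<dots> = real r * max_row_weight m n t p" by (simp add: r_def)
    also have "\<dots> < real r * (1 / real r)" using bound r by (intro mult_strict_left_mono) auto
    also have "\<dots> = 1" using r by simp
    finally show False by simp
  qed
  then show ?thesis using that by blast
qed

theorem corollary2:
  fixes m n :: nat
    and t :: "nat \<Rightarrow> nat \<Rightarrow> nat"
    and p :: "nat \<Rightarrow> nat \<Rightarrow> real"
    and K :: "(real \<times> real) set"
    and \<mu> :: "(real \<times> real) measure"
    and \<rho> \<sigma> :: "real \<Rightarrow> real measure"
  assumes "2 \<le> m" and "m \<le> n"
    and "\<forall>i<n. \<forall>j<m. t i j \<in> {0, 1}"
    and "is_attractor m n t K"
    and "\<forall>(i, j)\<in>ones m n t. p i j > 0"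
    and "(\<Sum>(i, j)\<in>ones m n t. p i j) = 1"
    and "is_invariant_measure m n t p K \<mu>"
    and "is_disintegration (\<lambda>x y. (x, y)) \<mu> (x_marginal \<mu>) \<rho>"
    and "is_disintegration (\<lambda>y x. (x, y)) \<mu> (y_marginal \<mu>) \<sigma>"
  shows
    "(max_column_weight m n t p < real n / xi1 m n t \<longrightarrow>
        (AE x in x_marginal \<mu>. lebesgue_singular (\<rho> x)) \<and>
        (lebesgue_singular (x_marginal \<mu>) \<or> x_marginal \<mu> = lebesgue_unit) \<and>
        (lebesgue_singular (x_marginal \<mu>) \<longrightarrow>
          (\<forall>f\<in>L2 \<mu>. \<exists>d :: nat \<Rightarrow> nat \<Rightarrow> complex.
             L2_iterated_sums \<mu>
               (\<lambda>k l (x, y). d k l * expi (of_nat k * y + of_nat l * x)) f)) \<and>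
        (x_marginal \<mu> = lebesgue_unit \<longrightarrow>
          (\<forall>f\<in>L2 \<mu>. \<exists>d :: nat \<Rightarrow> int \<Rightarrow> complex.
             L2_iterated_sums_bilateral \<mu>
               (\<lambda>k l (x, y). d k l * expi (of_nat k * y + of_int l * x)) f)))
     \<and>
     (max_row_weight m n t p < real m / xi2 m n t \<longrightarrow>
        (AE y in y_marginal \<mu>. lebesgue_singular (\<sigma> y)) \<and>
        (lebesgue_singular (y_marginal \<mu>) \<or> y_marginal \<mu> = lebesgue_unit) \<and>
        (lebesgue_singular (y_marginal \<mu>) \<longrightarrow>
          (\<forall>f\<in>L2 \<mu>. \<exists>d :: nat \<Rightarrow> nat \<Rightarrow> complex.
             L2_iterated_sums \<mu>
               (\<lambda>k l (x, y). d k l * expi (of_nat k * x + of_nat l * y)) f)) \<and>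
        (y_marginal \<mu> = lebesgue_unit \<longrightarrow>
          (\<forall>f\<in>L2 \<mu>. \<exists>d :: nat \<Rightarrow> int \<Rightarrow> complex.
             L2_iterated_sums_bilateral \<mu>
               (\<lambda>k l (x, y). d k l * expi (of_nat k * x + of_int l * y)) f)))"
proof -
  have prob: "prob_space \<mu>" and sets: "sets \<mu> = sets borel" and null: "emeasure \<mu> (- K) = 0"
    and inv: "\<And>f :: real \<times> real \<Rightarrow> complex. continuous_on UNIV f \<Longrightarrow>
      (\<integral>z. f z \<partial>\<mu>) = (\<Sum>(i, j)\<in>ones m n t. of_real (p i j) * (\<integral>z. f (tau m n i j z) \<partial>\<mu>))"
    using assms(7) by (auto simp: is_invariant_measure_def)
  have K: "compact K" "K = (\<Union>(i, j)\<in>ones m n t. tau m n i j ` K)"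
    using assms(4) by (simp_all add: is_attractor_def)
  have m: "2 \<le> m" and n: "2 \<le> n" using assms by auto
  have swap: "(\<Sum>d\<in>prod.swap ` ones m n t. F d) = (\<Sum>(i, j)\<in>ones m n t. F (j, i))" for F :: "nat \<times> nat \<Rightarrow> 'c :: comm_monoid_add"
    by (subst sum.reindex) (simp_all add: comp_def case_prod_unfold prod.swap_def[abs_def] inj_on_def prod_eq_iff)
  show ?thesis
  proof ((rule conjI; rule impI), goal_cases)
    case 1
    then obtain i j j' where hole: "(i, j) \<in> ones m n t" "j' < m" "(i, j') \<notin> ones m n t"
      using column_hole[OF assms(1,2,6)] by blast
    interpret carpet \<mu> "\<lambda>x y. (x, y)" fst snd \<rho> n m "ones m n t" "\<lambda>(i, j). p i j" "\<lambda>(i, j). tau m n i j" K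
    proof (intro carpet.intro carpet_axioms.intro prob sets null m n K(1))
      show "ones m n t \<subseteq> {..<n} \<times> {..<m}" by (auto simp: ones_def)
      show "K = (\<Union>d\<in>ones m n t. (case d of (i, j) \<Rightarrow> tau m n i j) ` K)"
        using K(2) by (simp add: case_prod_unfold)
      show "(\<integral>z. f z \<partial>\<mu>) = (\<Sum>d\<in>ones m n t. of_real (case d of (i, j) \<Rightarrow> p i j) *
          (\<integral>z. f ((case d of (i, j) \<Rightarrow> tau m n i j) z) \<partial>\<mu>))"
        if "continuous_on UNIV f" for f :: "real \<times> real \<Rightarrow> complex"
        using inv[OF that] by (simp add: case_prod_unfold)
    qed (use assms in \<open>auto simp: tau_def add_divide_distrib intro!: continuous_intros\<close>)
    show ?case using slices_and_expansions[OF hole] by (simp add: case_prod_unfold)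
  next
    case 2
    then obtain i j i' where hole: "(i, j) \<in> ones m n t" "i' < n" "(i', j) \<notin> ones m n t"
      using row_hole[OF assms(1,2,6)] by blast
    \<comment> \<open>Horizontal slices have the second axis as base, so the digit pairs are swapped
      to (row, column) and the two sizes are exchanged.\<close>
    interpret carpet \<mu> "\<lambda>y x. (x, y)" snd fst \<sigma> m n "prod.swap ` ones m n t" "\<lambda>(j, i). p i j" "\<lambda>(j, i). tau m n i j" K
    proof (intro carpet.intro carpet_axioms.intro prob sets null m n K(1))
      show "prod.swap ` ones m n t \<subseteq> {..<m} \<times> {..<n}" by (auto simp: ones_def)
      show "K = (\<Union>d\<in>prod.swap ` ones m n t. (case d of (j, i) \<Rightarrow> tau m n i j) ` K)"
        using K(2) by (simp add: case_prod_unfold)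
      show "(\<Sum>d\<in>prod.swap ` ones m n t. case d of (j, i) \<Rightarrow> p i j) = 1"
        using assms(6) by (simp add: swap)
      show "(\<integral>z. f z \<partial>\<mu>) = (\<Sum>d\<in>prod.swap ` ones m n t. of_real (case d of (j, i) \<Rightarrow> p i j) *
          (\<integral>z. f ((case d of (j, i) \<Rightarrow> tau m n i j) z) \<partial>\<mu>))"
        if "continuous_on UNIV f" for f :: "real \<times> real \<Rightarrow> complex"
        using inv[OF that] by (simp add: swap case_prod_unfold)
    qed (use assms in \<open>auto simp: tau_def add_divide_distrib intro!: continuous_intros\<close>)
    have "(j, i) \<in> prod.swap ` ones m n t" "(j, i') \<notin> prod.swap ` ones m n t"
      using hole by force+
    from slices_and_expansions[OF this(1) hole(2) this(2)] show ?case
      by (simp add: case_prod_unfold)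
  qed
qed

end
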